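(* Let $u\in\mathcal{C}^3(\mathbb{T})$ be bell shaped. There exists $C>0$ such that for every integer $N\ge1$ and every $\delta>0$ there exist $C_N(\delta)>0$ and $\varepsilon_0(\delta)>0$ such that if $0<\varepsilon<\varepsilon_0(\delta)$, then the following holds, where $\lambda_n=\lambda_n(u;\varepsilon)$ are the eigenvalues of the Lax operator $L_u(\varepsilon)$ and $\gamma_n=\gamma_n(u;\varepsilon)$ the associated gaps. 1. For every $n\ge0$, \[ \left|\int_{-\lambda_n}^{\max(u)}F(\eta)\,d\eta-n\varepsilon\right|\le\frac{C}{N\sqrt N}+C_N(\delta)\varepsilon\sqrt\varepsilon+C\delta. \] 2. (Large eigenvalues) If $\lambda_n+\varepsilon\in\Lambda_+(\delta)=[-\min(u)+\delta,+\infty)$, then \[ \sum_{k=n+1}^\infty\gamma_k\le\frac{C}{N\sqrt N}+C_N(\delta)\varepsilon\sqrt\varepsilon+C\delta. \] 3. (Two-region eigenvalues) If $\lambda_n+\varepsilon\in\Lambda_-(\delta)=[-\max(u)+\delta,-\min(u)-\delta]$ and $\lambda_p+\varepsilon\in\Lambda_+(\delta)=[-\min(u)+\delta,+\infty)$, then $|p-n|\ge\dfrac{\delta}{C\varepsilon}$.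
   Context: $\mathbb{T}=\mathbb{R}/2\pi\mathbb{Z}$. A function $u\in\mathcal{C}^3(\mathbb{T})$ is bell shaped if (1) it is real valued with zero mean; (2)-(3) with $x_{\min}=0$, there is $x_{\max}\in(0,2\pi)$ such that $u'>0$ on $(0,x_{\max})$ and $u'<0$ on $(x_{\max},2\pi)$; (4) there are exactly two inflection points $\xi_-\in(0,x_{\max})$, $\xi_+\in(x_{\max},2\pi)$ with $u''(\xi_\pm)=0$, and $u'''(\xi_\pm)\ne0$. $L^2_+(\mathbb{T})$ is the space of $L^2$ functions with only nonnegative Fourier modes, $\Pi:L^2(\mathbb{T})\to L^2_+(\mathbb{T})$ the orthogonal (Szegő) projector, and $L_u(\varepsilon)h=-i\varepsilon\partial_xh-\Pi(uh)$ on $L^2_+(\mathbb{T})$. Its eigenvalues, which are simple, are listed in increasing order $\lambda_0(u;\varepsilon)<\lambda_1(u;\varepsilon)<\dots$. The gaps are $\gamma_n(u;\varepsilon)=\lambda_n(u;\varepsilon)-\lambda_{n-1}(u;\varepsilon)-\varepsilon\ge0$ for $n\ge1$. The distribution function is $F(\eta)=\frac1{2\pi}\mathrm{Leb}\{x\in[0,2\pi]:u(x)\ge\eta\}$. The constants $C$, $C_N(\delta)$, $\varepsilon_0(\delta)$ may depend on $u$. *)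

theory Defs
  imports "HOL-Analysis.Analysis"
begin

text \<open>
  Functions on \<open>\<real>/2\<pi>\<int>\<close> that are defined everywhere (such as \<open>u\<close>) are
  \<open>2\<pi>\<close>-periodic functions on \<open>\<real>\<close>; elements of \<open>L\<^sup>2\<close> are represented by their
  restrictions to \<open>[0, 2\<pi>]\<close>, and equality in \<open>L\<^sup>2\<close> is equality almost everywhere.
\<close>

definition C3_periodic :: "(real \<Rightarrow> real) \<Rightarrow> bool" where
  "C3_periodic u \<longleftrightarrow>
     (\<forall>x. u (x + 2 * pi) = u x) \<and>
     (\<forall>j<3. \<forall>x. (deriv ^^ j) u differentiable (at x)) \<and>
     continuous_on UNIV ((deriv ^^ 3) u)"

text \<open>A point where the concavity changes, i.e. where \<open>u''\<close> changes sign.\<close>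

definition inflection_point :: "(real \<Rightarrow> real) \<Rightarrow> real \<Rightarrow> bool" where
  "inflection_point u x \<longleftrightarrow>
     (\<exists>e>0. (\<forall>y\<in>{x-e<..<x}. (deriv ^^ 2) u y < 0) \<and> (\<forall>y\<in>{x<..<x+e}. (deriv ^^ 2) u y > 0)) \<or>
     (\<exists>e>0. (\<forall>y\<in>{x-e<..<x}. (deriv ^^ 2) u y > 0) \<and> (\<forall>y\<in>{x<..<x+e}. (deriv ^^ 2) u y < 0))"

definition bell_shaped :: "(real \<Rightarrow> real) \<Rightarrow> bool" where
  "bell_shaped u \<longleftrightarrow>
     C3_periodic u \<and>
     (LBINT x:{0..2*pi}. u x) = 0 \<and>
     (\<exists>xmax\<in>{0<..<2*pi}.
        (\<forall>x\<in>{0<..<xmax}. deriv u x > 0) \<and>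
        (\<forall>x\<in>{xmax<..<2*pi}. deriv u x < 0) \<and>
        (\<exists>\<xi>m\<in>{0<..<xmax}. \<exists>\<xi>p\<in>{xmax<..<2*pi}.
           {x\<in>{0..<2*pi}. inflection_point u x} = {\<xi>m, \<xi>p} \<and>
           (deriv ^^ 2) u \<xi>m = 0 \<and> (deriv ^^ 2) u \<xi>p = 0 \<and>
           (deriv ^^ 3) u \<xi>m \<noteq> 0 \<and> (deriv ^^ 3) u \<xi>p \<noteq> 0))"

definition torus :: "real measure" where
  "torus = restrict_space lborel {0..2*pi}"

definition L2_torus :: "(real \<Rightarrow> complex) set" where
  "L2_torus = {f. f \<in> borel_measurable torus \<and> integrable torus (\<lambda>x. (cmod (f x))\<^sup>2)}"

definition L2_inner :: "(real \<Rightarrow> complex) \<Rightarrow> (real \<Rightarrow> complex) \<Rightarrow> complex" where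
  "L2_inner f g = (\<integral>x. f x * cnj (g x) \<partial>torus)"

definition fourier_coeff :: "(real \<Rightarrow> complex) \<Rightarrow> int \<Rightarrow> complex" where
  "fourier_coeff f k = (\<integral>x. f x * cis (- (of_int k * x)) \<partial>torus) / of_real (2 * pi)"

definition L2_plus :: "(real \<Rightarrow> complex) set" where
  "L2_plus = {f \<in> L2_torus. \<forall>k<0. fourier_coeff f k = 0}"

text \<open>The orthogonal projection; the chosen representative is unique up to null sets.\<close>

definition szego :: "(real \<Rightarrow> complex) \<Rightarrow> real \<Rightarrow> complex" where
  "szego f = (SOME g. g \<in> L2_plus \<and> (\<forall>h\<in>L2_plus. L2_inner (\<lambda>x. f x - g x) h = 0))"

text \<open>
  \<open>g\<close> is the derivative of \<open>h\<close> in the sense of periodic distributions, and belongs to \<open>L\<^sup>2\<close>.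
\<close>

definition is_weak_deriv :: "(real \<Rightarrow> complex) \<Rightarrow> (real \<Rightarrow> complex) \<Rightarrow> bool" where
  "is_weak_deriv h g \<longleftrightarrow>
     g \<in> L2_torus \<and> (\<forall>k. fourier_coeff g k = \<i> * of_int k * fourier_coeff h k)"

definition weak_deriv :: "(real \<Rightarrow> complex) \<Rightarrow> real \<Rightarrow> complex" where
  "weak_deriv h = (SOME g. is_weak_deriv h g)"

text \<open>The domain of the (unbounded, self-adjoint) Lax operator: the Hardy-Sobolev space
  \<open>H\<^sup>1 \<inter> L\<^sup>2\<^sub>+\<close>.\<close>

definition H1_plus :: "(real \<Rightarrow> complex) set" where
  "H1_plus = {h \<in> L2_plus. \<exists>g. is_weak_deriv h g}"

definition lax :: "(real \<Rightarrow> real) \<Rightarrow> real \<Rightarrow> (real \<Rightarrow> complex) \<Rightarrow> real \<Rightarrow> complex" where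
  "lax u \<epsilon> h = (\<lambda>x. - \<i> * of_real \<epsilon> * weak_deriv h x - szego (\<lambda>y. of_real (u y) * h y) x)"

definition lax_eigenvalues :: "(real \<Rightarrow> real) \<Rightarrow> real \<Rightarrow> real set" where
  "lax_eigenvalues u \<epsilon> =
     {\<mu>. \<exists>h\<in>H1_plus. \<not> (AE x in torus. h x = 0) \<and>
            (AE x in torus. lax u \<epsilon> h x = of_real \<mu> * h x)}"

text \<open>
  The eigenvalues are simple, so they are listed without repetition; for \<open>u\<close> bounded and
  \<open>\<epsilon> > 0\<close> they form an infinite discrete set bounded below, whose increasing enumeration
  exists and is unique.
\<close>

definition lax_ev :: "(real \<Rightarrow> real) \<Rightarrow> real \<Rightarrow> nat \<Rightarrow> real" where
  "lax_ev u \<epsilon> = (THE l. strict_mono l \<and> range l = lax_eigenvalues u \<epsilon>)"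

text \<open>Only meaningful for \<open>n \<ge> 1\<close>.\<close>

definition gap :: "(real \<Rightarrow> real) \<Rightarrow> real \<Rightarrow> nat \<Rightarrow> real" where
  "gap u \<epsilon> n = lax_ev u \<epsilon> n - lax_ev u \<epsilon> (n - 1) - \<epsilon>"

definition distrib_fun :: "(real \<Rightarrow> real) \<Rightarrow> real \<Rightarrow> real" where
  "distrib_fun u \<eta> = measure lborel {x\<in>{0..2*pi}. u x \<ge> \<eta>} / (2 * pi)"

definition Lambda_plus :: "(real \<Rightarrow> real) \<Rightarrow> real \<Rightarrow> real set" where
  "Lambda_plus u \<delta> = {- (INF x. u x) + \<delta>..}"

definition Lambda_minus :: "(real \<Rightarrow> real) \<Rightarrow> real \<Rightarrow> real set" where
  "Lambda_minus u \<delta> = {- (SUP x. u x) + \<delta> .. - (INF x. u x) - \<delta>}"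

end

theory Submission
  imports Defs "HOL-Complex_Analysis.Great_Picard" "HOL-Library.Nat_Bijection"
begin

text \<open>
  In the basis \<open>exp (i j x)\<close>, \<open>j \<ge> 0\<close>, the Lax operator is the matrix
  \<open>\<epsilon> j [j = k] - c (j - k)\<close>, where \<open>c\<close> are the Fourier coefficients of \<open>u\<close>; it is approximated by
  its finite truncations. Since the Toeplitz part commutes with the shift up to the first coordinate,
  the min-max principle gives \<open>\<lambda>\<^sub>n + \<epsilon> \<le> \<lambda>\<^sub>n\<^sub>+\<^sub>1\<close>, and the traces of the
  truncations give \<open>\<lambda>\<^sub>n \<le> n \<epsilon>\<close>.

  On the right-hand sides the term \<open>C \<delta>\<close> is available for every \<open>\<delta>\<close> with an
  \<open>\<epsilon>\<^sub>0\<close> that depends only on \<open>\<delta>\<close>, so no rate of convergence is needed: it suffices that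
  \<open>\<integral> F - n \<epsilon>\<close> tends to \<open>0\<close> uniformly in \<open>n\<close>. The integral of \<open>F\<close> over
  \<open>[-\<lambda>, max u]\<close> is the mean of the positive part of \<open>\<lambda> + u\<close>, so this is a Weyl law. It is proved
  by cutting the indices into blocks of a fixed length \<open>B\<close>, on which \<open>\<epsilon> j\<close> is nearly constant, and
  removing a few coordinates per block: the band-limited Toeplitz form of what remains is diagonalised
  exactly by the discrete Fourier transform of length \<open>B\<close>, so that the eigenvalues are counted by the
  lattice points \<open>(b, r)\<close> with \<open>\<epsilon> b B - u (2 \<pi> r / B) \<le> \<lambda>\<close>. Large \<open>n\<close> are reached from
  bounded ones by the gap inequality together with \<open>\<lambda>\<^sub>n \<le> n \<epsilon>\<close>.
  The second and third claims follow from the first, because \<open>\<integral> F = \<lambda>\<close> for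
  \<open>\<lambda> \<ge> - min u\<close> and the gaps telescope.
\<close>

section \<open>Finite Hermitian matrices\<close>

text \<open>The unbounded operator is only met through its compressions to the first
  \<open>n\<close> modes. These are nested Hermitian matrices whose \<open>k\<close>-th eigenvalues
  decrease in \<open>n\<close> and are bounded below, so they converge; what has to be shown is that
  the limits are exactly the eigenvalues of the operator. Truncated eigenvectors lose no mass to
  high modes because their diagonal energy is bounded, so every limit is an eigenvalue. Conversely,
  a cut-off eigenfunction leaves a residual controlled by the tail of its coefficients.

  In the Weyl law, decoupling the blocks costs \<open>M\<close> constraints per block,
  \<open>M\<close> being the bandwidth of the truncated Fourier series. Energies below
  \<open>Y\<close> occupy about \<open>Y / (\<epsilon> B)\<close> blocks, so in the scale
  \<open>n \<epsilon>\<close> the cost is about \<open>M Y / B\<close>, whatever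
  \<open>\<epsilon>\<close> is. Hence the order of choices: \<open>M\<close> from the accuracy, then
  \<open>B\<close> much larger than \<open>M\<close>, and only then \<open>\<epsilon>\<close>, small
  enough that a block has small width \<open>\<epsilon> B\<close>. This is uniform only for energies
  below a fixed bound, which is why large \<open>n\<close> needs a separate argument.\<close>

lemma underdetermined_system:
  fixes J :: "('i \<Rightarrow> complex) set"
  assumes "finite J" "finite I" "card J < card I"
  obtains c where "\<exists>i\<in>I. c i \<noteq> 0" "\<forall>a\<in>J. (\<Sum>i\<in>I. a i * c i) = 0"
proof -
  have "\<exists>c. (\<exists>i\<in>I. c i \<noteq> 0) \<and> (\<forall>a\<in>J. (\<Sum>i\<in>I. a i * c i) = 0)"
    using assms
  proof (induction "card J" arbitrary: J I rule: less_induct)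
    case less
    show ?case
    proof (cases "J = {}")
      case True
      then obtain i where "i \<in> I" using less.prems by (metis card_gt_0_iff card.empty ex_in_conv)
      then show ?thesis using True by (intro exI[of _ "\<lambda>_. 1"]) auto
    next
      case False
      then obtain a where "a \<in> J" by blast
      then obtain J' where J: "J = insert a J'" "a \<notin> J'" by (rule mk_disjoint_insert[THEN exE]) blast
      then have fJ': "finite J'" "card J' < card J" using less.prems by auto
      show ?thesis
      proof (cases "\<exists>i0\<in>I. a i0 \<noteq> 0")
        case False
        have "card J' < card I" using fJ' less.prems by linarith
        then obtain c where "\<exists>i\<in>I. c i \<noteq> 0" "\<forall>a\<in>J'. (\<Sum>i\<in>I. a i * c i) = 0"
          using less.hyps[OF fJ'(2) fJ'(1) less.prems(2)] by blast
        then show ?thesis using False J by (intro exI[of _ c]) auto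
      next
        case True
        then obtain i0 where i0: "i0 \<in> I" "a i0 \<noteq> 0" by auto
        \<comment> \<open>Gaussian elimination: each remaining equation is reduced by a multiple of
          \<open>a\<close> so that its coefficient at \<open>i0\<close> vanishes. Reduced equations
          may coincide, hence the inequality between the cardinalities.\<close>
        define J2 where "J2 = (\<lambda>b i. b i - b i0 / a i0 * a i) ` J'"
        have cJ2: "card J2 \<le> card J'" "finite J2" using fJ' by (auto simp: J2_def card_image_le)
        have cI: "card (I - {i0}) = card I - 1" using i0 less.prems by simp
        obtain c where c: "\<exists>i\<in>I - {i0}. c i \<noteq> 0"
            "\<And>b. b\<in>J2 \<Longrightarrow> (\<Sum>i\<in>I - {i0}. b i * c i) = 0"
        proof -
          have "card J2 < card (I - {i0})" using fJ' cJ2 cI less.prems by linarith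
          moreover have "card J2 < card J" "finite (I - {i0})" using cJ2 fJ' less.prems by auto
          ultimately show thesis using less.hyps[of J2 "I - {i0}"] cJ2(2) that by blast
        qed
        define s where "s = (\<Sum>i\<in>I - {i0}. a i * c i)"
        define d where "d = c(i0 := - s / a i0)"
        have split: "(\<Sum>i\<in>I. b i * d i) = - b i0 * s / a i0 + (\<Sum>i\<in>I - {i0}. b i * c i)" for b
        proof -
          have "(\<Sum>i\<in>I. b i * d i) = b i0 * d i0 + (\<Sum>i\<in>I - {i0}. b i * d i)"
            using i0 less.prems by (simp add: sum.remove)
          also have "(\<Sum>i\<in>I - {i0}. b i * d i) = (\<Sum>i\<in>I - {i0}. b i * c i)"
            by (intro sum.cong) (auto simp: d_def)
          finally show ?thesis by (simp add: d_def)
        qed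
        have "(\<Sum>i\<in>I. a i * d i) = 0" unfolding split using i0 by (simp add: s_def)
        moreover have "(\<Sum>i\<in>I. b i * d i) = 0" if "b \<in> J'" for b
        proof -
          have "(\<lambda>i. b i - b i0 / a i0 * a i) \<in> J2" using that by (auto simp: J2_def)
          from c(2)[OF this] have "(\<Sum>i\<in>I - {i0}. b i * c i) - b i0 / a i0 * s = 0"
            by (simp add: s_def left_diff_distrib sum_subtractf sum_distrib_left mult.assoc)
          then show ?thesis unfolding split by simp
        qed
        moreover have "\<exists>i\<in>I. d i \<noteq> 0" using c(1) by (auto simp: d_def)
        ultimately show ?thesis using J by auto
      qed
    qed
  qed
  then show ?thesis using that by blast
qed

text \<open>Vectors of length \<open>n\<close> are functions on all of \<open>nat\<close> of which
  only the entries below \<open>n\<close> count, so that one sequence can be read at every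
  truncation size. The form is linear in its first argument.\<close>

definition inner_n :: "nat \<Rightarrow> (nat \<Rightarrow> complex) \<Rightarrow> (nat \<Rightarrow> complex) \<Rightarrow> complex" where
  "inner_n n f g = (\<Sum>i<n. f i * cnj (g i))"

definition nsq :: "nat \<Rightarrow> (nat \<Rightarrow> complex) \<Rightarrow> real" where
  "nsq n f = (\<Sum>i<n. (cmod (f i))\<^sup>2)"

definition mat_vec :: "nat \<Rightarrow> (nat \<Rightarrow> nat \<Rightarrow> complex) \<Rightarrow> (nat \<Rightarrow> complex) \<Rightarrow> nat \<Rightarrow> complex" where
  "mat_vec n A f i = (\<Sum>k<n. A i k * f k)"

definition qform :: "nat \<Rightarrow> (nat \<Rightarrow> nat \<Rightarrow> complex) \<Rightarrow> (nat \<Rightarrow> complex) \<Rightarrow> real" where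
  "qform n A h = Re (inner_n n (mat_vec n A h) h)"

definition hermitian_mat :: "(nat \<Rightarrow> nat \<Rightarrow> complex) \<Rightarrow> bool" where
  "hermitian_mat A \<longleftrightarrow> (\<forall>i k. A k i = cnj (A i k))"

lemma inner_n_self: "inner_n n f f = of_real (nsq n f)"
  unfolding inner_n_def nsq_def of_real_sum by (intro sum.cong refl) (simp only: complex_norm_square)

lemma nsq_nonneg: "nsq n f \<ge> 0"
  by (simp add: nsq_def sum_nonneg)

lemma nsq_eq_0_iff: "nsq n f = 0 \<longleftrightarrow> (\<forall>i<n. f i = 0)"
  by (auto simp: nsq_def sum_nonneg_eq_0_iff)

lemma nsq_pos: "i < n \<Longrightarrow> f i \<noteq> 0 \<Longrightarrow> nsq n f > 0"
  using nsq_eq_0_iff[of n f] nsq_nonneg[of n f] by fastforce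

lemma inner_n_commute: "inner_n n g f = cnj (inner_n n f g)"
  by (simp add: inner_n_def mult.commute)

lemma inner_n_add_left: "inner_n n (\<lambda>i. f i + g i) h = inner_n n f h + inner_n n g h"
  by (simp add: inner_n_def algebra_simps sum.distrib)

lemma inner_n_diff_left: "inner_n n (\<lambda>i. f i - g i) h = inner_n n f h - inner_n n g h"
  by (simp add: inner_n_def algebra_simps sum_subtractf)

lemma inner_n_scale_left: "inner_n n (\<lambda>i. c * f i) h = c * inner_n n f h"
  by (simp add: inner_n_def algebra_simps sum_distrib_left)

lemma inner_n_add_right: "inner_n n h (\<lambda>i. f i + g i) = inner_n n h f + inner_n n h g"
  by (simp add: inner_n_def algebra_simps sum.distrib)

lemma inner_n_scale_right: "inner_n n h (\<lambda>i. c * f i) = cnj c * inner_n n h f"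
  by (simp add: inner_n_def algebra_simps sum_distrib_left)

lemma inner_n_sum_left: "inner_n n (\<lambda>i. \<Sum>m\<in>S. c m * f m i) h = (\<Sum>m\<in>S. c m * inner_n n (f m) h)"
proof -
  have "inner_n n (\<lambda>i. \<Sum>m\<in>S. c m * f m i) h = (\<Sum>i<n. \<Sum>m\<in>S. c m * f m i * cnj (h i))"
    by (simp add: inner_n_def sum_distrib_right)
  also have "\<dots> = (\<Sum>m\<in>S. \<Sum>i<n. c m * f m i * cnj (h i))" by (rule sum.swap)
  finally show ?thesis by (simp add: inner_n_def sum_distrib_left mult.assoc)
qed

lemma inner_n_sum_right:
  "inner_n n h (\<lambda>i. \<Sum>m\<in>S. c m * f m i) = (\<Sum>m\<in>S. cnj (c m) * inner_n n h (f m))"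
  by (subst inner_n_commute, subst inner_n_sum_left) (simp add: inner_n_commute[of n h])

lemma inner_n_cong: "(\<And>i. i < n \<Longrightarrow> f i = f' i) \<Longrightarrow> (\<And>i. i < n \<Longrightarrow> g i = g' i) \<Longrightarrow> inner_n n f g = inner_n n f' g'"
  by (simp add: inner_n_def)

lemma mat_vec_add: "mat_vec n A (\<lambda>i. f i + g i) = (\<lambda>i. mat_vec n A f i + mat_vec n A g i)"
  by (simp add: fun_eq_iff mat_vec_def algebra_simps sum.distrib)

lemma mat_vec_scale: "mat_vec n A (\<lambda>i. c * f i) = (\<lambda>i. c * mat_vec n A f i)"
  by (simp add: fun_eq_iff mat_vec_def algebra_simps sum_distrib_left)

lemma mat_vec_sum: "mat_vec n A (\<lambda>i. \<Sum>m\<in>S. c m * f m i) = (\<lambda>i. \<Sum>m\<in>S. c m * mat_vec n A (f m) i)"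
proof
  fix i
  have "mat_vec n A (\<lambda>i. \<Sum>m\<in>S. c m * f m i) i = (\<Sum>k<n. \<Sum>m\<in>S. A i k * (c m * f m k))"
    by (simp add: mat_vec_def sum_distrib_left)
  also have "\<dots> = (\<Sum>m\<in>S. \<Sum>k<n. A i k * (c m * f m k))" by (rule sum.swap)
  finally show "mat_vec n A (\<lambda>i. \<Sum>m\<in>S. c m * f m i) i = (\<Sum>m\<in>S. c m * mat_vec n A (f m) i)"
    by (simp add: mat_vec_def sum_distrib_left algebra_simps)
qed

lemma mat_vec_cong: "(\<And>i. i < n \<Longrightarrow> f i = f' i) \<Longrightarrow> mat_vec n A f = mat_vec n A f'"
  by (simp add: mat_vec_def fun_eq_iff)

lemma qform_cong: "(\<And>i. i < n \<Longrightarrow> f i = f' i) \<Longrightarrow> qform n A f = qform n A f'"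
  by (simp add: qform_def inner_n_def mat_vec_def)

lemma nsq_cong: "(\<And>i. i < n \<Longrightarrow> f i = f' i) \<Longrightarrow> nsq n f = nsq n f'"
  by (simp add: nsq_def)

lemma inner_mat_vec_hermitian:
  assumes "hermitian_mat A"
  shows "inner_n n (mat_vec n A f) g = inner_n n f (mat_vec n A g)"
proof -
  have "inner_n n (mat_vec n A f) g = (\<Sum>i<n. \<Sum>k<n. A i k * f k * cnj (g i))"
    by (simp add: inner_n_def mat_vec_def sum_distrib_right)
  also have "\<dots> = (\<Sum>k<n. \<Sum>i<n. A i k * f k * cnj (g i))" by (rule sum.swap)
  also have "\<dots> = (\<Sum>k<n. \<Sum>i<n. f k * cnj (A k i * g i))"
  proof (intro sum.cong refl)
    fix i k
    have "A i k = cnj (A k i)" using assms unfolding hermitian_mat_def by blast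
    then show "A i k * f k * cnj (g i) = f k * cnj (A k i * g i)" by simp
  qed
  finally show ?thesis by (simp add: inner_n_def mat_vec_def sum_distrib_left)
qed

lemma qform_add_scaled:
  assumes "hermitian_mat A"
  shows "qform n A (\<lambda>i. f i + of_real s * g i)
    = qform n A f + 2 * s * Re (inner_n n (mat_vec n A f) g) + s\<^sup>2 * qform n A g"
proof -
  have "inner_n n (mat_vec n A g) f = cnj (inner_n n (mat_vec n A f) g)"
    using inner_mat_vec_hermitian[OF assms, of n g f] inner_n_commute[of n g "mat_vec n A f"] by simp
  then have 1: "Re (inner_n n (mat_vec n A g) f) = Re (inner_n n (mat_vec n A f) g)" by simp
  have "inner_n n (mat_vec n A (\<lambda>i. f i + of_real s * g i)) (\<lambda>i. f i + of_real s * g i)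
    = inner_n n (mat_vec n A f) f + of_real s * inner_n n (mat_vec n A f) g
      + of_real s * inner_n n (mat_vec n A g) f + of_real (s\<^sup>2) * inner_n n (mat_vec n A g) g"
    unfolding mat_vec_add mat_vec_scale inner_n_add_left inner_n_add_right
      inner_n_scale_left inner_n_scale_right
    by (simp add: algebra_simps power2_eq_square)
  then show ?thesis using 1 by (simp add: qform_def del: of_real_power)
qed

lemma qform_scale: "qform n A (\<lambda>i. c * f i) = (cmod c)\<^sup>2 * qform n A f"
proof -
  have "inner_n n (mat_vec n A (\<lambda>i. c * f i)) (\<lambda>i. c * f i) = of_real ((cmod c)\<^sup>2) * inner_n n (mat_vec n A f)
    f"
    unfolding mat_vec_scale inner_n_scale_left inner_n_scale_right complex_norm_square
    by (rule mult.assoc[symmetric])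
  then show ?thesis by (simp add: qform_def)
qed

lemma nsq_scale: "nsq n (\<lambda>i. c * f i) = (cmod c)\<^sup>2 * nsq n f"
  by (simp add: nsq_def norm_mult power_mult_distrib sum_distrib_left)

section \<open>Orthonormal eigenbases of Hermitian matrices by successive minimisation\<close>

definition eigenbasis :: "nat \<Rightarrow> (nat \<Rightarrow> nat \<Rightarrow> complex) \<Rightarrow> nat \<Rightarrow> (nat \<Rightarrow> nat \<Rightarrow> complex) \<Rightarrow> (nat \<Rightarrow> real) \<Rightarrow> bool"
  where
  "eigenbasis n A m \<phi> l \<longleftrightarrow>
     (\<forall>k<m. \<forall>i<n. mat_vec n A (\<phi> k) i = of_real (l k) * \<phi> k i) \<and>
     (\<forall>j<m. \<forall>k<m. inner_n n (\<phi> j) (\<phi> k) = of_bool (j = k)) \<and>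
     (\<forall>j k. j \<le> k \<longrightarrow> k < m \<longrightarrow> l j \<le> l k)"

text \<open>The unit sphere of the solution space is compact, so the quadratic form attains its
  minimum there; compactness is used as convergence of a subsequence in every coordinate. The
  assumption \<open>card J < n\<close> keeps the sphere nonempty.\<close>

lemma qform_minimizer:
  assumes "m < n" "finite J" "card J < n"
  obtains h where "nsq n h = 1" "\<forall>a\<in>J. (\<Sum>i<n. a i * h i) = 0"
    "\<And>f. \<forall>a\<in>J. (\<Sum>i<n. a i * f i) = 0 \<Longrightarrow> qform n A f \<ge> qform n A h * nsq n f"
proof -
  define S where "S = {f. nsq n f = 1 \<and> (\<forall>a\<in>J. (\<Sum>i<n. a i * f i) = 0)}"
  have coord: "cmod (f i) \<le> 1" if "f \<in> S" "i < n" for f i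
  proof -
    have "(cmod (f i))\<^sup>2 \<le> nsq n f" unfolding nsq_def
      using that by (intro member_le_sum) auto
    then show ?thesis using that by (simp add: S_def abs_square_le_1)
  qed
  have normalize: "\<exists>g\<in>S. qform n A f = nsq n f * qform n A g"
    if f: "\<forall>a\<in>J. (\<Sum>i<n. a i * f i) = 0" "nsq n f \<noteq> 0" for f
  proof -
    have pos: "nsq n f > 0" using f nsq_nonneg[of n f] by simp
    define c where "c = complex_of_real (1 / sqrt (nsq n f))"
    have c: "(cmod c)\<^sup>2 = 1 / nsq n f" using pos by (simp add: c_def norm_divide power_divide)
    have "(\<Sum>i<n. a i * (c * f i)) = 0" if "a \<in> J" for a
    proof -
      have "(\<Sum>i<n. a i * (c * f i)) = c * (\<Sum>i<n. a i * f i)"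
        by (simp add: sum_distrib_left algebra_simps)
      then show ?thesis using f that by simp
    qed
    then have "(\<lambda>i. c * f i) \<in> S" using pos by (auto simp: S_def nsq_scale c)
    then show ?thesis using pos by (intro bexI[of _ "\<lambda>i. c * f i"]) (auto simp: qform_scale c)
  qed
  have "S \<noteq> {}"
  proof -
    obtain c where c: "\<exists>i\<in>{..<n}. c i \<noteq> 0" "\<forall>a\<in>J. (\<Sum>i\<in>{..<n}. a i * c i) = 0"
      using underdetermined_system[of J "{..<n}"] assms by auto
    then have "nsq n c \<noteq> 0" by (auto simp: nsq_eq_0_iff)
    then show ?thesis using normalize[OF c(2)] by auto
  qed
  have qf_bound: "\<bar>qform n A f\<bar> \<le> (\<Sum>i<n. \<Sum>k<n. cmod (A i k))" if "f \<in> S" for f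
  proof -
    have "\<bar>qform n A f\<bar> \<le> cmod (\<Sum>i<n. \<Sum>k<n. A i k * f k * cnj (f i))"
      unfolding qform_def inner_n_def mat_vec_def sum_distrib_right by (rule abs_Re_le_cmod)
    also have "\<dots> \<le> (\<Sum>i<n. \<Sum>k<n. cmod (A i k * f k * cnj (f i)))"
      by (intro order.trans[OF norm_sum] sum_mono norm_sum)
    also have "\<dots> \<le> (\<Sum>i<n. \<Sum>k<n. cmod (A i k))"
    proof (intro sum_mono)
      fix i k assume "i \<in> {..<n}" "k \<in> {..<n}"
      then have "cmod (f k) * cmod (f i) \<le> 1" using coord[OF that] by (intro mult_le_one) auto
      then have "cmod (A i k) * (cmod (f k) * cmod (f i)) \<le> cmod (A i k)" by (intro mult_left_le) auto
      then show "cmod (A i k * f k * cnj (f i)) \<le> cmod (A i k)" by (simp add: norm_mult mult.assoc)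
    qed
    finally show ?thesis .
  qed
  define x where "x = Inf (qform n A ` S)"
  have bb: "bdd_below (qform n A ` S)"
    using qf_bound by (intro bdd_belowI2[of _ "- (\<Sum>i<n. \<Sum>k<n. cmod (A i k))"]) (force simp: abs_le_iff)
  have lower: "qform n A f \<ge> x" if "f \<in> S" for f
    unfolding x_def using that bb by (intro cInf_lower) auto
  have "\<exists>f\<in>S. qform n A f < x + 1 / Suc p" for p
    using cInf_lessD[of "qform n A ` S" "x + 1 / Suc p"] \<open>S \<noteq> {}\<close> by (force simp: x_def)
  then obtain F where F: "\<And>p. F p \<in> S" "\<And>p. qform n A (F p) < x + 1 / Suc p" by metis
  obtain r where r: "strict_mono (r::nat\<Rightarrow>nat)" "\<And>i. i \<in> {..<n} \<Longrightarrow> \<exists>l. (\<lambda>p. F (r p) i) \<longlonglongrightarrow> l"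
    using function_convergent_subsequence[of "{..<n}" F 1] coord F(1)
      by (metis countable_finite finite_lessThan lessThan_iff)
  define h where "h i = lim (\<lambda>p. F (r p) i)" for i
  have h: "(\<lambda>p. F (r p) i) \<longlonglongrightarrow> h i" if "i < n" for i
    using r(2)[of i] that by (auto simp: h_def convergent_def limI)
  have "(\<lambda>p. nsq n (F (r p))) \<longlonglongrightarrow> nsq n h"
    unfolding nsq_def by (intro tendsto_intros h) auto
  moreover have "nsq n (F (r p)) = 1" for p using F(1) by (simp add: S_def)
  ultimately have h1: "nsq n h = 1" by (simp add: LIMSEQ_const_iff)
  have h2: "(\<Sum>i<n. a i * h i) = 0" if "a \<in> J" for a
  proof -
    have "(\<lambda>p. \<Sum>i<n. a i * F (r p) i) \<longlonglongrightarrow> (\<Sum>i<n. a i * h i)" by (intro tendsto_intros h) auto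
    moreover have "(\<Sum>i<n. a i * F (r p) i) = 0" for p using F(1) that by (simp add: S_def)
    ultimately show ?thesis by (simp add: LIMSEQ_const_iff)
  qed
  have hS: "h \<in> S" using h1 h2 by (simp add: S_def)
  have "qform n A h \<le> x"
  proof (rule LIMSEQ_le)
    show "(\<lambda>p. qform n A (F (r p))) \<longlonglongrightarrow> qform n A h"
      unfolding qform_def inner_n_def mat_vec_def by (intro tendsto_intros h) auto
    have "(\<lambda>p. x + 1 / Suc p) \<longlonglongrightarrow> x + 0"
      by (intro tendsto_intros) (rule LIMSEQ_Suc[OF lim_1_over_n])
    from LIMSEQ_subseq_LIMSEQ[OF this r(1)]
    show "(\<lambda>p. x + 1 / Suc (r p)) \<longlonglongrightarrow> x" by (simp add: o_def)
    show "\<exists>N. \<forall>p\<ge>N. qform n A (F (r p)) \<le> x + 1 / real (Suc (r p))"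
      using F(2) less_imp_le by blast
  qed
  then have hx: "qform n A h = x" using lower[OF hS] by simp
  show thesis
  proof (rule that[OF h1])
    show "\<forall>a\<in>J. (\<Sum>i<n. a i * h i) = 0" using h2 by auto
    fix f assume f: "\<forall>a\<in>J. (\<Sum>i<n. a i * f i) = 0"
    show "qform n A f \<ge> qform n A h * nsq n f"
    proof (cases "nsq n f = 0")
      case True
      then have "qform n A f = 0" by (simp add: nsq_eq_0_iff qform_def inner_n_def)
      then show ?thesis using True by simp
    next
      case False
      from normalize[OF f this] obtain g where "g \<in> S" "qform n A f = nsq n f * qform n A g" by auto
      then show ?thesis using lower[of g] nsq_nonneg[of n f] hx by (metis mult.commute mult_left_mono)
    qed
  qed
qed


text \<open>Minimise over the complement of the \<open>m\<close> eigenvectors already found. The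
  minimiser is an eigenvector by the first-order condition, and since each earlier
  \<open>l k\<close> is itself such a minimum over a larger complement, the list stays
  sorted.\<close>

lemma eigenbasis_extend:
  assumes A: "hermitian_mat A" and "m < n" and e: "eigenbasis n A m \<phi> l"
    and min: "\<And>k f. k < m \<Longrightarrow> \<forall>j<k. inner_n n f (\<phi> j) = 0 \<Longrightarrow> qform n A f \<ge> l k * nsq n f"
  shows "\<exists>\<phi>' l'. eigenbasis n A (Suc m) \<phi>' l' \<and>
    (\<forall>k f. k < Suc m \<longrightarrow> (\<forall>j<k. inner_n n f (\<phi>' j) = 0) \<longrightarrow> qform n A f \<ge> l' k * nsq n f)"
proof -
  define J where "J = (\<lambda>j i. cnj (\<phi> j i)) ` {..<m}"
  have J: "(\<forall>a\<in>J. (\<Sum>i<n. a i * f i) = 0) \<longleftrightarrow> (\<forall>j<m. inner_n n f (\<phi> j) = 0)" for f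
    by (auto simp: J_def inner_n_def mult.commute)
  have "finite J" "card J < n"
    using \<open>m < n\<close> card_image_le[of "{..<m}" "\<lambda>j i. cnj (\<phi> j i)"] by (auto simp: J_def)
  then obtain h where h: "nsq n h = 1" "\<forall>j<m. inner_n n h (\<phi> j) = 0"
    "\<And>f. \<forall>j<m. inner_n n f (\<phi> j) = 0 \<Longrightarrow> qform n A f \<ge> qform n A h * nsq n f"
    using qform_minimizer[OF \<open>m < n\<close>, of J A] unfolding J by metis
  define x where "x = qform n A h"
  define r where "r = (\<lambda>i. mat_vec n A h i - of_real x * h i)"
  have rphi: "inner_n n r (\<phi> j) = 0" if "j < m" for j
  proof -
    have "inner_n n (mat_vec n A h) (\<phi> j) = inner_n n h (mat_vec n A (\<phi> j))"
      by (rule inner_mat_vec_hermitian[OF A])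
    also have "\<dots> = inner_n n h (\<lambda>i. of_real (l j) * \<phi> j i)"
      using e that by (intro inner_n_cong) (auto simp: eigenbasis_def)
    also have "\<dots> = 0" using h(2) that by (simp add: inner_n_scale_right)
    finally show ?thesis using h(2) that by (simp add: r_def inner_n_diff_left inner_n_scale_left)
  qed
  \<comment> \<open>The residual is orthogonal to the earlier eigenvectors, so
    \<open>h - t r\<close> is an admissible competitor. Its first-order gain
    \<open>2 t nsq n r\<close> is therefore bounded by a term of order \<open>t\<^sup>2\<close>;
    after division by \<open>t\<close>, letting \<open>t\<close> tend to 0 forces the residual to
    vanish.\<close>
  have "nsq n r * 2 \<le> t * (qform n A r - x * nsq n r)" if "t > 0" for t
  proof -
    have "\<forall>j<m. inner_n n (\<lambda>i. h i + of_real (- t) * r i) (\<phi> j) = 0"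
      unfolding inner_n_add_left inner_n_scale_left using h(2) rphi by simp
    from h(3)[OF this] have 1: "qform n A (\<lambda>i. h i + of_real (- t) * r i)
      \<ge> x * nsq n (\<lambda>i. h i + of_real (- t) * r i)"
      by (simp add: x_def)
    have 2: "complex_of_real (nsq n (\<lambda>i. h i + of_real (- t) * r i)) =
       of_real (nsq n h) - of_real t * (inner_n n h r + inner_n n r h) + of_real (t\<^sup>2) * of_real (nsq n r)"
      unfolding inner_n_self[symmetric] inner_n_add_left inner_n_add_right inner_n_scale_left
        inner_n_scale_right
      by (simp add: algebra_simps power2_eq_square)
    have 3: "inner_n n h r + inner_n n r h = of_real (2 * Re (inner_n n h r))"
      using inner_n_commute[of n r h] by (simp add: complex_add_cnj)
    have "complex_of_real (nsq n (\<lambda>i. h i + of_real (- t) * r i)) =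
       of_real (nsq n h - 2 * t * Re (inner_n n h r) + t\<^sup>2 * nsq n r)"
      unfolding 2 3 by simp
    then have 4: "nsq n (\<lambda>i. h i + of_real (- t) * r i) = 1 - 2 * t * Re (inner_n n h r) + t\<^sup>2 * nsq n r"
      unfolding of_real_eq_iff using h(1) by simp
    have 5: "inner_n n (mat_vec n A h) r = of_real (nsq n r) + of_real x * inner_n n h r"
    proof -
      have "inner_n n (mat_vec n A h) r = inner_n n (\<lambda>i. r i + of_real x * h i) r"
        by (intro inner_n_cong) (auto simp: r_def)
      then show ?thesis by (simp add: inner_n_add_left inner_n_scale_left inner_n_self)
    qed
    from 1 have "x * (1 - 2 * t * Re (inner_n n h r) + t\<^sup>2 * nsq n r) \<le>
       x - 2 * t * (nsq n r + x * Re (inner_n n h r)) + t\<^sup>2 * qform n A r"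
      unfolding qform_add_scaled[OF A] 4 5 by (simp add: x_def)
    then have "t * (nsq n r * 2) \<le> t * (t * (qform n A r - x * nsq n r))"
      by (simp add: algebra_simps power2_eq_square)
    then show ?thesis using that by simp
  qed
  note bound = this
  have "((\<lambda>t. t * (qform n A r - x * nsq n r)) \<longlongrightarrow> 0 * (qform n A r - x * nsq n r)) (at_right 0)"
    by (intro tendsto_intros)
  then have "nsq n r * 2 \<le> 0 * (qform n A r - x * nsq n r)"
    by (rule tendsto_lowerbound) (auto simp: eventually_at_right_less intro!: eventually_at_rightI[of 0 1]
      bound)
  then have "nsq n r = 0" using nsq_nonneg[of n r] by simp
  then have eig: "mat_vec n A h i = of_real x * h i" if "i < n" for i
    using that by (simp add: nsq_eq_0_iff r_def)
  define \<phi>' where "\<phi>' = \<phi>(m := h)"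
  define l' where "l' = l(m := x)"
  have hh: "inner_n n h h = 1" using h(1) by (simp add: inner_n_self)
  have h2': "inner_n n (\<phi> j) h = 0" if "j < m" for j
    using h(2) that inner_n_commute[of n "\<phi> j" h] by simp
  have lx: "l j \<le> x" if "j < m" for j
    using min[OF that, of h] h that by (simp add: x_def)
  have "eigenbasis n A (Suc m) \<phi>' l'"
    unfolding eigenbasis_def
  proof (intro conjI allI impI)
    fix k i assume "k < Suc m" "i < n"
    then show "mat_vec n A (\<phi>' k) i = of_real (l' k) * \<phi>' k i"
      using eig e by (cases "k = m") (auto simp: \<phi>'_def l'_def eigenbasis_def)
  next
    fix j k assume "j < Suc m" "k < Suc m"
    then show "inner_n n (\<phi>' j) (\<phi>' k) = of_bool (j = k)"
      using e h(2) h2' hh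
      by (cases "k = m"; cases "j = m") (auto simp: \<phi>'_def eigenbasis_def)
  next
    fix j k assume "j \<le> k" "k < Suc m"
    then show "l' j \<le> l' k"
      using e lx by (cases "k = m"; cases "j = m") (auto simp: l'_def eigenbasis_def)
  qed
  moreover have "qform n A f \<ge> l' k * nsq n f"
    if "k < Suc m" "\<forall>j<k. inner_n n f (\<phi>' j) = 0" for k f
    using that h(3)[of f] min[of k f] by (cases "k = m") (auto simp: \<phi>'_def l'_def x_def)
  ultimately show ?thesis by blast
qed

theorem hermitian_eigenbasis:
  assumes "hermitian_mat A"
  shows "\<exists>\<phi> l. eigenbasis n A n \<phi> l"
proof -
  have "\<exists>\<phi> l. eigenbasis n A m \<phi> l \<and>
    (\<forall>k f. k < m \<longrightarrow> (\<forall>j<k. inner_n n f (\<phi> j) = 0) \<longrightarrow> qform n A f \<ge> l k * nsq n f)" if "m \<le> n" for m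
    using that
  proof (induction m)
    case 0
    show ?case by (auto simp: eigenbasis_def)
  next
    case (Suc m)
    then obtain \<phi> l where "eigenbasis n A m \<phi> l"
      "\<And>k f. k < m \<Longrightarrow> \<forall>j<k. inner_n n f (\<phi> j) = 0 \<Longrightarrow> qform n A f \<ge> l k * nsq n f"
      by (metis Suc_leD)
    then show ?case using eigenbasis_extend[OF assms, of m n \<phi> l] Suc.prems by simp
  qed
  then show ?thesis by blast
qed

text \<open>Completeness follows by counting: a nonzero defect \<open>r\<close> would be orthogonal
  to all \<open>n\<close> eigenvectors, and \<open>n + 1\<close> nonzero pairwise orthogonal vectors
  with \<open>n\<close> entries cannot exist.\<close>

lemma eigenbasis_expand:
  assumes "eigenbasis n A n \<phi> l" "i < n"
  shows "f i = (\<Sum>k<n. inner_n n f (\<phi> k) * \<phi> k i)"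
proof (rule ccontr)
  assume ne: "f i \<noteq> (\<Sum>k<n. inner_n n f (\<phi> k) * \<phi> k i)"
  have orth: "inner_n n (\<phi> j) (\<phi> k) = of_bool (j = k)" if "j < n" "k < n" for j k
    using assms that by (auto simp: eigenbasis_def)
  define r where "r i = f i - (\<Sum>k<n. inner_n n f (\<phi> k) * \<phi> k i)" for i
  have r_orth: "inner_n n r (\<phi> j) = 0" if "j < n" for j
  proof -
    have "inner_n n r (\<phi> j) = inner_n n f (\<phi> j) - (\<Sum>k<n. inner_n n f (\<phi> k) * inner_n n (\<phi> k) (\<phi> j))"
      unfolding r_def inner_n_diff_left inner_n_sum_left by simp
    also have "(\<Sum>k<n. inner_n n f (\<phi> k) * inner_n n (\<phi> k) (\<phi> j))
      = (\<Sum>k<n. if k = j then inner_n n f (\<phi> k) else 0)"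
      using that by (intro sum.cong) (auto simp: orth)
    finally show ?thesis using that by simp
  qed
  have r_orth': "inner_n n (\<phi> j) r = 0" if "j < n" for j
    using r_orth[OF that] inner_n_commute[of n "\<phi> j" r] by simp
  define v where "v = \<phi>(n := r)"
  \<comment> \<open>One equation per entry, \<open>n\<close> in all, for the \<open>n + 1\<close>
    coefficients of a linear relation among the vectors \<open>v\<close>.\<close>
  define J where "J = (\<lambda>i k. v k i) ` {..<n}"
  have "card J < card {..n}" "finite J"
    using card_image_le[of "{..<n}" "\<lambda>i k. v k i"] by (auto simp: J_def)
  then obtain c where c: "\<exists>k\<in>{..n}. c k \<noteq> 0" "\<forall>a\<in>J. (\<Sum>k\<in>{..n}. a k * c k) = 0"
    using underdetermined_system[of J "{..n}"] by auto
  have zero: "(\<Sum>k\<le>n. c k * v k i) = 0" if "i < n" for i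
    using c(2) that by (auto simp: J_def mult.commute)
  have v_orth: "inner_n n (v k) (v j) = 0" if "k \<le> n" "j \<le> n" "k \<noteq> j" for j k
    using that orth r_orth r_orth'
    by (cases "k = n"; cases "j = n") (auto simp: v_def)
  have "c j * inner_n n (v j) (v j) = 0" if "j \<le> n" for j
  proof -
    have "0 = inner_n n (\<lambda>i. \<Sum>k\<le>n. c k * v k i) (v j)"
      using zero by (simp add: inner_n_def)
    also have "\<dots> = (\<Sum>k\<le>n. c k * inner_n n (v k) (v j))" by (rule inner_n_sum_left)
    also have "\<dots> = (\<Sum>k\<le>n. if k = j then c j * inner_n n (v j) (v j) else 0)"
      using that v_orth by (intro sum.cong) auto
    finally show ?thesis using that by simp
  qed
  moreover have "inner_n n (v j) (v j) \<noteq> 0" if "j \<le> n" for j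
  proof (cases "j = n")
    case True
    have "r i \<noteq> 0" using ne by (simp add: r_def)
    then show ?thesis using True nsq_pos[OF assms(2), of r] by (simp add: v_def inner_n_self)
  next
    case False
    then show ?thesis using that orth[of j j] by (simp add: v_def)
  qed
  ultimately show False using c(1) by auto
qed

lemma nsq_span_eigenbasis:
  assumes "eigenbasis n A n \<phi> l" "finite S" "S \<subseteq> {..<n}"
  shows "nsq n (\<lambda>i. \<Sum>k\<in>S. c k * \<phi> k i) = (\<Sum>k\<in>S. (cmod (c k))\<^sup>2)"
    and "qform n A (\<lambda>i. \<Sum>k\<in>S. c k * \<phi> k i) = (\<Sum>k\<in>S. l k * (cmod (c k))\<^sup>2)"
proof -
  have orth: "inner_n n (\<phi> j) (\<phi> k) = of_bool (j = k)" if "j \<in> S" "k \<in> S" for j k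
    using assms(1) that[THEN subsetD[OF assms(3)]] by (auto simp: eigenbasis_def)
  have *: "inner_n n (\<lambda>i. \<Sum>k\<in>S. d k * \<phi> k i) (\<lambda>i. \<Sum>k\<in>S. c k * \<phi> k i) = (\<Sum>k\<in>S. d k * cnj (c k))" for d
  proof -
    have "inner_n n (\<lambda>i. \<Sum>k\<in>S. d k * \<phi> k i) (\<lambda>i. \<Sum>k\<in>S. c k * \<phi> k i)
      = (\<Sum>k\<in>S. d k * (\<Sum>j\<in>S. cnj (c j) * inner_n n (\<phi> k) (\<phi> j)))"
      unfolding inner_n_sum_left inner_n_sum_right by simp
    also have "\<dots> = (\<Sum>k\<in>S. d k * (\<Sum>j\<in>S. if k = j then cnj (c j) else 0))"
      by (intro sum.cong refl arg_cong2[of _ _ _ _ "(*)"]) (auto simp: orth)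
    finally show ?thesis using assms(2) by simp
  qed
  have "complex_of_real (nsq n (\<lambda>i. \<Sum>k\<in>S. c k * \<phi> k i)) = of_real (\<Sum>k\<in>S. (cmod (c k))\<^sup>2)"
    unfolding inner_n_self[symmetric] * of_real_sum by (intro sum.cong refl) (simp only: complex_norm_square)
  then show "nsq n (\<lambda>i. \<Sum>k\<in>S. c k * \<phi> k i) = (\<Sum>k\<in>S. (cmod (c k))\<^sup>2)" by (simp only: of_real_eq_iff)
  have "inner_n n (mat_vec n A (\<lambda>i. \<Sum>k\<in>S. c k * \<phi> k i)) (\<lambda>i. \<Sum>k\<in>S. c k * \<phi> k i)
    = inner_n n (\<lambda>i. \<Sum>k\<in>S. (c k * of_real (l k)) * \<phi> k i) (\<lambda>i. \<Sum>k\<in>S. c k * \<phi> k i)"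
    using assms unfolding mat_vec_sum
    by (intro inner_n_cong sum.cong refl) (auto simp: eigenbasis_def)
  also have "\<dots> = (\<Sum>k\<in>S. c k * of_real (l k) * cnj (c k))" by (rule *)
  also have "\<dots> = of_real (\<Sum>k\<in>S. l k * (cmod (c k))\<^sup>2)"
    unfolding of_real_sum of_real_mult complex_norm_square by (intro sum.cong refl) (simp only: mult_ac)
  finally show "qform n A (\<lambda>i. \<Sum>k\<in>S. c k * \<phi> k i) = (\<Sum>k\<in>S. l k * (cmod (c k))\<^sup>2)"
    unfolding qform_def by simp
qed

lemma eigenbasis_parseval:
  assumes "eigenbasis n A n \<phi> l"
  shows "nsq n f = (\<Sum>k<n. (cmod (inner_n n f (\<phi> k)))\<^sup>2)"
    and "qform n A f = (\<Sum>k<n. l k * (cmod (inner_n n f (\<phi> k)))\<^sup>2)"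
proof -
  have f: "f i = (\<Sum>k<n. inner_n n f (\<phi> k) * \<phi> k i)" if "i < n" for i
    using eigenbasis_expand[OF assms that] .
  show "nsq n f = (\<Sum>k<n. (cmod (inner_n n f (\<phi> k)))\<^sup>2)"
  proof -
    have "nsq n f = nsq n (\<lambda>i. \<Sum>k<n. inner_n n f (\<phi> k) * \<phi> k i)" by (rule nsq_cong) (rule f)
    then show ?thesis by (simp add: nsq_span_eigenbasis(1)[OF assms])
  qed
  show "qform n A f = (\<Sum>k<n. l k * (cmod (inner_n n f (\<phi> k)))\<^sup>2)"
  proof -
    have "qform n A f = qform n A (\<lambda>i. \<Sum>k<n. inner_n n f (\<phi> k) * \<phi> k i)" by (rule qform_cong) (rule f)
    then show ?thesis by (simp add: nsq_span_eigenbasis(2)[OF assms])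
  qed
qed

text \<open>Courant-Fischer: the span of the first \<open>k + 1\<close> eigenvectors, on which the
  form is at most \<open>l k\<close> times the squared norm, meets the solution space of
  \<open>k\<close> linear equations nontrivially. Subspaces are given by finite sets of linear
  forms, so that codimension is bounded by a cardinality.\<close>

lemma eigenvalue_lower_bound:
  assumes e: "eigenbasis n A n \<phi> l" and "k < n" "finite J" "card J \<le> k"
    and J: "\<And>h. \<forall>a\<in>J. (\<Sum>i<n. a i * h i) = 0 \<Longrightarrow> qform n A h \<ge> x * nsq n h"
  shows "l k \<ge> x"
proof -
  define J' where "J' = (\<lambda>a m. \<Sum>i<n. a i * \<phi> m i) ` J"
  have "finite J'" "card J' < card {..k}"
    using assms card_image_le[OF \<open>finite J\<close>, of "\<lambda>a m. \<Sum>i<n. a i * \<phi> m i"] by (auto simp: J'_def)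
  then obtain c where c: "\<exists>m\<in>{..k}. c m \<noteq> 0" "\<forall>a\<in>J'. (\<Sum>m\<le>k. a m * c m) = 0"
    using underdetermined_system[of J' "{..k}"] by auto
  define h where "h = (\<lambda>i. \<Sum>m\<le>k. c m * \<phi> m i)"
  have "(\<Sum>i<n. a i * h i) = 0" if "a \<in> J" for a
  proof -
    have "(\<Sum>i<n. a i * h i) = (\<Sum>i<n. \<Sum>m\<le>k. a i * \<phi> m i * c m)"
      by (simp add: h_def sum_distrib_left mult_ac)
    also have "\<dots> = (\<Sum>m\<le>k. (\<Sum>i<n. a i * \<phi> m i) * c m)"
      by (subst sum.swap) (simp add: sum_distrib_right)
    finally show ?thesis using c(2) that by (auto simp: J'_def)
  qed
  then have 1: "x * nsq n h \<le> qform n A h" using J by blast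
  have "{..k} \<subseteq> {..<n}" using \<open>k < n\<close> by auto
  note s = nsq_span_eigenbasis[OF e finite_atMost this, of c, folded h_def]
  have "l m \<le> l k" if "m \<le> k" for m
    using e that \<open>k < n\<close> by (auto simp: eigenbasis_def)
  then have "qform n A h \<le> l k * nsq n h"
    unfolding s sum_distrib_left by (intro sum_mono mult_right_mono) auto
  moreover have "nsq n h > 0"
  proof -
    have "nsq n h \<noteq> 0" unfolding s using c(1) by (auto simp: sum_nonneg_eq_0_iff)
    then show ?thesis using nsq_nonneg[of n h] by simp
  qed
  ultimately show ?thesis using 1 by (smt (verit) mult_right_mono mult_le_cancel_right)
qed

text \<open>The dual count: orthogonality to the first \<open>k\<close> eigenvectors together with
  the forms in \<open>J\<close> leaves a nonzero vector, on which the form is at least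
  \<open>l k\<close> times the squared norm.\<close>

lemma eigenvalue_upper_bound:
  assumes e: "eigenbasis n A n \<phi> l" and "finite J" "card J + k < n"
    and J: "\<And>h. \<forall>a\<in>J. (\<Sum>i<n. a i * h i) = 0 \<Longrightarrow> qform n A h \<le> x * nsq n h"
  shows "l k \<le> x"
proof -
  define J' where "J' = J \<union> (\<lambda>m i. cnj (\<phi> m i)) ` {..<k}"
  have "card J' \<le> card J + card ((\<lambda>m i. cnj (\<phi> m i)) ` {..<k})"
    unfolding J'_def by (rule card_Un_le)
  also have "\<dots> \<le> card J + k" using card_image_le[of "{..<k}" "\<lambda>m i. cnj (\<phi> m i)"] by simp
  finally have "finite J'" "card J' < card {..<n}" using assms by (auto simp: J'_def)
  then obtain h where h: "\<exists>i\<in>{..<n}. h i \<noteq> 0" "\<forall>a\<in>J'. (\<Sum>i<n. a i * h i) = 0"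
    using underdetermined_system[of J' "{..<n}"] by auto
  have orth: "inner_n n h (\<phi> m) = 0" if "m < k" for m
    using h(2) that by (auto simp: J'_def inner_n_def mult.commute)
  have "qform n A h \<le> x * nsq n h" using J h(2) by (auto simp: J'_def)
  moreover have "l k * nsq n h \<le> qform n A h"
    unfolding eigenbasis_parseval[OF e, of h] sum_distrib_left
  proof (intro sum_mono)
    fix m assume "m \<in> {..<n}"
    then show "l k * (cmod (inner_n n h (\<phi> m)))\<^sup>2 \<le> l m * (cmod (inner_n n h (\<phi> m)))\<^sup>2"
      using orth e by (cases "m < k") (auto simp: eigenbasis_def intro!: mult_right_mono)
  qed
  moreover have "nsq n h > 0" using h(1) nsq_pos by auto
  ultimately show ?thesis by (smt (verit) mult_right_mono mult_le_cancel_right)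
qed

text \<open>Diagonal entries are values of the form at the standard unit vectors. Parseval turns
  each into a weighted sum of eigenvalues, and exchanging the sums leaves the unit norms of the
  eigenvectors as weights.\<close>

lemma eigenbasis_trace:
  assumes e: "eigenbasis n A n \<phi> l"
  shows "(\<Sum>k<n. l k) = (\<Sum>j<n. Re (A j j))"
proof -
  have "Re (A j j) = (\<Sum>k<n. l k * (cmod (\<phi> k j))\<^sup>2)" if "j < n" for j
  proof -
    define d where "d = (\<lambda>i. of_bool (i = j) :: complex)"
    have "mat_vec n A d i = A i j" for i
      using that by (simp add: mat_vec_def d_def of_bool_def if_distrib[of "\<lambda>x. _ * x"] cong: if_cong)
    then have "qform n A d = Re (A j j)"
      using that by (simp add: qform_def inner_n_def d_def of_bool_def if_distrib[of "\<lambda>x. _ * x"]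
        if_distrib[of cnj] cong: if_cong)
    moreover have "inner_n n d (\<phi> k) = cnj (\<phi> k j)" for k
      using that by (simp add: inner_n_def d_def of_bool_def if_distrib[of "\<lambda>x. x * _"] cong: if_cong)
    ultimately show ?thesis using eigenbasis_parseval(2)[OF e, of d] by simp
  qed
  then have "(\<Sum>j<n. Re (A j j)) = (\<Sum>j<n. \<Sum>k<n. l k * (cmod (\<phi> k j))\<^sup>2)" by simp
  also have "\<dots> = (\<Sum>k<n. \<Sum>j<n. l k * (cmod (\<phi> k j))\<^sup>2)" by (rule sum.swap)
  also have "\<dots> = (\<Sum>k<n. l k * nsq n (\<phi> k))" by (simp add: nsq_def sum_distrib_left)
  also have "\<dots> = (\<Sum>k<n. l k)"
  proof (intro sum.cong refl)
    fix k assume "k \<in> {..<n}"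
    then have "complex_of_real (nsq n (\<phi> k)) = 1"
      using e by (simp add: inner_n_self[symmetric] eigenbasis_def)
    then show "l k * nsq n (\<phi> k) = l k" by simp
  qed
  finally show ?thesis by simp
qed

text \<open>In eigencoordinates \<open>A - x\<close> multiplies every entry by at least
  \<open>d\<close> in modulus. Read backwards: a vector with a small residual forces an eigenvalue
  near \<open>x\<close>.\<close>

lemma eigenbasis_residual:
  assumes e: "eigenbasis n A n \<phi> l" and A: "hermitian_mat A" and d: "d \<ge> 0" "\<And>k. k < n \<Longrightarrow> \<bar>l k - x\<bar> \<ge> d"
  shows "nsq n (\<lambda>i. mat_vec n A f i - of_real x * f i) \<ge> d\<^sup>2 * nsq n f"
proof -
  define r where "r = (\<lambda>i. mat_vec n A f i - of_real x * f i)"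
  have 1: "inner_n n r (\<phi> k) = of_real (l k - x) * inner_n n f (\<phi> k)" if "k < n" for k
  proof -
    have "inner_n n (mat_vec n A f) (\<phi> k) = inner_n n f (mat_vec n A (\<phi> k))"
      by (rule inner_mat_vec_hermitian[OF A])
    also have "\<dots> = inner_n n f (\<lambda>i. of_real (l k) * \<phi> k i)"
      using e that by (intro inner_n_cong) (auto simp: eigenbasis_def)
    finally show ?thesis
      unfolding r_def inner_n_diff_left inner_n_scale_left by (simp add: inner_n_scale_right algebra_simps)
  qed
  have "d\<^sup>2 * nsq n f \<le> nsq n r"
    unfolding eigenbasis_parseval(1)[OF e] sum_distrib_left
  proof (intro sum_mono)
    fix k assume k: "k \<in> {..<n}"
    have "d\<^sup>2 \<le> (l k - x)\<^sup>2" using d(2)[of k] d(1) k by (simp add: abs_le_square_iff[symmetric])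
    then show "d\<^sup>2 * (cmod (inner_n n f (\<phi> k)))\<^sup>2 \<le> (cmod (inner_n n r (\<phi> k)))\<^sup>2"
      using k by (simp add: 1 norm_mult power_mult_distrib mult_right_mono flip: of_real_diff)
  qed
  then show ?thesis by (simp add: r_def)
qed

section \<open>Truncated Lax matrices and their limits\<close>

text \<open>Rows, columns and shifted rows of a Toeplitz matrix are injective reindexings of the
  coefficients, so one bound on finite sums covers them all.\<close>

lemma sum_inj_le:
  fixes f :: "int \<Rightarrow> real"
  assumes "\<And>F. finite F \<Longrightarrow> sum f F \<le> C" "inj_on p {..<n::nat}"
  shows "(\<Sum>k<n. f (p k)) \<le> C"
  using assms(1)[of "p ` {..<n}"] assms(2) by (simp add: sum.reindex)

text \<open>Schur's test: the inequality \<open>a b \<le> (a^2 + b^2) / 2\<close> splits the form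
  into a part summed along columns and a part summed along rows, and both kinds of sums are at most
  \<open>D\<close>.\<close>

lemma schur_bound:
  fixes d :: "int \<Rightarrow> complex"
  assumes D: "\<And>F. finite F \<Longrightarrow> (\<Sum>m\<in>F. cmod (d m)) \<le> D"
  shows "cmod (\<Sum>j<n. \<Sum>k<n. d (int j - int k) * h k * cnj (h j)) \<le> D * nsq n h"
proof -
  have row: "(\<Sum>k<n. cmod (d (int j - int k))) \<le> D" for j
    by (rule sum_inj_le[of "\<lambda>m. cmod (d m)", OF D]) (auto simp: inj_on_def)
  have col: "(\<Sum>j<n. cmod (d (int j - int k))) \<le> D" for k
    by (rule sum_inj_le[of "\<lambda>m. cmod (d m)", OF D]) (auto simp: inj_on_def)
  have "cmod (\<Sum>j<n. \<Sum>k<n. d (int j - int k) * h k * cnj (h j))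
    \<le> (\<Sum>j<n. \<Sum>k<n. cmod (d (int j - int k) * h k * cnj (h j)))"
    by (intro order.trans[OF norm_sum] sum_mono norm_sum)
  also have "\<dots> \<le> (\<Sum>j<n. \<Sum>k<n. cmod (d (int j - int k)) * (cmod (h k))\<^sup>2 / 2 + cmod (d (int j - int k))
    * (cmod (h j))\<^sup>2 / 2)"
  proof (intro sum_mono)
    fix j k
    have "cmod (h k) * cmod (h j) \<le> ((cmod (h k))\<^sup>2 + (cmod (h j))\<^sup>2) / 2"
      using sum_squares_bound[of "cmod (h k)" "cmod (h j)"] by simp
    then have "cmod (d (int j - int k)) * (cmod (h k) * cmod (h j))
      \<le> cmod (d (int j - int k)) * (((cmod (h k))\<^sup>2 + (cmod (h j))\<^sup>2) / 2)"
      by (intro mult_left_mono) auto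
    then show "cmod (d (int j - int k) * h k * cnj (h j))
      \<le> cmod (d (int j - int k)) * (cmod (h k))\<^sup>2 / 2 + cmod (d (int j - int k)) * (cmod (h j))\<^sup>2 / 2"
      by (simp add: norm_mult field_simps)
  qed
  also have "\<dots> = (\<Sum>k<n. (\<Sum>j<n. cmod (d (int j - int k))) * ((cmod (h k))\<^sup>2 / 2))
      + (\<Sum>j<n. (\<Sum>k<n. cmod (d (int j - int k))) * ((cmod (h j))\<^sup>2 / 2))"
    unfolding sum.distrib sum_distrib_right
    by (subst sum.swap[of "\<lambda>j k. cmod (d (int j - int k)) * (cmod (h k))\<^sup>2 / 2"]) simp
  also have "\<dots> \<le> (\<Sum>k<n. D * ((cmod (h k))\<^sup>2 / 2)) + (\<Sum>j<n. D * ((cmod (h j))\<^sup>2 / 2))"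
    by (intro add_mono sum_mono mult_right_mono row col) auto
  also have "\<dots> = D * nsq n h"
    by (simp add: nsq_def sum_distrib_left[symmetric] sum_divide_distrib[symmetric])
  finally show ?thesis .
qed

definition lax_mat :: "(int \<Rightarrow> complex) \<Rightarrow> real \<Rightarrow> nat \<Rightarrow> nat \<Rightarrow> complex" where
  "lax_mat c \<epsilon> j k = of_bool (j = k) * of_real (\<epsilon> * real j) - c (int j - int k)"

definition toeplitz_form :: "(int \<Rightarrow> complex) \<Rightarrow> nat \<Rightarrow> (nat \<Rightarrow> complex) \<Rightarrow> real" where
  "toeplitz_form c n h = Re (\<Sum>j<n. \<Sum>k<n. c (int j - int k) * h k * cnj (h j))"

lemma mat_vec_lax_mat:
  assumes "j < n"
  shows "mat_vec n (lax_mat c \<epsilon>) h j = of_real (\<epsilon> * real j) * h j - (\<Sum>k<n. c (int j - int k) * h k)"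
proof -
  have "(\<Sum>k<n. of_bool (j = k) * complex_of_real (\<epsilon> * real j) * h k)
    = (\<Sum>k<n. if j = k then of_real (\<epsilon> * real j) * h j else 0)"
    by (intro sum.cong) auto
  then show ?thesis using assms by (simp add: mat_vec_def lax_mat_def left_diff_distrib sum_subtractf)
qed

lemma qform_lax_mat:
  "qform n (lax_mat c \<epsilon>) h = (\<Sum>j<n. \<epsilon> * real j * (cmod (h j))\<^sup>2) - toeplitz_form c n h"
proof -
  have "inner_n n (mat_vec n (lax_mat c \<epsilon>) h) h =
    (\<Sum>j<n. of_real (\<epsilon> * real j) * (h j * cnj (h j))) - (\<Sum>j<n. \<Sum>k<n. c (int j - int k) * h k * cnj (h j))"
    by (simp add: inner_n_def mat_vec_lax_mat left_diff_distrib sum_subtractf sum_distrib_right mult.assoc)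
  also have "(\<Sum>j<n. complex_of_real (\<epsilon> * real j) * (h j * cnj (h j)))
    = of_real (\<Sum>j<n. \<epsilon> * real j * (cmod (h j))\<^sup>2)"
    unfolding of_real_sum of_real_mult[of _ "(cmod _)\<^sup>2"] complex_norm_square by (rule refl)
  finally show ?thesis by (simp add: qform_def toeplitz_form_def)
qed

text \<open>The eigenvalues are sorted and repeated with multiplicity. Values at indices
  \<open>k \<ge> n\<close> are arbitrary, which is why the bounds below carry the guard
  \<open>k < n\<close>.\<close>

definition trunc_ev :: "(int \<Rightarrow> complex) \<Rightarrow> real \<Rightarrow> nat \<Rightarrow> nat \<Rightarrow> real" where
  "trunc_ev c \<epsilon> n = (SOME l. \<exists>\<phi>. eigenbasis n (lax_mat c \<epsilon>) n \<phi> l)"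

definition limit_ev :: "(int \<Rightarrow> complex) \<Rightarrow> real \<Rightarrow> nat \<Rightarrow> real" where
  "limit_ev c \<epsilon> k = lim (\<lambda>n. trunc_ev c \<epsilon> n k)"

text \<open>The Fourier coefficients \<open>c\<close> stand for the potential. Absolute summability
  bounds the Toeplitz part by \<open>D\<close> on every truncation, the symmetry says that
  \<open>u\<close> is real, and \<open>c 0 = 0\<close> is the zero mean, which enters through the
  trace.\<close>

locale lax_matrix =
  fixes c :: "int \<Rightarrow> complex" and \<epsilon> :: real
  assumes c_summable: "(\<lambda>m. cmod (c m)) summable_on UNIV"
    and c_cnj: "c (- m) = cnj (c m)"
    and c_0: "c 0 = 0"
    and eps_pos: "\<epsilon> > 0"
begin

definition D :: real where "D = (\<Sum>\<^sub>\<infinity>m. cmod (c m))"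

lemma sum_le_D: "finite F \<Longrightarrow> (\<Sum>m\<in>F. cmod (c m)) \<le> D"
  unfolding D_def by (intro finite_sum_le_infsum c_summable) auto

lemma cmod_c_le: "cmod (c m) \<le> D"
  using sum_le_D[of "{m}"] by simp

lemma D_nonneg: "D \<ge> 0"
  using sum_le_D[of "{}"] by simp

abbreviation "A \<equiv> lax_mat c \<epsilon>"
abbreviation "ev \<equiv> trunc_ev c \<epsilon>"
abbreviation "evl \<equiv> limit_ev c \<epsilon>"

lemma hermitian: "hermitian_mat A"
  unfolding hermitian_mat_def
proof (intro allI)
  fix i k
  show "A k i = cnj (A i k)" using c_cnj[of "int i - int k"] by (simp add: lax_mat_def)
qed

lemma ev_eigenbasis: obtains \<phi> where "eigenbasis n A n \<phi> (ev n)"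
proof -
  have "\<exists>l \<phi>. eigenbasis n A n \<phi> l" using hermitian_eigenbasis[OF hermitian, of n] by blast
  from someI_ex[OF this] show ?thesis using that unfolding trunc_ev_def by blast
qed

section \<open>Min-max for the truncations and their monotonicity in the size\<close>

lemma ev_lower_bound:
  assumes "k < n" "finite J" "card J \<le> k"
    and "\<And>h. \<forall>a\<in>J. (\<Sum>i<n. a i * h i) = 0 \<Longrightarrow> qform n A h \<ge> x * nsq n h"
  shows "ev n k \<ge> x"
proof -
  obtain \<phi> where "eigenbasis n A n \<phi> (ev n)" by (rule ev_eigenbasis)
  from eigenvalue_lower_bound[OF this assms] show ?thesis .
qed

lemma ev_upper_bound:
  assumes "finite J" "card J + k < n"
    and "\<And>h. \<forall>a\<in>J. (\<Sum>i<n. a i * h i) = 0 \<Longrightarrow> qform n A h \<le> x * nsq n h"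
  shows "ev n k \<le> x"
proof -
  obtain \<phi> where "eigenbasis n A n \<phi> (ev n)" by (rule ev_eigenbasis)
  from eigenvalue_upper_bound[OF this assms] show ?thesis .
qed

lemma ev_orthogonal:
  "\<exists>J. finite J \<and> card J \<le> k \<and> (\<forall>h. (\<forall>a\<in>J. (\<Sum>i<n. a i * h i) = 0) \<longrightarrow> qform n A h \<ge> ev n k * nsq n h)"
  if "k < n"
proof -
  obtain \<phi> where e: "eigenbasis n A n \<phi> (ev n)" by (rule ev_eigenbasis)
  define J where "J = (\<lambda>m i. cnj (\<phi> m i)) ` {..<k}"
  have "finite J" "card J \<le> k" using card_image_le[of "{..<k}" "\<lambda>m i. cnj (\<phi> m i)"] by (auto simp: J_def)
  moreover have "qform n A h \<ge> ev n k * nsq n h" if h: "\<forall>a\<in>J. (\<Sum>i<n. a i * h i) = 0" for h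
    unfolding eigenbasis_parseval[OF e, of h] sum_distrib_left
  proof (intro sum_mono)
    fix m assume "m \<in> {..<n}"
    moreover have "inner_n n h (\<phi> m) = 0" if "m < k"
      using h that by (auto simp: J_def inner_n_def mult.commute)
    ultimately show "ev n k * (cmod (inner_n n h (\<phi> m)))\<^sup>2 \<le> ev n m * (cmod (inner_n n h (\<phi> m)))\<^sup>2"
      using e by (cases "m < k") (auto simp: eigenbasis_def intro!: mult_right_mono)
  qed
  ultimately show ?thesis by blast
qed

lemma ev_mono: "j \<le> k \<Longrightarrow> k < n \<Longrightarrow> ev n j \<le> ev n k"
  by (rule ev_eigenbasis[of n]) (auto simp: eigenbasis_def)

lemma abs_toeplitz_form_le: "\<bar>toeplitz_form c n h\<bar> \<le> D * nsq n h"
  unfolding toeplitz_form_def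
  by (intro order.trans[OF abs_Re_le_cmod] schur_bound sum_le_D)

lemma ev_ge: "k < n \<Longrightarrow> ev n k \<ge> - D"
proof (rule ev_lower_bound[of _ _ "{}"])
  fix h
  have "0 \<le> (\<Sum>j<n. \<epsilon> * real j * (cmod (h j))\<^sup>2)" using eps_pos by (intro sum_nonneg) auto
  then show "- D * nsq n h \<le> qform n A h"
    unfolding qform_lax_mat using abs_toeplitz_form_le[of n h] by linarith
qed auto

text \<open>Cauchy interlacing: padding with a zero entry changes neither norm nor form, so
  constraints for the larger matrix also serve the smaller one.\<close>

lemma ev_Suc_le: "k < n \<Longrightarrow> ev (Suc n) k \<le> ev n k"
proof -
  assume "k < n"
  obtain J where J: "finite J" "card J \<le> k" "\<And>h. \<forall>a\<in>J. (\<Sum>i<Suc n. a i * h i) = 0 \<Longrightarrow> qform (Suc n) A h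
    \<ge> ev (Suc n) k * nsq (Suc n) h"
    using ev_orthogonal[of k "Suc n"] \<open>k < n\<close> by auto
  show ?thesis
  proof (rule ev_lower_bound[OF \<open>k < n\<close> J(1,2)])
    fix h :: "nat \<Rightarrow> complex"
    assume h: "\<forall>a\<in>J. (\<Sum>i<n. a i * h i) = 0"
    define h' where "h' = (\<lambda>i. if i < n then h i else 0)"
    have "\<forall>a\<in>J. (\<Sum>i<Suc n. a i * h' i) = 0" using h by (simp add: h'_def)
    from J(3)[OF this] show "ev (Suc n) k * nsq n h \<le> qform n A h"
      by (simp add: nsq_def qform_def inner_n_def mat_vec_def h'_def)
  qed
qed

text \<open>The orthogonality conditions are imposed on the backward shift of \<open>h\<close>; the shift does not
  change the Toeplitz form and raises the diagonal form by \<open>\<epsilon> \<parallel>h\<parallel>\<^sup>2\<close>.\<close>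

lemma ev_shift:
  assumes "k < n"
  shows "ev n k + \<epsilon> \<le> ev (Suc n) (Suc k)"
proof -
  obtain J where J: "finite J" "card J \<le> k" "\<And>h. \<forall>a\<in>J. (\<Sum>i<n. a i * h i) = 0 \<Longrightarrow> qform n A h \<ge> ev n k * nsq n h"
    using ev_orthogonal[of k n] assms by auto
  \<comment> \<open>The extra form imposes \<open>h 0 = 0\<close>, so that the backward shift keeps
    the norm; it accounts for the passage from \<open>k\<close> to \<open>Suc k\<close>.\<close>
  define J' where "J' = insert (\<lambda>i. of_bool (i = 0)) ((\<lambda>a i. if i = 0 then 0 else a (i - 1)) ` J)"
  have "card ((\<lambda>(a::nat \<Rightarrow> complex) i. if i = 0 then 0 else a (i - 1)) ` J) \<le> k"
    using J card_image_le le_trans by blast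
  then have "card J' \<le> Suc k" "finite J'"
    using J by (auto simp: J'_def intro: order.trans[OF card_insert_le_m1])
  then show ?thesis
  proof (intro ev_lower_bound)
    fix h :: "nat \<Rightarrow> complex"
    assume h: "\<forall>a\<in>J'. (\<Sum>i<Suc n. a i * h i) = 0"
    have h0: "h 0 = 0"
    proof -
      have "(\<Sum>i<Suc n. of_bool (i = 0) * h i) = 0" using h by (simp add: J'_def)
      moreover have "(\<Sum>i<Suc n. of_bool (i = 0) * h i) = h 0"
        by (subst sum.lessThan_Suc_shift) simp
      ultimately show ?thesis by simp
    qed
    define g where "g i = h (Suc i)" for i
    have "\<forall>a\<in>J. (\<Sum>i<n. a i * g i) = 0"
      using h by (auto simp: J'_def g_def sum.lessThan_Suc_shift simp del: sum.lessThan_Suc)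
    from J(3)[OF this] have 1: "ev n k * nsq n g \<le> qform n A g" .
    have 2: "nsq (Suc n) h = nsq n g"
      by (simp add: nsq_def sum.lessThan_Suc_shift h0 g_def del: sum.lessThan_Suc)
    have 3: "toeplitz_form c (Suc n) h = toeplitz_form c n g"
      by (simp add: toeplitz_form_def sum.lessThan_Suc_shift h0 g_def del: sum.lessThan_Suc)
    have "(\<Sum>j<Suc n. \<epsilon> * real j * (cmod (h j))\<^sup>2) = (\<Sum>j<n. \<epsilon> * real j * (cmod (g j))\<^sup>2) + \<epsilon> * nsq n g"
      by (simp add: nsq_def sum.lessThan_Suc_shift h0 g_def sum.distrib algebra_simps sum_distrib_left del:
        sum.lessThan_Suc)
    then show "(ev n k + \<epsilon>) * nsq (Suc n) h \<le> qform (Suc n) A h"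
      using 1 by (simp add: qform_lax_mat 2 3 algebra_simps)
  qed (use assms in auto)
qed

lemma ev_decseq:
  assumes "k < n" "n \<le> m"
  shows "ev m k \<le> ev n k"
  using assms(2)
proof (induction m rule: dec_induct)
  case (step m)
  then show ?case using ev_Suc_le[of k m] assms(1) by simp
qed simp

text \<open>A decreasing sequence bounded by \<open>- D\<close> from below; the offset
  \<open>Suc k\<close> skips the sizes that have no \<open>k\<close>-th eigenvalue.\<close>

lemma ev_tendsto: "(\<lambda>n. ev n k) \<longlonglongrightarrow> evl k"
proof -
  have "decseq (\<lambda>n. ev (n + Suc k) k)"
    unfolding decseq_def by (auto intro!: ev_decseq)
  moreover have "- D \<le> ev (n + Suc k) k" for n by (rule ev_ge) simp
  ultimately obtain L where "(\<lambda>n. ev (n + Suc k) k) \<longlonglongrightarrow> L"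
    using decseq_convergent[of "\<lambda>n. ev (n + Suc k) k" "- D"] by blast
  then have "(\<lambda>n. ev n k) \<longlonglongrightarrow> L" by (rule LIMSEQ_offset)
  then show ?thesis by (simp add: limit_ev_def limI)
qed

lemma evl_le_ev: "k < n \<Longrightarrow> evl k \<le> ev n k"
  by (rule LIMSEQ_le_const2[OF ev_tendsto]) (use ev_decseq in blast)

lemma evl_ge: "(\<And>n. n \<ge> N \<Longrightarrow> x \<le> ev n k) \<Longrightarrow> x \<le> evl k"
  by (rule LIMSEQ_le_const[OF ev_tendsto]) blast

lemma evl_Suc: "evl k + \<epsilon> \<le> evl (Suc k)"
proof (rule evl_ge[of "Suc (Suc k)"])
  fix n assume "n \<ge> Suc (Suc k)"
  then obtain n' where n': "n = Suc n'" "k < n'" by (cases n) auto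
  then show "evl k + \<epsilon> \<le> ev n (Suc k)"
    using ev_shift[of k n'] evl_le_ev[of k n'] by simp
qed

lemma evl_add: "evl k + real m * \<epsilon> \<le> evl (k + m)"
proof (induction m)
  case (Suc m)
  then show ?case using evl_Suc[of "k + m"] by (simp add: algebra_simps)
qed simp

lemma evl_strict_mono: "strict_mono evl"
  unfolding strict_mono_Suc_iff
proof
  fix k
  show "evl k < evl (Suc k)" using evl_Suc[of k] eps_pos by linarith
qed

lemma sum_ev: "(\<Sum>k<n. ev n k) = (\<Sum>k<n. \<epsilon> * real k)"
proof -
  obtain \<phi> where e: "eigenbasis n A n \<phi> (ev n)" by (rule ev_eigenbasis)
  show ?thesis using eigenbasis_trace[OF e] by (simp add: lax_mat_def c_0)
qed

text \<open>The sequence \<open>evl k - k \<epsilon>\<close> is nondecreasing, and by the trace identity its averages are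
  nonpositive.\<close>

lemma evl_le: "evl k \<le> real k * \<epsilon>"
proof (rule ccontr)
  assume neg: "\<not> evl k \<le> real k * \<epsilon>"
  define a where "a = evl k - real k * \<epsilon>"
  have a: "a > 0" using neg by (simp add: a_def)
  have mono: "evl k - real k * \<epsilon> \<le> evl (k + m) - real (k + m) * \<epsilon>" for k m
    using evl_add[of k m] by (simp add: algebra_simps)
  define s where "s = (\<Sum>j<k. evl j - real j * \<epsilon>)"
  \<comment> \<open>From index \<open>k\<close> on every term is at least \<open>a > 0\<close>, so
    sufficiently many of them outweigh the fixed initial sum \<open>s\<close>, while the trace keeps
    the total from being positive.\<close>
  obtain m :: nat where m: "real m * a > - s" using a reals_Archimedean3 by blast
  have "(\<Sum>j<k + m. evl j - real j * \<epsilon>) = s + (\<Sum>j\<in>{k..<k+m}. evl j - real j * \<epsilon>)"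
    unfolding s_def by (subst sum.atLeastLessThan_concat[of 0 k "k+m", symmetric, unfolded atLeast0LessThan])
      auto
  also have "\<dots> \<ge> s + (\<Sum>j\<in>{k..<k+m}. a)"
  proof (intro add_left_mono sum_mono)
    fix j assume "j \<in> {k..<k+m}"
    then show "a \<le> evl j - real j * \<epsilon>" using mono[of k "j - k"] by (simp add: a_def)
  qed
  finally have "(\<Sum>j<k + m. evl j - real j * \<epsilon>) > 0" using m by simp
  moreover have "(\<Sum>j<k + m. evl j) \<le> (\<Sum>j<k + m. ev (k + m) j)"
    by (intro sum_mono evl_le_ev) auto
  ultimately show False by (simp add: sum_ev sum_subtractf mult.commute)
qed

text \<open>Unit eigenvectors of the truncations converge in every coordinate along a subsequence.
  The danger is that the limit vanishes because mass moves to ever higher modes; the diagonal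
  \<open>\<epsilon> j\<close> prevents it. Only boundedness of the limit is recorded here; decay is
  recovered from the equation in \<open>eigenvector_decay\<close>.\<close>

lemma evl_eigenvector:
  obtains a :: "nat \<Rightarrow> complex" where "\<And>j. cmod (a j) \<le> 1" "\<exists>j. a j \<noteq> 0"
    "\<And>j. of_real (\<epsilon> * real j) * a j - (\<Sum>m. c (int j - int m) * a m) = of_real (evl k) * a j"
proof -
  have "\<exists>\<phi>. eigenbasis n A n \<phi> (ev n)" for n by (rule ev_eigenbasis) blast
  then obtain \<phi> where e: "\<And>n. eigenbasis n A n (\<phi> n) (ev n)" by metis
  define F where "F n j = (if k < n \<and> j < n then \<phi> n k j else 0)" for n j
  have nsqF: "nsq n (F n) = 1" if "k < n" for n
  proof -
    have "complex_of_real (nsq n (F n)) = inner_n n (\<phi> n k) (\<phi> n k)"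
      unfolding inner_n_self[symmetric] using that by (intro inner_n_cong) (auto simp: F_def)
    also have "\<dots> = 1" using e[of n] that by (simp add: eigenbasis_def)
    finally show ?thesis by simp
  qed
  have F1: "cmod (F n j) \<le> 1" for n j
  proof (cases "k < n \<and> j < n")
    case True
    then have "(cmod (F n j))\<^sup>2 \<le> nsq n (F n)" unfolding nsq_def
      by (intro member_le_sum) auto
    then show ?thesis using nsqF[of n] True by (simp add: abs_square_le_1)
  qed (auto simp: F_def)
  have Feig: "mat_vec n A (F n) j = of_real (ev n k) * F n j" if "k < n" "j < n" for n j
  proof -
    have "mat_vec n A (F n) = mat_vec n A (\<phi> n k)" using that by (intro mat_vec_cong) (auto simp: F_def)
    then show ?thesis using e[of n] that by (simp add: eigenbasis_def F_def)
  qed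
  obtain r where r: "strict_mono (r::nat\<Rightarrow>nat)" "\<And>j. j \<in> UNIV \<Longrightarrow> \<exists>l. (\<lambda>p. F (r p) j) \<longlonglongrightarrow> l"
    using function_convergent_subsequence[of "UNIV::nat set" F 1] F1 by (metis countableI_type)
  define a where "a j = lim (\<lambda>p. F (r p) j)" for j
  have a: "(\<lambda>p. F (r p) j) \<longlonglongrightarrow> a j" for j
    using r(2)[of j] by (auto simp: a_def limI)
  have r_large: "\<forall>\<^sub>F p in sequentially. N \<le> r p" for N
    using filterlim_subseq[OF r(1)] by (simp add: filterlim_at_top)
  have a1: "cmod (a j) \<le> 1" for j
    by (rule LIMSEQ_le_const2[OF tendsto_norm[OF a]]) (use F1 in blast)
  \<comment> \<open>\<open>K\<close> bounds the diagonal energy: the eigenvalue plus what the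
    Toeplitz part can contribute. Beyond \<open>N\<close> the diagonal exceeds
    \<open>2 K + 1\<close>, so those modes carry at most half of the unit mass.\<close>
  define K where "K = ev (Suc k) k + D"
  obtain N :: nat where N: "real N * \<epsilon> > 2 * K + 1" using eps_pos reals_Archimedean3 by blast
  have half: "(\<Sum>j<N. (cmod (F n j))\<^sup>2) \<ge> 1/2" if n: "k < n" "N \<le> n" for n
  proof -
    have "inner_n n (mat_vec n A (F n)) (F n) = inner_n n (\<lambda>j. of_real (ev n k) * F n j) (F n)"
      using Feig n by (intro inner_n_cong) auto
    then have "qform n A (F n) = ev n k" using nsqF n by (simp add: qform_def inner_n_scale_left inner_n_self)
    also have "\<dots> \<le> ev (Suc k) k" using ev_decseq[of k "Suc k" n] n by simp
    finally have "(\<Sum>j<n. \<epsilon> * real j * (cmod (F n j))\<^sup>2) \<le> K"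
      unfolding qform_lax_mat K_def using abs_toeplitz_form_le[of n "F n"] nsqF n by simp
    moreover have "(\<Sum>j\<in>{N..<n}. (\<epsilon> * real N) * (cmod (F n j))\<^sup>2) \<le> (\<Sum>j<n. \<epsilon> * real j * (cmod (F n j))\<^sup>2)"
    proof (rule order.trans)
      show "(\<Sum>j\<in>{N..<n}. (\<epsilon> * real N) * (cmod (F n j))\<^sup>2) \<le> (\<Sum>j\<in>{N..<n}. (\<epsilon> * real j) * (cmod (F n j))\<^sup>2)"
        using eps_pos by (intro sum_mono mult_right_mono mult_left_mono) auto
      show "(\<Sum>j\<in>{N..<n}. (\<epsilon> * real j) * (cmod (F n j))\<^sup>2) \<le> (\<Sum>j<n. \<epsilon> * real j * (cmod (F n j))\<^sup>2)"
        using eps_pos by (intro sum_mono2) auto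
    qed
    ultimately have 1: "(\<epsilon> * real N) * (\<Sum>j\<in>{N..<n}. (cmod (F n j))\<^sup>2) \<le> K" by (simp add: sum_distrib_left)
    have 2: "nsq n (F n) = (\<Sum>j<N. (cmod (F n j))\<^sup>2) + (\<Sum>j\<in>{N..<n}. (cmod (F n j))\<^sup>2)"
      unfolding nsq_def using n
      by (subst sum.atLeastLessThan_concat[of 0 N n, symmetric, unfolded atLeast0LessThan]) auto
    have "(\<Sum>j\<in>{N..<n}. (cmod (F n j))\<^sup>2) \<le> 1/2"
    proof (rule ccontr)
      assume "\<not> ?thesis"
      then have "(\<epsilon> * real N) * (1/2) \<le> (\<epsilon> * real N) * (\<Sum>j\<in>{N..<n}. (cmod (F n j))\<^sup>2)"
        using eps_pos by (intro mult_left_mono) auto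
      then show False using 1 N by (simp add: mult.commute)
    qed
    then show ?thesis using 2 nsqF n by simp
  qed
  have "(\<Sum>j<N. (cmod (a j))\<^sup>2) \<ge> 1/2"
  proof (rule tendsto_lowerbound)
    show "(\<lambda>p. \<Sum>j<N. (cmod (F (r p) j))\<^sup>2) \<longlonglongrightarrow> (\<Sum>j<N. (cmod (a j))\<^sup>2)"
      by (intro tendsto_intros a)
    show "\<forall>\<^sub>F p in sequentially. (\<Sum>j<N. (cmod (F (r p) j))\<^sup>2) \<ge> 1/2"
      using r_large[of "Suc k"] r_large[of N] by eventually_elim (use half in auto)
  qed auto
  then have "(\<Sum>j<N. (cmod (a j))\<^sup>2) \<noteq> 0" by linarith
  then have ex: "\<exists>j. a j \<noteq> 0" using sum.neutral[of "{..<N}" "\<lambda>j. (cmod (a j))\<^sup>2"] by fastforce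
  have eq: "of_real (\<epsilon> * real j) * a j - (\<Sum>m. c (int j - int m) * a m) = of_real (evl k) * a j" for j
  proof -
    have sc: "summable (\<lambda>m. cmod (c (int j - int m)))"
    proof (rule summableI_nonneg_bounded)
      show "(\<Sum>m<n. cmod (c (int j - int m))) \<le> D" for n
        by (rule sum_inj_le[of "\<lambda>m. cmod (c m)", OF sum_le_D]) (auto simp: inj_on_def)
    qed simp
    \<comment> \<open>Tannery's theorem moves the limit inside the infinite convolution: all entries
      are at most 1 in modulus, so the coefficients themselves are a summable majorant.\<close>
    have lim: "(\<lambda>p. \<Sum>m. c (int j - int m) * F (r p) m) \<longlonglongrightarrow> (\<Sum>m. c (int j - int m) * a m)"
    proof (rule tannerys_theorem[THEN conjunct2, THEN conjunct2])
      show "((\<lambda>n. c (int j - int m) * F (r n) m) \<longlongrightarrow> c (int j - int m) * a m) sequentially" for m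
        by (intro tendsto_intros a)
      show "\<forall>\<^sub>F (m, n) in sequentially \<times>\<^sub>F sequentially. cmod (c (int j - int m) * F (r n) m)
        \<le> cmod (c (int j - int m))"
        using F1 by (intro always_eventually) (auto simp: norm_mult intro!: mult_left_le)
    qed (use sc in auto)
    have l1: "(\<lambda>p. of_real (\<epsilon> * real j) * F (r p) j - (\<Sum>m. c (int j - int m) * F (r p) m))
        \<longlonglongrightarrow> of_real (\<epsilon> * real j) * a j - (\<Sum>m. c (int j - int m) * a m)"
      by (intro tendsto_intros a lim)
    have l2: "(\<lambda>p. complex_of_real (ev (r p) k) * F (r p) j) \<longlonglongrightarrow> of_real (evl k) * a j"
      using LIMSEQ_subseq_LIMSEQ[OF ev_tendsto r(1), of k] by (intro tendsto_intros a) (simp add: o_def)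
    have l3: "\<forall>\<^sub>F p in sequentially. of_real (\<epsilon> * real j) * F (r p) j - (\<Sum>m. c (int j - int m) * F (r p) m)
      = complex_of_real (ev (r p) k) * F (r p) j"
      using r_large[of "Suc k"] r_large[of "Suc j"]
    proof eventually_elim
      case (elim p)
      define n where "n = r p"
      have n: "k < n" "j < n" using elim by (auto simp: n_def)
      have "(\<Sum>m. c (int j - int m) * F n m) = (\<Sum>m<n. c (int j - int m) * F n m)"
        by (rule suminf_finite) (auto simp: F_def)
      then show ?case using Feig[OF n] unfolding mat_vec_lax_mat[OF n(2)] by (simp add: n_def)
    qed
    show ?thesis by (rule LIMSEQ_unique[OF Lim_transform_eventually[OF l1 l3] l2])
  qed
  show ?thesis using that a1 ex eq by blast
qed

text \<open>Truncations of an eigenvector are approximate eigenvectors of the truncated matrices, which is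
  impossible if \<open>\<mu>\<close> stays away from their spectra.\<close>

lemma eigenvalue_is_evl:
  assumes "summable (\<lambda>j. cmod (a j))" "a i0 \<noteq> 0"
    and eq: "\<And>j. of_real (\<epsilon> * real j) * a j - (\<Sum>m. c (int j - int m) * a m) = of_real \<mu> * a j"
  shows "\<mu> \<in> range evl"
proof (rule ccontr)
  assume no: "\<mu> \<notin> range evl"
  \<comment> \<open>Limits with index at least \<open>K\<close> are at least
    \<open>\<mu> + 1\<close>, and truncated eigenvalues lie above their limits. So convergence has
    to be watched at finitely many indices only.\<close>
  obtain K :: nat where K: "real K * \<epsilon> > \<mu> + 1 - evl 0" using eps_pos reals_Archimedean3 by blast
  have evK: "evl K \<ge> \<mu> + 1" using evl_add[of 0 K] K by simp
  \<comment> \<open>Half of the smallest distance, so that a distance \<open>d\<close> remains after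
    a perturbation smaller than \<open>d\<close>.\<close>
  define d where "d = Min (insert 1 ((\<lambda>k. \<bar>evl k - \<mu>\<bar> / 2) ` {..<K}))"
  have d: "d > 0" "d \<le> 1" "\<And>k. k < K \<Longrightarrow> d \<le> \<bar>evl k - \<mu>\<bar> / 2"
  proof -
    show "d > 0" using no by (auto simp: d_def)
    show "d \<le> 1" unfolding d_def by (rule Min_le) auto
    show "d \<le> \<bar>evl k - \<mu>\<bar> / 2" if "k < K" for k unfolding d_def using that by (intro Min_le) auto
  qed
  have "\<forall>\<^sub>F n in sequentially. \<forall>k\<in>{..<K}. \<bar>ev n k - evl k\<bar> < d"
    using d(1) tendstoD[OF ev_tendsto, of d] by (intro eventually_ball_finite) (auto simp: dist_real_def)
  then obtain N where N: "\<And>n k. n \<ge> N \<Longrightarrow> k < K \<Longrightarrow> \<bar>ev n k - evl k\<bar> < d"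
    by (auto simp: eventually_sequentially)
  have far: "d \<le> \<bar>ev n k - \<mu>\<bar>" if "n \<ge> N" "k < n" for n k
  proof (cases "k < K")
    case True
    have "\<bar>evl k - \<mu>\<bar> \<le> \<bar>ev n k - evl k\<bar> + \<bar>ev n k - \<mu>\<bar>" by linarith
    moreover have "2 * d \<le> \<bar>evl k - \<mu>\<bar>" using d(3)[OF True] by (simp add: field_simps)
    moreover have "\<bar>ev n k - evl k\<bar> < d" using N[OF that(1) True] .
    ultimately show ?thesis by (simp only: mult_2)
  next
    case False
    then have "ev n K \<le> ev n k" "evl K \<le> ev n K" using that by (auto intro!: ev_mono evl_le_ev)
    then show ?thesis using evK d(2) by linarith
  qed
  define t where "t n = (\<Sum>m. cmod (a (m + n)))" for n
  have t: "t \<longlonglongrightarrow> 0"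
  proof (rule LIMSEQ_I)
    fix r :: real assume "0 < r"
    from suminf_exist_split[OF this assms(1)] show "\<exists>no. \<forall>n\<ge>no. norm (t n - 0) < r" by (simp add: t_def)
  qed
  have sa: "summable (\<lambda>m. cmod (a (m + n)))" for n
    using assms(1) by (rule summable_ignore_initial_segment)
  have sca: "summable (\<lambda>m. cmod (c (int j - int (m + n))) * cmod (a (m + n)))" for j n
  proof (rule summable_comparison_test)
    show "\<exists>N. \<forall>m\<ge>N. norm (cmod (c (int j - int (m + n))) * cmod (a (m + n))) \<le> D * cmod (a (m + n))"
      by (auto intro!: mult_right_mono cmod_c_le)
    show "summable (\<lambda>m. D * cmod (a (m + n)))" using sa by (intro summable_mult)
  qed
  have sca': "summable (\<lambda>m. c (int j - int (m + n)) * a (m + n))" for j n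
    by (rule summable_norm_cancel) (use sca[of j n] in \<open>simp add: norm_mult\<close>)
  \<comment> \<open>Subtracting the truncated equation from the infinite one leaves the contribution
    of the entries beyond \<open>n\<close>. Its sum of moduli is at most \<open>D * t n\<close> by
    column sums, and this dominates the Euclidean norm.\<close>
  have bound: "nsq n (\<lambda>i. mat_vec n A a i - of_real \<mu> * a i) \<le> (D * t n)\<^sup>2" for n
  proof -
    define s where "s i = mat_vec n A a i - of_real \<mu> * a i" for i
    have s: "s i = (\<Sum>m. c (int i - int (m + n)) * a (m + n))" if "i < n" for i
    proof -
      have "mat_vec n A a i = of_real (\<epsilon> * real i) * a i - (\<Sum>m<n. c (int i - int m) * a m)"
        by (rule mat_vec_lax_mat[OF that])
      moreover have "(\<Sum>m. c (int i - int m) * a m) = (\<Sum>m. c (int i - int (m + n)) * a (m + n))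
        + (\<Sum>m<n. c (int i - int m) * a m)"
        using suminf_split_initial_segment[OF sca'[of i 0, simplified]] by simp
      ultimately show ?thesis unfolding s_def eq[of i, symmetric] by simp
    qed
    have "(\<Sum>i<n. cmod (s i)) \<le> (\<Sum>i<n. \<Sum>m. cmod (c (int i - int (m + n))) * cmod (a (m + n)))"
    proof (intro sum_mono)
      fix i assume "i \<in> {..<n}"
      then show "cmod (s i) \<le> (\<Sum>m. cmod (c (int i - int (m + n))) * cmod (a (m + n)))"
        using summable_norm[of "\<lambda>m. c (int i - int (m + n)) * a (m + n)"] sca[of i n]
          by (simp add: s norm_mult)
    qed
    also have "\<dots> = (\<Sum>m. \<Sum>i<n. cmod (c (int i - int (m + n))) * cmod (a (m + n)))"
      by (rule suminf_sum[symmetric]) (rule sca)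
    also have "\<dots> \<le> (\<Sum>m. D * cmod (a (m + n)))"
    proof (rule suminf_le)
      fix m
      have "(\<Sum>i<n. cmod (c (int i - int (m + n)))) \<le> D"
        by (rule sum_inj_le[of "\<lambda>m. cmod (c m)", OF sum_le_D]) (auto simp: inj_on_def)
      then show "(\<Sum>i<n. cmod (c (int i - int (m + n))) * cmod (a (m + n))) \<le> D * cmod (a (m + n))"
        by (simp add: sum_distrib_right[symmetric] mult_right_mono)
    qed (use sa sca in \<open>auto intro!: summable_sum summable_mult\<close>)
    also have "\<dots> = D * t n" unfolding t_def using sa by (rule suminf_mult)
    finally have "(\<Sum>i<n. cmod (s i)) \<le> D * t n" .
    moreover have "nsq n s \<le> (\<Sum>i<n. cmod (s i))\<^sup>2"
      unfolding nsq_def power2_eq_square sum_distrib_left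
      by (intro sum_mono mult_right_mono member_le_sum) auto
    ultimately show ?thesis
      unfolding s_def[symmetric] by (meson order.trans power_mono sum_nonneg norm_ge_zero)
  qed
  have "(\<lambda>n. (D * t n)\<^sup>2) \<longlonglongrightarrow> (D * 0)\<^sup>2" by (intro tendsto_intros t)
  then have lim: "(\<lambda>n. (D * t n)\<^sup>2) \<longlonglongrightarrow> 0" by simp
  have "d\<^sup>2 * (cmod (a i0))\<^sup>2 \<le> 0"
  proof (rule LIMSEQ_le_const[OF lim], intro exI allI impI)
    fix n assume n: "max N (Suc i0) \<le> n"
    obtain \<phi> where e: "eigenbasis n A n \<phi> (ev n)" by (rule ev_eigenbasis)
    have "(cmod (a i0))\<^sup>2 \<le> nsq n a" unfolding nsq_def using n by (intro member_le_sum) auto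
    then have "d\<^sup>2 * (cmod (a i0))\<^sup>2 \<le> d\<^sup>2 * nsq n a" by (intro mult_left_mono) auto
    also have "\<dots> \<le> (D * t n)\<^sup>2"
      using eigenbasis_residual[OF e hermitian, of d \<mu> a] far[of n] d(1) n bound[of n] by fastforce
    finally show "d\<^sup>2 * (cmod (a i0))\<^sup>2 \<le> (D * t n)\<^sup>2" .
  qed
  then show False using d(1) assms(2) by (simp add: mult_le_0_iff power2_eq_square)
qed

end

section \<open>Quadrature on blocks\<close>

lemma sum_cis_roots:
  fixes l :: int
  assumes "\<bar>l\<bar> < int B"
  shows "(\<Sum>r<B. cis (of_int l * (2 * pi * real r / real B))) = (if l = 0 then of_nat B else 0)"
proof (cases "l = 0")
  case False
  define z where "z = cis (2 * pi * of_int l / real B)"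
  have B: "B > 0" using assms by auto
  have pow: "cis (of_int l * (2 * pi * real r / real B)) = z ^ r" for r
  proof -
    have "z ^ r = cis (real r * (2 * pi * of_int l / real B))" unfolding z_def by (rule Complex.DeMoivre)
    then show ?thesis by (simp add: mult_ac)
  qed
  have "z ^ B = 1"
  proof -
    have "z ^ B = cis (real B * (2 * pi * of_int l / real B))" unfolding z_def by (rule Complex.DeMoivre)
    also have "real B * (2 * pi * of_int l / real B) = 2 * pi * of_int l" using B by simp
    finally show ?thesis by (simp add: cis_multiple_2pi)
  qed
  moreover have "z \<noteq> 1"
  proof
    assume "z = 1"
    then have "exp (\<i> * of_real (2 * pi * of_int l / real B)) = 1" by (simp add: z_def cis_conv_exp)
    then obtain n :: int where "2 * pi * of_int l / real B = of_int (2 * n) * pi"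
      by (auto simp: exp_eq_1)
    then have "of_int l = of_int n * real B" using B by (simp add: field_simps)
    then have "l = n * int B" by (metis of_int_eq_iff of_int_mult of_int_of_nat_eq)
    then show False using assms False by (auto simp: abs_mult)
  qed
  ultimately have "(\<Sum>r<B. z ^ r) = 0" by (simp add: sum_gp_strict)
  then show ?thesis using False by (simp only: pow if_False)
qed simp

definition node :: "nat \<Rightarrow> nat \<Rightarrow> real" where
  "node B r = 2 * pi * real r / real B"

text \<open>A partial Fourier sum, and at the same time the generating function of the Toeplitz
  matrix with coefficients \<open>band c M\<close>.\<close>

definition trig_poly :: "(int \<Rightarrow> complex) \<Rightarrow> nat \<Rightarrow> real \<Rightarrow> complex" where
  "trig_poly c M \<theta> = (\<Sum>m\<in>{-int M..int M}. c m * cis (of_int m * \<theta>))"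

text \<open>At the nodes this is the discrete Fourier transform of \<open>g\<close> of length
  \<open>B\<close>, up to the sign convention.\<close>

definition symbol :: "nat \<Rightarrow> (nat \<Rightarrow> complex) \<Rightarrow> real \<Rightarrow> complex" where
  "symbol B g \<theta> = (\<Sum>s<B. g s * cis (real s * \<theta>))"

definition band :: "(int \<Rightarrow> complex) \<Rightarrow> nat \<Rightarrow> int \<Rightarrow> complex" where
  "band c M m = (if \<bar>m\<bar> \<le> int M then c m else 0)"

text \<open>The quadrature is exact because no frequency is aliased: all frequencies in the product are
  below \<open>B\<close> in absolute value.\<close>

lemma toeplitz_quadrature:
  assumes "M < B" and g: "\<And>s. B - M \<le> s \<Longrightarrow> s < B \<Longrightarrow> g s = 0"
  shows "(\<Sum>s<B. \<Sum>t<B. band c M (int s - int t) * g t * cnj (g s)) =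
    (\<Sum>r<B. trig_poly c M (node B r) * of_real ((cmod (symbol B g (node B r)))\<^sup>2)) / of_nat B"
proof -
  define I where "I = {-int M..int M}"
  have term_eq: "trig_poly c M (node B r) * of_real ((cmod (symbol B g (node B r)))\<^sup>2) =
     (\<Sum>m\<in>I. \<Sum>s<B. \<Sum>t<B. c m * g t * cnj (g s) * cis (of_int (m + int t - int s) * node B r))" for r
  proof -
    have "trig_poly c M (node B r) * (symbol B g (node B r) * cnj (symbol B g (node B r)))
      = (\<Sum>m\<in>I. c m * cis (of_int m * node B r)) * ((\<Sum>s<B. cnj (g s) * cis (- (real s * node B r)))
        * (\<Sum>t<B. g t * cis (real t * node B r)))"
      by (simp add: trig_poly_def symbol_def I_def cis_cnj mult.commute)
    also have "\<dots>
      = (\<Sum>m\<in>I. \<Sum>s<B. \<Sum>t<B. c m * cis (of_int m * node B r)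
        * (cnj (g s) * cis (- (real s * node B r)) * (g t * cis (real t * node B r))))"
    proof -
      have X: "(\<Sum>s<B. cnj (g s) * cis (- (real s * node B r))) * (\<Sum>t<B. g t * cis (real t * node B r))
        = (\<Sum>s<B. \<Sum>t<B. cnj (g s) * cis (- (real s * node B r)) * (g t * cis (real t * node B r)))"
        by (rule sum_product)
      show ?thesis unfolding X by (subst sum_distrib_right) (simp only: sum_distrib_left)
    qed
    also have "\<dots> = (\<Sum>m\<in>I. \<Sum>s<B. \<Sum>t<B. c m * g t * cnj (g s) * cis (of_int (m + int t - int s) * node B r))"
    proof (intro sum.cong refl)
      fix m s t
      have "cis (of_int (m + int t - int s) * node B r)
        = cis (of_int m * node B r) * cis (- (real s * node B r)) * cis (real t * node B r)"
        by (simp add: cis_mult algebra_simps)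
      then show "c m * cis (of_int m * node B r)
        * (cnj (g s) * cis (- (real s * node B r)) * (g t * cis (real t * node B r)))
        = c m * g t * cnj (g s) * cis (of_int (m + int t - int s) * node B r)" by (simp only: mult_ac)
    qed
    finally show ?thesis unfolding complex_norm_square .
  qed
  have inner: "(\<Sum>r<B. c m * g t * cnj (g s) * cis (of_int (m + int t - int s) * node B r)) =
      (if m = int s - int t then of_nat B * (c m * g t * cnj (g s)) else 0)"
    if "m \<in> I" "s < B" "t < B" for m s t
  proof (cases "g t = 0 \<or> g s = 0")
    case False
    \<comment> \<open>The last \<open>M\<close> entries of \<open>g\<close> vanish, so
      \<open>\<bar>t - s\<bar> < B - M\<close>; adding a frequency
      \<open>\<bar>m\<bar> \<le> M\<close> stays below \<open>B\<close>, where the roots of unity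
      are orthogonal.\<close>
    then have "s < B - M" "t < B - M" using g that by (meson not_le)+
    then have "\<bar>m + int t - int s\<bar> < int B" using that \<open>M < B\<close> by (auto simp: I_def)
    from sum_cis_roots[OF this] show ?thesis
      unfolding sum_distrib_left[symmetric] node_def by auto
  qed auto
  have "(\<Sum>r<B. trig_poly c M (node B r) * of_real ((cmod (symbol B g (node B r)))\<^sup>2))
    = (\<Sum>m\<in>I. \<Sum>s<B. \<Sum>t<B. \<Sum>r<B. c m * g t * cnj (g s) * cis (of_int (m + int t - int s) * node B r))"
  proof -
    let ?F = "\<lambda>m s t r. c m * g t * cnj (g s) * cis (of_int (m + int t - int s) * node B r)"
    have "(\<Sum>r<B. \<Sum>m\<in>I. \<Sum>s<B. \<Sum>t<B. ?F m s t r) = (\<Sum>m\<in>I. \<Sum>r<B. \<Sum>s<B. \<Sum>t<B. ?F m s t r)"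
      by (rule sum.swap)
    also have "\<dots> = (\<Sum>m\<in>I. \<Sum>s<B. \<Sum>r<B. \<Sum>t<B. ?F m s t r)"
      by (rule sum.cong[OF refl]) (rule sum.swap)
    also have "\<dots> = (\<Sum>m\<in>I. \<Sum>s<B. \<Sum>t<B. \<Sum>r<B. ?F m s t r)"
      by (rule sum.cong[OF refl], rule sum.cong[OF refl]) (rule sum.swap)
    finally show ?thesis unfolding term_eq .
  qed
  also have "\<dots> = (\<Sum>m\<in>I. \<Sum>s<B. \<Sum>t<B. if m = int s - int t then of_nat B * (c m * g t * cnj (g s)) else 0)"
    by (intro sum.cong refl inner) auto
  also have "\<dots> = (\<Sum>s<B. \<Sum>t<B. \<Sum>m\<in>I. if m = int s - int t then of_nat B * (c m * g t * cnj (g s)) else 0)"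
  proof -
    let ?F = "\<lambda>m s t. if m = int s - int t then of_nat B * (c m * g t * cnj (g s)) else 0"
    have "(\<Sum>m\<in>I. \<Sum>s<B. \<Sum>t<B. ?F m s t) = (\<Sum>s<B. \<Sum>m\<in>I. \<Sum>t<B. ?F m s t)" by (rule sum.swap)
    also have "\<dots> = (\<Sum>s<B. \<Sum>t<B. \<Sum>m\<in>I. ?F m s t)" by (rule sum.cong[OF refl]) (rule sum.swap)
    finally show ?thesis .
  qed
  also have "\<dots> = (\<Sum>s<B. \<Sum>t<B. of_nat B * (band c M (int s - int t) * g t * cnj (g s)))"
  proof (intro sum.cong refl)
    fix s t
    have "finite I" by (simp add: I_def)
    then have "(\<Sum>m\<in>I. if m = int s - int t then of_nat B * (c m * g t * cnj (g s)) else 0) =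
      (if int s - int t \<in> I then of_nat B * (c (int s - int t) * g t * cnj (g s)) else 0)"
      by (simp add: sum.delta')
    also have "\<dots> = of_nat B * (band c M (int s - int t) * g t * cnj (g s))"
      by (auto simp: I_def band_def)
    finally show "(\<Sum>m\<in>I. if m = int s - int t then of_nat B * (c m * g t * cnj (g s)) else 0) =
      of_nat B * (band c M (int s - int t) * g t * cnj (g s))" .
  qed
  also have "\<dots> = of_nat B * (\<Sum>s<B. \<Sum>t<B. band c M (int s - int t) * g t * cnj (g s))"
    by (simp add: sum_distrib_left)
  finally show ?thesis using \<open>M < B\<close> by simp
qed

text \<open>The quadrature formula for the identity matrix, whose bandwidth is 0, so that no entry
  of \<open>g\<close> has to vanish.\<close>

lemma discrete_parseval:
  assumes "B > 0"
  shows "nsq B g = (\<Sum>r<B. (cmod (symbol B g (node B r)))\<^sup>2) / real B"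
proof -
  let ?c = "\<lambda>m::int. of_bool (m = 0) :: complex"
  have t1: "trig_poly ?c 0 \<theta> = 1" for \<theta> by (simp add: trig_poly_def)
  have "(\<Sum>s<B. \<Sum>t<B. band ?c 0 (int s - int t) * g t * cnj (g s))
    = (\<Sum>s<B. \<Sum>t<B. if s = t then g s * cnj (g s) else 0)"
    by (intro sum.cong) (auto simp: band_def)
  also have "\<dots> = complex_of_real (nsq B g)" unfolding inner_n_self[symmetric] inner_n_def by simp
  finally have "complex_of_real (nsq B g) = of_real ((\<Sum>r<B. (cmod (symbol B g (node B r)))\<^sup>2) / real B)"
    using toeplitz_quadrature[of 0 B g ?c] assms by (simp add: t1)
  then show ?thesis by (simp only: of_real_eq_iff)
qed

section \<open>Cutting the index range into blocks\<close>

lemma sum_shift_block: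
  fixes f :: "nat \<Rightarrow> 'a::comm_monoid_add"
  shows "(\<Sum>j\<in>{a..<a+B}. f j) = (\<Sum>s<B. f (a + s))"
  using sum.shift_bounds_nat_ivl[of f 0 a B] by (simp add: atLeast0LessThan add.commute)

lemma sum_blocks:
  fixes f :: "nat \<Rightarrow> 'a::comm_monoid_add"
  assumes "m * B \<le> n"
  shows "(\<Sum>j<n. f j) = (\<Sum>b<m. \<Sum>s<B. f (b * B + s)) + (\<Sum>j\<in>{m*B..<n}. f j)"
proof -
  have "(\<Sum>b<m. \<Sum>s<B. f (b * B + s)) = (\<Sum>b<m. sum f {b*B..<b*B+B})"
    by (simp only: sum_shift_block)
  also have "\<dots> = sum f {..<m*B}" by (rule sum.nat_group)
  finally show ?thesis
    using sum.atLeastLessThan_concat[of 0 "m*B" n f] assms by (simp add: atLeast0LessThan)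
qed

text \<open>An index in the last \<open>M\<close> places of a block carries the value 0, and any
  other index of the block is more than \<open>M\<close> away from all later blocks. So the band
  couples no two blocks, and none with the incomplete tail.\<close>

lemma band_block_decomposition:
  assumes "M < B" "m * B \<le> n"
    and h: "\<And>b s. b < m \<Longrightarrow> B - M \<le> s \<Longrightarrow> s < B \<Longrightarrow> h (b * B + s) = 0"
  shows "(\<Sum>j<n. \<Sum>k<n. band c M (int j - int k) * h k * cnj (h j)) =
    (\<Sum>b<m. \<Sum>s<B. \<Sum>t<B. band c M (int s - int t) * h (b * B + t) * cnj (h (b * B + s))) +
    (\<Sum>j\<in>{m*B..<n}. \<Sum>k\<in>{m*B..<n}. band c M (int j - int k) * h k * cnj (h j))"
  using assms(2) h
proof (induction m)
  case 0
  then show ?case by (simp add: atLeast0LessThan)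
next
  case (Suc m)
  define f where "f j k = band c M (int j - int k) * h k * cnj (h j)" for j k
  have cross: "f j k = 0 \<and> f k j = 0" if "m * B \<le> j" "j < Suc m * B" "Suc m * B \<le> k" for j k
  proof (cases "j - m * B < B - M")
    case True
    then have "int j + int M < int k" using that \<open>M < B\<close> by (auto simp: less_diff_conv)
    then show ?thesis by (simp add: f_def band_def)
  next
    case False
    then have "h j = 0" using Suc.prems(2)[of m "j - m * B"] that by auto
    then show ?thesis by (simp add: f_def)
  qed
  have le: "m * B \<le> Suc m * B" "Suc m * B \<le> n" using Suc.prems by auto
  have split: "sum F {m*B..<n} = sum F {m*B..<Suc m*B} + sum F {Suc m*B..<n}" for F :: "nat \<Rightarrow> complex"
    using le by (rule sum.atLeastLessThan_concat[symmetric])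
  have "(\<Sum>j\<in>{m*B..<n}. \<Sum>k\<in>{m*B..<n}. f j k) =
     (\<Sum>j\<in>{m*B..<Suc m*B}. \<Sum>k\<in>{m*B..<Suc m*B}. f j k) + (\<Sum>j\<in>{m*B..<Suc m*B}. \<Sum>k\<in>{Suc m*B..<n}. f j k)
   + ((\<Sum>j\<in>{Suc m*B..<n}. \<Sum>k\<in>{m*B..<Suc m*B}. f j k) + (\<Sum>j\<in>{Suc m*B..<n}. \<Sum>k\<in>{Suc m*B..<n}. f j k))"
    unfolding split sum.distrib by (simp only: add_ac)
  also have "(\<Sum>j\<in>{m*B..<Suc m*B}. \<Sum>k\<in>{Suc m*B..<n}. f j k) = 0"
    using cross by (intro sum.neutral ballI) simp
  also have "(\<Sum>j\<in>{Suc m*B..<n}. \<Sum>k\<in>{m*B..<Suc m*B}. f j k) = 0"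
    using cross by (intro sum.neutral ballI) simp
  also have "(\<Sum>j\<in>{m*B..<Suc m*B}. \<Sum>k\<in>{m*B..<Suc m*B}. f j k) =
      (\<Sum>s<B. \<Sum>t<B. f (m * B + s) (m * B + t))"
  proof -
    have eq: "{m*B..<Suc m*B} = {m*B..<m*B + B}" by (simp add: add.commute)
    show ?thesis unfolding eq sum_shift_block ..
  qed
  finally have "(\<Sum>j\<in>{m*B..<n}. \<Sum>k\<in>{m*B..<n}. f j k) =
     (\<Sum>s<B. \<Sum>t<B. f (m * B + s) (m * B + t)) + (\<Sum>j\<in>{Suc m*B..<n}. \<Sum>k\<in>{Suc m*B..<n}. f j k)" by simp
  then show ?case using Suc by (simp add: f_def add.assoc)
qed

section \<open>Lattice point counts and the constraints they pay for\<close>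

lemma count_less:
  "real (card {b::nat. b < m \<and> real b < y}) \<le> max 0 y + 1"
proof -
  have "{b::nat. b < m \<and> real b < y} \<subseteq> {..<nat \<lceil>max 0 y\<rceil>}"
    by (auto simp: zless_nat_eq_int_zless less_ceiling_iff)
  then have "card {b::nat. b < m \<and> real b < y} \<le> nat \<lceil>max 0 y\<rceil>"
    using card_mono[of "{..<nat \<lceil>max 0 y\<rceil>}"] by simp
  then show ?thesis by linarith
qed

text \<open>The shift to \<open>b + 1\<close> belongs to the upper bound, where the diagonal is
  evaluated at the far end of a block. The assumption keeps the subtraction of natural numbers
  exact.\<close>

lemma count_greater:
  assumes "y \<le> real m"
  shows "real (card {b::nat. b < m \<and> real b + 1 > y}) \<le> real m - max 0 y + 1"
proof -
  have "{b::nat. b < m \<and> real b + 1 > y} \<subseteq> {nat \<lfloor>max 0 y\<rfloor>..<m}"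
    by (auto simp: nat_le_iff floor_le_iff max_def)
  then have "card {b::nat. b < m \<and> real b + 1 > y} \<le> m - nat \<lfloor>max 0 y\<rfloor>"
    using card_mono[of "{nat \<lfloor>max 0 y\<rfloor>..<m}"] by simp
  moreover have "nat \<lfloor>max 0 y\<rfloor> \<le> m" using assms by (simp add: nat_le_iff floor_le_iff)
  moreover have "real (nat \<lfloor>max 0 y\<rfloor>) \<ge> max 0 y - 1" by linarith
  ultimately show ?thesis by linarith
qed

lemma card_pairs:
  "card {(b, r). b < (m::nat) \<and> r < (B::nat) \<and> P b r} = (\<Sum>r<B. card {b. b < m \<and> P b r})"
proof -
  have "{(b, r). b < m \<and> r < B \<and> P b r} = (\<lambda>(r, b). (b, r)) ` (SIGMA r:{..<B}. {b. b < m \<and> P b r})"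
    by (auto simp: image_iff)
  then have "card {(b, r). b < m \<and> r < B \<and> P b r} = card (SIGMA r:{..<B}. {b. b < m \<and> P b r})"
    by (simp add: card_image inj_on_def split_beta prod_eq_iff)
  also have "\<dots> = (\<Sum>r<B. card {b. b < m \<and> P b r})" by (rule card_SigmaI) auto
  finally show ?thesis .
qed

text \<open>The first family annihilates the last \<open>M\<close> entries of every block, which
  decouples the blocks. The second annihilates the discrete Fourier coefficient at node
  \<open>r\<close> of block \<open>b\<close> for every \<open>(b, r)\<close> in \<open>S\<close>.
  Min-max charges \<open>M m\<close> for the first and \<open>card S\<close> for the second.\<close>

definition block_constraints :: "nat \<Rightarrow> nat \<Rightarrow> nat \<Rightarrow> (nat \<times> nat) set \<Rightarrow> (nat \<Rightarrow> complex) set" where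
  "block_constraints B M m S =
     (\<lambda>(b, s) i. of_bool (i = b * B + s)) ` ({..<m} \<times> {B - M..<B}) \<union>
     (\<lambda>(b, r) i. if i div B = b then cis (real (i mod B) * node B r) else 0) ` S"

lemma block_constraints:
  assumes "M < B" "m * B \<le> n" "S \<subseteq> {..<m} \<times> {..<B}"
  shows "finite (block_constraints B M m S)" "card (block_constraints B M m S) \<le> M * m + card S"
    "\<forall>a\<in>block_constraints B M m S. (\<Sum>i<n. a i * h i) = 0 \<Longrightarrow> b < m \<Longrightarrow> B - M \<le> s \<Longrightarrow> s < B \<Longrightarrow> h (b * B + s) = 0"
    "\<forall>a\<in>block_constraints B M m S. (\<Sum>i<n. a i * h i) = 0 \<Longrightarrow> (b, r) \<in> S
      \<Longrightarrow> symbol B (\<lambda>s. h (b * B + s)) (node B r) = 0"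
proof -
  have fS: "finite S" using assms(3) by (rule finite_subset) auto
  then show "finite (block_constraints B M m S)" by (auto simp: block_constraints_def)
  have "card (block_constraints B M m S)
    \<le> card ((\<lambda>(b, s) i. of_bool (i = b * B + s) :: complex) ` ({..<m} \<times> {B - M..<B})) +
     card ((\<lambda>(b, r) i. if i div B = b then cis (real (i mod B) * node B r) else 0) ` S)"
    unfolding block_constraints_def by (rule card_Un_le)
  also have "\<dots> \<le> card ({..<m} \<times> {B - M..<B}) + card S"
    using fS by (intro add_mono card_image_le) auto
  also have "card ({..<m} \<times> {B - M..<B}) = M * m" using assms(1) by (simp add: card_cartesian_product)
  finally show "card (block_constraints B M m S) \<le> M * m + card S" .
  assume C: "\<forall>a\<in>block_constraints B M m S. (\<Sum>i<n. a i * h i) = 0"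
  have inn: "b * B + s < n" if "b < m" "s < B" for b s
  proof -
    have "b * B + s < Suc b * B" using that by simp
    also have "\<dots> \<le> m * B" using that by (intro mult_le_mono1) simp
    finally show ?thesis using assms(2) by simp
  qed
  show "h (b * B + s) = 0" if "b < m" "B - M \<le> s" "s < B"
  proof -
    have "(\<lambda>i. of_bool (i = b * B + s)) \<in> block_constraints B M m S"
      unfolding block_constraints_def using that by (intro UnI1 image_eqI[of _ _ "(b, s)"]) auto
    from bspec[OF C this] have "0 = (\<Sum>i<n. of_bool (i = b * B + s) * h i)" by (rule sym)
    also have "\<dots> = (\<Sum>i<n. if i = b * B + s then h i else 0)" by (intro sum.cong) auto
    also have "\<dots> = h (b * B + s)" using inn[of b s] that by simp
    finally show ?thesis by simp
  qed
  show "symbol B (\<lambda>s. h (b * B + s)) (node B r) = 0" if "(b, r) \<in> S"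
  proof -
    have br: "b < m" "r < B" using that assms(3) by auto
    define a where "a i = (if i div B = b then cis (real (i mod B) * node B r) else 0)" for i
    have "a \<in> block_constraints B M m S"
      unfolding block_constraints_def a_def using that by (intro UnI2 image_eqI[of _ _ "(b, r)"]) auto
    from bspec[OF C this] have "0 = (\<Sum>i<n. a i * h i)" by (rule sym)
    also have "\<dots> = (\<Sum>b'<m. \<Sum>s<B. a (b' * B + s) * h (b' * B + s)) + (\<Sum>i\<in>{m*B..<n}. a i * h i)"
      by (rule sum_blocks[OF assms(2)])
    also have "(\<Sum>i\<in>{m*B..<n}. a i * h i) = 0"
    proof (intro sum.neutral ballI)
      fix i assume "i \<in> {m*B..<n}"
      then have "m \<le> i div B" using assms(1) by (simp add: less_eq_div_iff_mult_less_eq)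
      then show "a i * h i = 0" using br by (simp add: a_def)
    qed
    also have "(\<Sum>b'<m. \<Sum>s<B. a (b' * B + s) * h (b' * B + s)) =
      (\<Sum>b'<m. if b' = b then symbol B (\<lambda>s. h (b * B + s)) (node B r) else 0)"
    proof (intro sum.cong refl)
      fix b' assume "b' \<in> {..<m}"
      have "a (b' * B + s) * h (b' * B + s) = (if b' = b then h (b * B + s) * cis (real s * node B r) else 0)"
        if "s < B" for s
        using that assms(1) by (simp add: a_def)
      then show "(\<Sum>s<B. a (b' * B + s) * h (b' * B + s))
        = (if b' = b then symbol B (\<lambda>s. h (b * B + s)) (node B r) else 0)"
        by (simp add: symbol_def)
    qed
    finally show ?thesis using br by simp
  qed
qed

section \<open>The Weyl law\<close>

text \<open>The factor \<open>1 / B\<close> is the one in Parseval's identity, so that the energies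
  of a block add up to its squared norm.\<close>

definition block_energy :: "nat \<Rightarrow> (nat \<Rightarrow> complex) \<Rightarrow> nat \<Rightarrow> nat \<Rightarrow> real" where
  "block_energy B h b r = (cmod (symbol B (\<lambda>s. h (b * B + s)) (node B r)))\<^sup>2 / real B"

lemma block_energy_nonneg: "block_energy B h b r \<ge> 0"
  by (simp add: block_energy_def)

lemma block_energy_sum: "B > 0 \<Longrightarrow> (\<Sum>s<B. (cmod (h (b * B + s)))\<^sup>2) = (\<Sum>r<B. block_energy B h b r)"
  using discrete_parseval[of B "\<lambda>s. h (b * B + s)"]
  by (simp add: nsq_def block_energy_def sum_divide_distrib)

lemma nsq_blocks:
  assumes "B > 0" "m * B \<le> n"
  shows "nsq n h = (\<Sum>b<m. \<Sum>r<B. block_energy B h b r) + (\<Sum>j\<in>{m*B..<n}. (cmod (h j))\<^sup>2)"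
  unfolding nsq_def sum_blocks[OF assms(2)] using block_energy_sum[OF assms(1)] by simp

lemma sum_lessThan_eq_tail:
  fixes F :: "nat \<Rightarrow> 'a::comm_monoid_add"
  assumes "\<And>j. j < N \<Longrightarrow> F j = 0"
  shows "(\<Sum>j<n. F j) = (\<Sum>j\<in>{N..<n}. F j)"
  by (rule sum.mono_neutral_right) (auto intro: assms simp: not_le)

lemma toeplitz_form_diff: "toeplitz_form c n h = toeplitz_form d n h + toeplitz_form (\<lambda>m. c m - d m) n h"
  by (simp add: toeplitz_form_def left_diff_distrib sum_subtractf)

context lax_matrix
begin

text \<open>Inside the blocks the constrained form is diagonal in the discrete Fourier coefficients,
  with the values of the trigonometric polynomial at the nodes as weights. Schur's test bounds what
  lies beyond the last block.\<close>

lemma toeplitz_form_band: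
  assumes "M < B" "m * B \<le> n"
    and h: "\<And>b s. b < m \<Longrightarrow> B - M \<le> s \<Longrightarrow> s < B \<Longrightarrow> h (b * B + s) = 0"
  shows "\<bar>toeplitz_form (band c M) n h - (\<Sum>b<m. \<Sum>r<B. Re (trig_poly c M (node B r)) * block_energy B h b r)\<bar>
    \<le> D * (\<Sum>j\<in>{m*B..<n}. (cmod (h j))\<^sup>2)"
proof -
  \<comment> \<open>Extending the tail by zeros to all indices below \<open>n\<close> gives it the
    shape to which Schur's test applies.\<close>
  define g where "g j = (if m * B \<le> j then h j else 0)" for j
  have low: "Re (\<Sum>s<B. \<Sum>t<B. band c M (int s - int t) * h (b * B + t) * cnj (h (b * B + s)))
     = (\<Sum>r<B. Re (trig_poly c M (node B r)) * block_energy B h b r)" if "b < m" for b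
    using toeplitz_quadrature[OF assms(1), of "\<lambda>s. h (b * B + s)" c] h[OF that]
    by (simp add: block_energy_def sum_divide_distrib)
  have hi: "(\<Sum>j\<in>{m*B..<n}. \<Sum>k\<in>{m*B..<n}. band c M (int j - int k) * h k * cnj (h j))
     = (\<Sum>j<n. \<Sum>k<n. band c M (int j - int k) * g k * cnj (g j))"
  proof -
    have "(\<Sum>j\<in>{m*B..<n}. \<Sum>k\<in>{m*B..<n}. band c M (int j - int k) * h k * cnj (h j))
      = (\<Sum>j\<in>{m*B..<n}. \<Sum>k<n. band c M (int j - int k) * g k * cnj (g j))"
    proof (rule sum.cong[OF refl])
      fix j assume "j \<in> {m*B..<n}"
      then have "(\<Sum>k\<in>{m*B..<n}. band c M (int j - int k) * h k * cnj (h j))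
        = (\<Sum>k\<in>{m*B..<n}. band c M (int j - int k) * g k * cnj (g j))"
        by (intro sum.cong) (auto simp: g_def)
      also have "\<dots> = (\<Sum>k<n. band c M (int j - int k) * g k * cnj (g j))"
        by (rule sum_lessThan_eq_tail[symmetric]) (simp add: g_def)
      finally show "(\<Sum>k\<in>{m*B..<n}. band c M (int j - int k) * h k * cnj (h j))
        = (\<Sum>k<n. band c M (int j - int k) * g k * cnj (g j))" .
    qed
    also have "\<dots> = (\<Sum>j<n. \<Sum>k<n. band c M (int j - int k) * g k * cnj (g j))"
      by (rule sum_lessThan_eq_tail[symmetric]) (simp add: g_def)
    finally show ?thesis .
  qed
  have gn: "nsq n g = (\<Sum>j\<in>{m*B..<n}. (cmod (h j))\<^sup>2)"
    unfolding nsq_def by (subst sum_lessThan_eq_tail[of "m * B"]) (auto simp: g_def)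
  have "cmod (\<Sum>j<n. \<Sum>k<n. band c M (int j - int k) * g k * cnj (g j)) \<le> D * nsq n g"
  proof (rule schur_bound)
    fix F :: "int set" assume "finite F"
    have "(\<Sum>m\<in>F. cmod (band c M m)) \<le> (\<Sum>m\<in>F. cmod (c m))" by (intro sum_mono) (simp add: band_def)
    then show "(\<Sum>m\<in>F. cmod (band c M m)) \<le> D" using sum_le_D[OF \<open>finite F\<close>] by linarith
  qed
  then have "\<bar>Re (\<Sum>j<n. \<Sum>k<n. band c M (int j - int k) * g k * cnj (g j))\<bar>
    \<le> D * (\<Sum>j\<in>{m*B..<n}. (cmod (h j))\<^sup>2)"
    unfolding gn by (rule order.trans[OF abs_Re_le_cmod])
  moreover have "toeplitz_form (band c M) n h
    = (\<Sum>b<m. \<Sum>r<B. Re (trig_poly c M (node B r)) * block_energy B h b r)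
     + Re (\<Sum>j<n. \<Sum>k<n. band c M (int j - int k) * g k * cnj (g j))"
  proof -
    have "toeplitz_form (band c M) n h
      = Re ((\<Sum>b<m. \<Sum>s<B. \<Sum>t<B. band c M (int s - int t) * h (b * B + t) * cnj (h (b * B + s))) +
       (\<Sum>j<n. \<Sum>k<n. band c M (int j - int k) * g k * cnj (g j)))"
      unfolding toeplitz_form_def hi[symmetric]
      by (rule arg_cong[of _ _ Re], rule band_block_decomposition) (use assms in auto)
    then show ?thesis using low by simp
  qed
  ultimately show ?thesis by simp
qed

text \<open>Schur's test for the coefficients outside the band: passing to the banded form costs
  \<open>\<eta>\<close> per unit of squared norm.\<close>

lemma toeplitz_form_tail:
  assumes "\<And>F. finite F \<Longrightarrow> (\<forall>l\<in>F. \<bar>l\<bar> > int M) \<Longrightarrow> (\<Sum>l\<in>F. cmod (c l)) \<le> \<eta>"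
  shows "\<bar>toeplitz_form c n h - toeplitz_form (band c M) n h\<bar> \<le> \<eta> * nsq n h"
proof -
  have "cmod (\<Sum>j<n. \<Sum>k<n. (\<lambda>l. c l - band c M l) (int j - int k) * h k * cnj (h j)) \<le> \<eta> * nsq n h"
  proof (rule schur_bound)
    fix F :: "int set" assume F: "finite F"
    have "(\<Sum>l\<in>F. cmod (c l - band c M l)) = (\<Sum>l\<in>{l\<in>F. \<bar>l\<bar> > int M}. cmod (c l))"
      using F by (intro sum.mono_neutral_cong_right) (auto simp: band_def)
    also have "\<dots> \<le> \<eta>" using F by (intro assms) auto
    finally show "(\<Sum>l\<in>F. cmod (c l - band c M l)) \<le> \<eta>" .
  qed
  then have "\<bar>toeplitz_form (\<lambda>l. c l - band c M l) n h\<bar> \<le> \<eta> * nsq n h"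
    unfolding toeplitz_form_def by (rule order.trans[OF abs_Re_le_cmod])
  then show ?thesis using toeplitz_form_diff[of c n h "band c M"] by simp
qed

text \<open>For \<open>h\<close> satisfying the constraints, the energy of \<open>h\<close> at every node \<open>(b, r)\<close> with
  \<open>\<epsilon> b B - p r < x + \<eta>\<close> vanishes.\<close>

lemma ev_lower_weyl:
  assumes "M < B" "m * B \<le> n" "k < n"
    and tail: "\<And>F. finite F \<Longrightarrow> (\<forall>l\<in>F. \<bar>l\<bar> > int M) \<Longrightarrow> (\<Sum>l\<in>F. cmod (c l)) \<le> \<eta>"
    and high: "x + \<eta> + D \<le> \<epsilon> * real m * real B"
    and card: "M * m + card {(b, r). b < m \<and> r < B \<and> \<epsilon> * real b * real B - Re (trig_poly c M (node B r))
      < x + \<eta>} \<le> k"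
  shows "x \<le> ev n k"
proof -
  define p where "p r = Re (trig_poly c M (node B r))" for r
  define S where "S = {(b, r). b < m \<and> r < B \<and> \<epsilon> * real b * real B - p r < x + \<eta>}"
  have S: "S \<subseteq> {..<m} \<times> {..<B}" by (auto simp: S_def)
  note bc = block_constraints[OF assms(1,2) S]
  have B: "B > 0" using assms by simp
  show ?thesis
  proof (rule ev_lower_bound[OF \<open>k < n\<close> bc(1)])
    show "card (block_constraints B M m S) \<le> k" using bc(2) card by (simp add: S_def p_def)
    fix h assume C: "\<forall>a\<in>block_constraints B M m S. (\<Sum>i<n. a i * h i) = 0"
    define e where "e = block_energy B h"
    define H where "H = (\<Sum>j\<in>{m*B..<n}. (cmod (h j))\<^sup>2)"
    have e0: "e b r \<ge> 0" for b r by (simp add: e_def block_energy_nonneg)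
    have "toeplitz_form (band c M) n h \<le> (\<Sum>b<m. \<Sum>r<B. p r * e b r) + D * H"
      using toeplitz_form_band[where h = h, OF assms(1,2)] bc(3)[OF C]
        by (auto simp: p_def e_def H_def abs_le_iff)
    moreover have "\<bar>toeplitz_form c n h - toeplitz_form (band c M) n h\<bar> \<le> \<eta> * nsq n h"
      by (rule toeplitz_form_tail) (rule tail)
    then have "toeplitz_form c n h \<le> toeplitz_form (band c M) n h + \<eta> * nsq n h"
      by linarith
    moreover have "(\<Sum>b<m. \<Sum>r<B. (\<epsilon> * real b * real B) * e b r) + \<epsilon> * real m * real B * H
      \<le> (\<Sum>j<n. \<epsilon> * real j * (cmod (h j))\<^sup>2)"
    proof -
      have "(\<Sum>b<m. \<Sum>r<B. (\<epsilon> * real b * real B) * e b r)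
        = (\<Sum>b<m. \<Sum>s<B. (\<epsilon> * real b * real B) * (cmod (h (b * B + s)))\<^sup>2)"
        unfolding sum_distrib_left[symmetric] e_def by (simp add: block_energy_sum[OF B])
      \<comment> \<open>Within a block the diagonal is bounded below by its value at the first
        index.\<close>
      also have "\<dots> \<le> (\<Sum>b<m. \<Sum>s<B. \<epsilon> * real (b * B + s) * (cmod (h (b * B + s)))\<^sup>2)"
        using eps_pos by (intro sum_mono mult_right_mono) (auto simp: algebra_simps)
      finally have 1: "(\<Sum>b<m. \<Sum>r<B. (\<epsilon> * real b * real B) * e b r)
        \<le> (\<Sum>b<m. \<Sum>s<B. \<epsilon> * real (b * B + s) * (cmod (h (b * B + s)))\<^sup>2)" .
      have "\<epsilon> * real m * real B * H \<le> (\<Sum>j\<in>{m*B..<n}. \<epsilon> * real j * (cmod (h j))\<^sup>2)"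
        unfolding H_def sum_distrib_left
      proof (intro sum_mono mult_right_mono)
        fix j assume "j \<in> {m*B..<n}"
        then have "real m * real B \<le> real j" by (simp flip: of_nat_mult)
        then show "\<epsilon> * real m * real B \<le> \<epsilon> * real j" using eps_pos by (simp add: mult.assoc)
      qed simp
      then show ?thesis using 1 unfolding sum_blocks[OF assms(2), of "\<lambda>j. \<epsilon> * real j * (cmod (h j))\<^sup>2"]
        by linarith
    qed
    moreover have "(\<Sum>b<m. \<Sum>r<B. (x + \<eta>) * e b r) \<le> (\<Sum>b<m. \<Sum>r<B. (\<epsilon> * real b * real B) * e b r - p r * e b r)"
    proof (intro sum_mono)
      fix b r assume "b \<in> {..<m}" "r \<in> {..<B}"
      show "(x + \<eta>) * e b r \<le> (\<epsilon> * real b * real B) * e b r - p r * e b r"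
      proof (cases "(b, r) \<in> S")
        case True
        then show ?thesis using bc(4)[OF C True] by (simp add: e_def block_energy_def)
      next
        case False
        then have "x + \<eta> \<le> \<epsilon> * real b * real B - p r" using \<open>b \<in> _\<close> \<open>r \<in> _\<close> by (auto simp: S_def)
        then have "(x + \<eta>) * e b r \<le> (\<epsilon> * real b * real B - p r) * e b r" using e0 by (rule mult_right_mono)
        then show ?thesis by (simp add: left_diff_distrib)
      qed
    qed
    \<comment> \<open>In the tail the diagonal is at least \<open>\<epsilon> m B\<close>, which by
      \<open>high\<close> still exceeds \<open>x + \<eta>\<close> after the Toeplitz part has taken
      \<open>D\<close>.\<close>
    moreover have "(x + \<eta>) * H \<le> \<epsilon> * real m * real B * H - D * H"
    proof -
      have "H \<ge> 0" by (simp add: H_def sum_nonneg)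
      then have "(x + \<eta>) * H \<le> (\<epsilon> * real m * real B - D) * H" using high by (intro mult_right_mono) auto
      then show ?thesis by (simp add: left_diff_distrib)
    qed
    moreover have "nsq n h = (\<Sum>b<m. \<Sum>r<B. e b r) + H"
      unfolding e_def H_def by (rule nsq_blocks[OF B assms(2)])
    then have "(x + \<eta>) * nsq n h = (\<Sum>b<m. \<Sum>r<B. (x + \<eta>) * e b r) + (x + \<eta>) * H"
      by (simp add: distrib_left[of "x + \<eta>"] sum_distrib_left)
    ultimately show "x * nsq n h \<le> qform n A h"
      unfolding qform_lax_mat by (simp add: sum_subtractf distrib_right)
  qed
qed

text \<open>The mirror image of the lower bound. The size is exactly \<open>m B\<close>, so there is
  no tail; the diagonal is rounded up to the end of its block, and the nodes with energy above
  \<open>x - \<eta>\<close> are annihilated.\<close>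

lemma ev_upper_weyl:
  assumes "M < B"
    and tail: "\<And>F. finite F \<Longrightarrow> (\<forall>l\<in>F. \<bar>l\<bar> > int M) \<Longrightarrow> (\<Sum>l\<in>F. cmod (c l)) \<le> \<eta>"
    and card: "M * m + card {(b, r). b < m \<and> r < B \<and> \<epsilon> * (real b + 1) * real B - Re (trig_poly c M (node B r))
      > x - \<eta>} + k < m * B"
  shows "ev (m * B) k \<le> x"
proof -
  define n where "n = m * B"
  have n: "m * B \<le> n" by (simp add: n_def)
  define p where "p r = Re (trig_poly c M (node B r))" for r
  define S where "S = {(b, r). b < m \<and> r < B \<and> \<epsilon> * (real b + 1) * real B - p r > x - \<eta>}"
  have S: "S \<subseteq> {..<m} \<times> {..<B}" by (auto simp: S_def)
  note bc = block_constraints[OF assms(1) n S]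
  have B: "B > 0" using assms by simp
  have "ev n k \<le> x"
  proof (rule ev_upper_bound[OF bc(1)])
    show "card (block_constraints B M m S) + k < n" using bc(2) card by (simp add: S_def p_def n_def)
    fix h assume C: "\<forall>a\<in>block_constraints B M m S. (\<Sum>i<n. a i * h i) = 0"
    define e where "e = block_energy B h"
    have e0: "e b r \<ge> 0" for b r by (simp add: e_def block_energy_nonneg)
    have "(\<Sum>b<m. \<Sum>r<B. p r * e b r) \<le> toeplitz_form (band c M) n h"
      using toeplitz_form_band[where h = h, OF assms(1) n] bc(3)[OF C] by (auto simp: p_def e_def n_def)
    moreover have "\<bar>toeplitz_form c n h - toeplitz_form (band c M) n h\<bar> \<le> \<eta> * nsq n h"
      by (rule toeplitz_form_tail) (rule tail)
    then have "toeplitz_form (band c M) n h \<le> toeplitz_form c n h + \<eta> * nsq n h"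
      by linarith
    moreover have "(\<Sum>j<n. \<epsilon> * real j * (cmod (h j))\<^sup>2) \<le> (\<Sum>b<m. \<Sum>r<B. (\<epsilon> * (real b + 1) * real B) * e b r)"
    proof -
      have "(\<Sum>j<n. \<epsilon> * real j * (cmod (h j))\<^sup>2)
        = (\<Sum>b<m. \<Sum>s<B. \<epsilon> * real (b * B + s) * (cmod (h (b * B + s)))\<^sup>2)"
        unfolding sum_blocks[OF n, of "\<lambda>j. \<epsilon> * real j * (cmod (h j))\<^sup>2"] by (simp add: n_def)
      also have "\<dots> \<le> (\<Sum>b<m. \<Sum>s<B. (\<epsilon> * (real b + 1) * real B) * (cmod (h (b * B + s)))\<^sup>2)"
        using eps_pos by (intro sum_mono mult_right_mono) (auto simp: algebra_simps)
      also have "\<dots> = (\<Sum>b<m. \<Sum>r<B. (\<epsilon> * (real b + 1) * real B) * e b r)"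
        unfolding sum_distrib_left[symmetric] e_def by (simp add: block_energy_sum[OF B])
      finally show ?thesis .
    qed
    moreover have "(\<Sum>b<m. \<Sum>r<B. (\<epsilon> * (real b + 1) * real B) * e b r - p r * e b r)
      \<le> (\<Sum>b<m. \<Sum>r<B. (x - \<eta>) * e b r)"
    proof (intro sum_mono)
      fix b r assume "b \<in> {..<m}" "r \<in> {..<B}"
      show "(\<epsilon> * (real b + 1) * real B) * e b r - p r * e b r \<le> (x - \<eta>) * e b r"
      proof (cases "(b, r) \<in> S")
        case True
        then show ?thesis using bc(4)[OF C True] by (simp add: e_def block_energy_def)
      next
        case False
        then have "\<epsilon> * (real b + 1) * real B - p r \<le> x - \<eta>" using \<open>b \<in> _\<close> \<open>r \<in> _\<close> by (auto simp: S_def)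
        then have "(\<epsilon> * (real b + 1) * real B - p r) * e b r \<le> (x - \<eta>) * e b r" using e0
          by (rule mult_right_mono)
        then show ?thesis by (simp only: left_diff_distrib)
      qed
    qed
    moreover have "nsq n h = (\<Sum>b<m. \<Sum>r<B. e b r)"
      using nsq_blocks[OF B n, of h] by (simp add: e_def n_def)
    then have "(x - \<eta>) * nsq n h = (\<Sum>b<m. \<Sum>r<B. (x - \<eta>) * e b r)"
      by (simp add: sum_distrib_left)
    ultimately show "qform n A h \<le> x * nsq n h"
      unfolding qform_lax_mat by (simp add: sum_subtractf left_diff_distrib)
  qed
  then show ?thesis by (simp add: n_def)
qed

text \<open>The constraint count does not involve \<open>n\<close>, so the bound holds for all large
  truncations and passes to the limit. One \<open>\<eta>\<close> pays for the band, the other for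
  replacing the trigonometric polynomial by \<open>v\<close>, later \<open>u\<close> at the nodes;
  each node adds 1 for rounding.\<close>

lemma evl_lower_weyl:
  assumes "M < B"
    and tail: "\<And>F. finite F \<Longrightarrow> (\<forall>l\<in>F. \<bar>l\<bar> > int M) \<Longrightarrow> (\<Sum>l\<in>F. cmod (c l)) \<le> \<eta>"
    and v: "\<And>r. r < B \<Longrightarrow> \<bar>Re (trig_poly c M (node B r)) - v r\<bar> \<le> \<eta>"
    and high: "x + \<eta> + D \<le> \<epsilon> * real m * real B"
    and count: "real M * real m + (\<Sum>r<B. max 0 ((x + 2 * \<eta> + v r) / (\<epsilon> * real B)) + 1) \<le> real k"
  shows "x \<le> evl k"
proof (rule evl_ge[of "max (m * B) (Suc k)"])
  fix n assume n: "max (m * B) (Suc k) \<le> n"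
  have eB: "\<epsilon> * real B > 0" using eps_pos \<open>M < B\<close> by simp
  have le: "real (card {b. b < m \<and> \<epsilon> * real b * real B - Re (trig_poly c M (node B r)) < x + \<eta>})
     \<le> max 0 ((x + 2 * \<eta> + v r) / (\<epsilon> * real B)) + 1" if "r < B" for r
  proof -
    have "{b. b < m \<and> \<epsilon> * real b * real B - Re (trig_poly c M (node B r)) < x + \<eta>} \<subseteq>
       {b. b < m \<and> real b < (x + 2 * \<eta> + v r) / (\<epsilon> * real B)}"
    proof safe
      fix b assume "\<epsilon> * real b * real B - Re (trig_poly c M (node B r)) < x + \<eta>"
      then have "\<epsilon> * real b * real B < x + 2 * \<eta> + v r" using v[OF that] by linarith
      then show "real b < (x + 2 * \<eta> + v r) / (\<epsilon> * real B)"
        using eB by (simp add: pos_less_divide_eq mult_ac)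
    qed
    then have "card {b. b < m \<and> \<epsilon> * real b * real B - Re (trig_poly c M (node B r)) < x + \<eta>}
      \<le> card {b. b < m \<and> real b < (x + 2 * \<eta> + v r) / (\<epsilon> * real B)}" by (intro card_mono) auto
    then show ?thesis using count_less[of m "(x + 2 * \<eta> + v r) / (\<epsilon> * real B)"] by linarith
  qed
  have "real (M * m + card {(b, r). b < m \<and> r < B \<and> \<epsilon> * real b * real B - Re (trig_poly c M (node B r))
    < x + \<eta>}) \<le> real k"
  proof -
    have "real (card {(b, r). b < m \<and> r < B \<and> \<epsilon> * real b * real B - Re (trig_poly c M (node B r)) < x + \<eta>})
      \<le> (\<Sum>r<B. max 0 ((x + 2 * \<eta> + v r) / (\<epsilon> * real B)) + 1)"
      unfolding card_pairs of_nat_sum by (intro sum_mono le) auto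
    then show ?thesis using count by simp
  qed
  then have "M * m + card {(b, r). b < m \<and> r < B \<and> \<epsilon> * real b * real B - Re (trig_poly c M (node B r))
    < x + \<eta>} \<le> k"
    by (simp only: of_nat_le_iff)
  then show "x \<le> ev n k" using n by (intro ev_lower_weyl[OF \<open>M < B\<close> _ _ tail high]) auto
qed

text \<open>A single truncation suffices, since limits lie below truncated eigenvalues. The term
  \<open>real B\<close> collects a rounding error of 1 per node, and \<open>high\<close> says that
  \<open>m\<close> blocks reach past all the energies to be counted.\<close>

lemma evl_upper_weyl:
  assumes "M < B"
    and tail: "\<And>F. finite F \<Longrightarrow> (\<forall>l\<in>F. \<bar>l\<bar> > int M) \<Longrightarrow> (\<Sum>l\<in>F. cmod (c l)) \<le> \<eta>"
    and v: "\<And>r. r < B \<Longrightarrow> \<bar>Re (trig_poly c M (node B r)) - v r\<bar> \<le> \<eta>"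
    and high: "\<And>r. r < B \<Longrightarrow> x - 2 * \<eta> + v r \<le> \<epsilon> * real m * real B"
    and count: "real k + real M * real m + real B < (\<Sum>r<B. max 0 ((x - 2 * \<eta> + v r) / (\<epsilon> * real B)))"
  shows "evl k \<le> x"
proof -
  have eB: "\<epsilon> * real B > 0" using eps_pos \<open>M < B\<close> by simp
  have le: "real (card {b. b < m \<and> \<epsilon> * (real b + 1) * real B - Re (trig_poly c M (node B r)) > x - \<eta>})
     \<le> real m - max 0 ((x - 2 * \<eta> + v r) / (\<epsilon> * real B)) + 1" if "r < B" for r
  proof -
    have "{b. b < m \<and> \<epsilon> * (real b + 1) * real B - Re (trig_poly c M (node B r)) > x - \<eta>} \<subseteq>
       {b. b < m \<and> real b + 1 > (x - 2 * \<eta> + v r) / (\<epsilon> * real B)}"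
    proof safe
      fix b assume "\<epsilon> * (real b + 1) * real B - Re (trig_poly c M (node B r)) > x - \<eta>"
      then have "x - 2 * \<eta> + v r < \<epsilon> * (real b + 1) * real B" using v[OF that] by linarith
      then have "x - 2 * \<eta> + v r < (real b + 1) * (\<epsilon> * real B)" by (simp only: mult_ac)
      then show "(x - 2 * \<eta> + v r) / (\<epsilon> * real B) < real b + 1"
        using eB by (simp only: pos_divide_less_eq)
    qed
    then have "card {b. b < m \<and> \<epsilon> * (real b + 1) * real B - Re (trig_poly c M (node B r)) > x - \<eta>}
      \<le> card {b. b < m \<and> real b + 1 > (x - 2 * \<eta> + v r) / (\<epsilon> * real B)}" by (intro card_mono) auto
    moreover have "(x - 2 * \<eta> + v r) / (\<epsilon> * real B) \<le> real m"
      using high[OF that] eB by (simp add: pos_divide_le_eq mult_ac)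
    ultimately show ?thesis using count_greater[of "(x - 2 * \<eta> + v r) / (\<epsilon> * real B)" m] by linarith
  qed
  have "real (M * m + card {(b, r). b < m \<and> r < B \<and> \<epsilon> * (real b + 1) * real B - Re (trig_poly c M (node B r))
    > x - \<eta>} + k) < real (m * B)"
  proof -
    have "real (card {(b, r). b < m \<and> r < B \<and> \<epsilon> * (real b + 1) * real B - Re (trig_poly c M (node B r)) > x
      - \<eta>})
      \<le> (\<Sum>r<B. real m - max 0 ((x - 2 * \<eta> + v r) / (\<epsilon> * real B)) + 1)"
      unfolding card_pairs of_nat_sum by (intro sum_mono le) auto
    then show ?thesis using count by (simp add: sum.distrib sum_subtractf mult.commute)
  qed
  then have c: "M * m + card {(b, r). b < m \<and> r < B \<and> \<epsilon> * (real b + 1) * real B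
    - Re (trig_poly c M (node B r)) > x - \<eta>} + k < m * B"
    by (simp only: of_nat_less_iff)
  then have "evl k \<le> ev (m * B) k" by (intro evl_le_ev) linarith
  also have "\<dots> \<le> x" by (rule ev_upper_weyl[OF \<open>M < B\<close> tail c])
  finally show ?thesis .
qed

end

text \<open>\<open>G\<close> is the limiting counting function in the scale
  \<open>k \<epsilon>\<close>, given through its Riemann sums. The error budget is
  \<open>\<delta>/8\<close> each for the band, the Riemann sum and the rounding, and
  \<open>\<delta>/4\<close> for the decoupling constraints, in total less than
  \<open>\<delta>\<close>. The bound \<open>X\<close> on the energies limits the number of blocks
  and thereby the last item.\<close>

theorem weyl_law:
  fixes c :: "int \<Rightarrow> complex" and u G :: "real \<Rightarrow> real"
  assumes c: "\<And>\<epsilon>. \<epsilon> > 0 \<Longrightarrow> lax_matrix c \<epsilon>"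
    and trunc: "\<And>\<eta>. \<eta> > 0 \<Longrightarrow> \<exists>M. (\<forall>F. finite F \<longrightarrow> (\<forall>l\<in>F. \<bar>l\<bar> > int M) \<longrightarrow> (\<Sum>l\<in>F. cmod (c l)) \<le> \<eta>)
       \<and> (\<forall>\<theta>. \<bar>Re (trig_poly c M \<theta>) - u \<theta>\<bar> \<le> \<eta>)"
    and bound: "\<And>\<theta>. \<bar>u \<theta>\<bar> \<le> U"
    and G: "\<And>B x. B > 0 \<Longrightarrow> \<bar>(\<Sum>r<B. max 0 (x + u (node B r))) / real B - G x\<bar> \<le> K / real B"
    and "\<delta> > 0" "X \<ge> 0"
  shows "\<exists>\<epsilon>0>0. \<forall>\<epsilon>. 0 < \<epsilon> \<longrightarrow> \<epsilon> < \<epsilon>0 \<longrightarrow> (\<forall>x k. x \<le> X \<longrightarrow>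
     (G x + \<delta> \<le> real k * \<epsilon> \<longrightarrow> x \<le> limit_ev c \<epsilon> k) \<and> (real k * \<epsilon> \<le> G x - \<delta> \<longrightarrow> limit_ev c \<epsilon> k \<le> x))"
proof -
  define \<eta> where "\<eta> = min 1 (\<delta> / 16)"
  have \<eta>: "\<eta> > 0" "\<eta> \<le> 1" "2 * \<eta> \<le> \<delta> / 8" using \<open>\<delta> > 0\<close> by (auto simp: \<eta>_def)
  obtain M where M: "\<And>F. finite F \<Longrightarrow> (\<forall>l\<in>F. \<bar>l\<bar> > int M) \<Longrightarrow> (\<Sum>l\<in>F. cmod (c l)) \<le> \<eta>"
     "\<And>\<theta>. \<bar>Re (trig_poly c M \<theta>) - u \<theta>\<bar> \<le> \<eta>"
    using trunc[OF \<eta>(1)] by blast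
  define D where "D = lax_matrix.D c"
  have D0: "D \<ge> 0" unfolding D_def by (rule lax_matrix.D_nonneg[OF c[OF zero_less_one]])
  have U0: "U \<ge> 0" using bound[of 0] by linarith
  note D_eq = D_def
  \<comment> \<open>Large enough for both conditions \<open>high\<close>:
    \<open>x + \<eta> + D\<close> in the lower bound and \<open>x - 2 \<eta> + u\<close> in the
    upper one, with \<open>\<eta> \<le> 1\<close>.\<close>
  define Y where "Y = X + D + U + 1"
  have Y: "Y \<ge> 0" using D0 U0 \<open>X \<ge> 0\<close> by (simp add: Y_def)
  \<comment> \<open>\<open>B > M\<close> for the decoupling, the second entry for the Riemann sum,
    the third for the main part \<open>M Y / B\<close> of the constraint count.\<close>
  obtain B :: nat where B: "real B > max (real M) (max (8 * K / \<delta>) (8 * (real M * Y) / \<delta>))"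
    using reals_Archimedean2 by blast
  then have MB: "M < B" "B > 0" by auto
  have KB: "K / real B \<le> \<delta> / 8" "real M * Y / real B \<le> \<delta> / 8"
    using B MB \<open>\<delta> > 0\<close> by (auto simp: field_simps)
  define \<epsilon>0 where "\<epsilon>0 = \<delta> / (8 * real B)"
  have "\<epsilon>0 > 0" using \<open>\<delta> > 0\<close> MB by (simp add: \<epsilon>0_def)
  moreover have "(G x + \<delta> \<le> real k * \<epsilon> \<longrightarrow> x \<le> limit_ev c \<epsilon> k) \<and> (real k * \<epsilon> \<le> G x - \<delta> \<longrightarrow> limit_ev c \<epsilon> k \<le> x)"
    if \<epsilon>: "0 < \<epsilon>" "\<epsilon> < \<epsilon>0" and "x \<le> X" for \<epsilon> x k
  proof -
    interpret lax_matrix c \<epsilon> by (rule c) fact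
    have eB: "\<epsilon> * real B \<le> \<delta> / 8" "\<epsilon> * real B > 0"
      using \<epsilon> MB by (auto simp: \<epsilon>0_def field_simps)
    have eM: "\<epsilon> * real M \<le> \<delta> / 8"
    proof -
      have "\<epsilon> * real M \<le> \<epsilon> * real B" using \<epsilon> MB by (intro mult_left_mono) auto
      then show ?thesis using eB by linarith
    qed
    \<comment> \<open>The number of blocks needed to reach energy \<open>Y\<close>; rounding up adds
      at most one block, that is, at most \<open>\<epsilon> M\<close> to the scaled constraint
      count.\<close>
    define m where "m = nat \<lceil>Y / (\<epsilon> * real B)\<rceil>"
    have "Y / (\<epsilon> * real B) \<le> real m" "real m \<le> Y / (\<epsilon> * real B) + 1"
    proof -
      have "Y / (\<epsilon> * real B) \<ge> 0" using Y eB by simp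
      then show "Y / (\<epsilon> * real B) \<le> real m" "real m \<le> Y / (\<epsilon> * real B) + 1" unfolding m_def by linarith+
    qed
    then have m: "Y \<le> \<epsilon> * real m * real B" "\<epsilon> * real m \<le> Y / real B + \<epsilon>"
      using eB(2) MB \<epsilon> by (auto simp: field_simps)
    have eMm: "\<epsilon> * (real M * real m) \<le> \<delta> / 4"
    proof -
      have "real M * (\<epsilon> * real m) \<le> real M * (Y / real B + \<epsilon>)" using m(2) by (intro mult_left_mono) auto
      also have "\<dots> = real M * Y / real B + \<epsilon> * real M" by (simp add: algebra_simps)
      finally have "real M * (\<epsilon> * real m) \<le> real M * Y / real B + \<epsilon> * real M" .
      moreover have "\<epsilon> * (real M * real m) = real M * (\<epsilon> * real m)" by simp
      ultimately show ?thesis using KB(2) eM by linarith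
    qed
    define s where "s = (\<Sum>r<B. max 0 (x + u (node B r))) / real B"
    have s: "\<bar>s - G x\<bar> \<le> \<delta> / 8" unfolding s_def by (rule order.trans[OF G[OF MB(2), of x] KB(1)])
    have scale: "\<epsilon> * (\<Sum>r<B. max 0 ((y r) / (\<epsilon> * real B))) = (\<Sum>r<B. max 0 (y r)) / real B" for y
    proof -
      have "\<epsilon> * max 0 (y r / (\<epsilon> * real B)) = max 0 (y r) / real B" for r
        using \<epsilon> eB by (auto simp: max_def field_simps)
      then show ?thesis by (simp add: sum_distrib_left sum_divide_distrib)
    qed
    show ?thesis
    proof (intro conjI impI)
      assume k: "G x + \<delta> \<le> real k * \<epsilon>"
      show "x \<le> limit_ev c \<epsilon> k"
      proof (rule evl_lower_weyl[OF MB(1) M(1) M(2), where m = m])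
        show "x + \<eta> + lax_matrix.D c \<le> \<epsilon> * real m * real B"
          using m(1) \<eta>(2) U0 \<open>x \<le> X\<close> by (simp add: Y_def D_eq[symmetric])
        have "(\<Sum>r<B. max 0 (x + 2 * \<eta> + u (node B r))) / real B \<le> (\<Sum>r<B. max 0 (x + u (node B r)) + 2 * \<eta>) /
          real B"
          using \<eta> by (intro divide_right_mono sum_mono) auto
        also have "\<dots> = s + 2 * \<eta>" using MB by (simp add: s_def sum.distrib add_divide_distrib)
        finally have "\<epsilon> * (real M * real m + (\<Sum>r<B. max 0 ((x + 2 * \<eta> + u (node B r)) / (\<epsilon> * real B)) + 1))
          \<le> \<delta> / 4 + (s + 2 * \<eta> + \<delta> / 8)"
          using eMm eB(1) unfolding sum.distrib distrib_left scale by simp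
        also have "\<dots> \<le> \<epsilon> * real k" using k s \<eta>(3) \<open>\<delta> > 0\<close> unfolding mult.commute[of \<epsilon>] by linarith
        finally show "real M * real m + (\<Sum>r<B. max 0 ((x + 2 * \<eta> + u (node B r)) / (\<epsilon> * real B)) + 1)
          \<le> real k"
          using \<epsilon> by simp
      qed auto
    next
      assume k: "real k * \<epsilon> \<le> G x - \<delta>"
      show "limit_ev c \<epsilon> k \<le> x"
      proof (rule evl_upper_weyl[OF MB(1) M(1) M(2), where m = m])
        show "x - 2 * \<eta> + u (node B r) \<le> \<epsilon> * real m * real B" for r
          using m(1) \<eta>(1) D0 \<open>x \<le> X\<close> bound[of "node B r"] by (simp add: Y_def abs_le_iff)
        have "s - 2 * \<eta> = (\<Sum>r<B. max 0 (x + u (node B r)) - 2 * \<eta>) / real B"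
          using MB by (simp add: s_def sum_subtractf diff_divide_distrib)
        also have "\<dots> \<le> (\<Sum>r<B. max 0 (x - 2 * \<eta> + u (node B r))) / real B"
          using \<eta> by (intro divide_right_mono sum_mono) auto
        finally have 1: "s - 2 * \<eta> \<le> \<epsilon> * (\<Sum>r<B. max 0 ((x - 2 * \<eta> + u (node B r)) / (\<epsilon> * real B)))"
          unfolding scale .
        have "\<epsilon> * (real k + real M * real m + real B) \<le> (G x - \<delta>) + \<delta> / 4 + \<delta> / 8"
          using k eMm eB(1) by (simp add: algebra_simps)
        also have "\<dots> < s - 2 * \<eta>" using s \<eta>(3) \<open>\<delta> > 0\<close> by linarith
        also note 1
        finally show "real k + real M * real m + real B
          < (\<Sum>r<B. max 0 ((x - 2 * \<eta> + u (node B r)) / (\<epsilon> * real B)))"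
          using \<epsilon> by simp
      qed auto
    qed
  qed
  ultimately show ?thesis by blast
qed

section \<open>Fourier analysis on the torus\<close>

text \<open>Since \<open>ennreal\<close> cuts off negative values, the two densities are the
  positive and the negative part of \<open>g\<close>. The finite measures they define agree on all
  rays, hence coincide, and so do their densities almost everywhere.\<close>

lemma AE_zero_if_ray_integrals_zero:
  fixes g :: "real \<Rightarrow> real"
  assumes g: "integrable lborel g" and zero: "\<And>x. (\<integral>y. indicator {x<..} y * g y \<partial>lborel) = 0"
  shows "AE y in lborel. g y = 0"
proof -
  have [measurable]: "g \<in> borel_measurable lborel" using g by simp
  define M where "M = density lborel (\<lambda>y. ennreal (g y))"
  define N where "N = density lborel (\<lambda>y. ennreal (- g y))"
  have int: "integrable lborel (\<lambda>y. indicator {x<..} y * g y)" for x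
    using integrable_real_mult_indicator[OF _ g, of "{x<..}"] by (simp add: mult.commute)
  have eM: "emeasure M {x<..} = (\<integral>\<^sup>+y. ennreal (indicator {x<..} y * g y) \<partial>lborel)" for x
    unfolding M_def by (subst emeasure_density) (auto intro!: nn_integral_cong simp: indicator_def)
  have eN: "emeasure N {x<..} = (\<integral>\<^sup>+y. ennreal (- (indicator {x<..} y * g y)) \<partial>lborel)" for x
    unfolding N_def by (subst emeasure_density) (auto intro!: nn_integral_cong simp: indicator_def)
  have fin: "emeasure M {x<..} < \<infinity>" "emeasure N {x<..} < \<infinity>" for x
    using int[of x] unfolding eM eN by (auto simp: real_integrable_def top.not_eq_extremum)
  have "M = N"
  proof (rule measure_eqI_lessThan)
    fix x
    have "enn2real (emeasure M {x<..}) = enn2real (emeasure N {x<..})"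
      using zero[of x] unfolding real_lebesgue_integral_def[OF int] eM eN by simp
    then show "emeasure M {x<..} = emeasure N {x<..}"
    proof -
      assume eq: "enn2real (emeasure M {x<..}) = enn2real (emeasure N {x<..})"
      have "emeasure M {x<..} = ennreal (enn2real (emeasure M {x<..}))"
        by (rule ennreal_enn2real[symmetric]) (use fin[of x] in simp)
      also have "\<dots> = ennreal (enn2real (emeasure N {x<..}))" by (simp only: eq)
      also have "\<dots> = emeasure N {x<..}" by (rule ennreal_enn2real) (use fin[of x] in simp)
      finally show ?thesis .
    qed
  qed (use fin in \<open>auto simp: M_def N_def\<close>)
  then have "AE y in lborel. ennreal (g y) = ennreal (- g y)"
    unfolding M_def N_def
      by (subst (asm) sigma_finite_measure.density_unique_iff[OF lborel.sigma_finite_measure_axioms]) auto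
  then show ?thesis
  proof eventually_elim
    case (elim y)
    then show ?case
      by (cases "g y \<ge> 0") (auto simp: ennreal_neg ennreal_eq_0_iff)
  qed
qed

section \<open>Fourier modes and trigonometric polynomials\<close>

definition mode :: "int \<Rightarrow> real \<Rightarrow> complex" where
  "mode k x = cis (of_int k * x)"

lemma mode_add: "mode (k + l) x = mode k x * mode l x"
  by (simp add: mode_def cis_mult algebra_simps)

lemma mode_0 [simp]: "mode 0 x = 1"
  by (simp add: mode_def)

lemma norm_mode [simp]: "cmod (mode k x) = 1"
  by (simp add: mode_def)

lemma cnj_mode: "cnj (mode k x) = mode (- k) x"
  by (simp add: mode_def cis_cnj)

lemma continuous_mode [continuous_intros]: "continuous_on S (mode k)"
  unfolding mode_def by (intro continuous_intros)

lemma measurable_mode [measurable]: "mode k \<in> borel_measurable borel"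
  by (intro borel_measurable_continuous_onI continuous_mode)

lemma space_torus: "space torus = {0..2*pi}"
  by (simp add: torus_def space_restrict_space)

lemma measurable_torusI: "f \<in> borel_measurable borel \<Longrightarrow> f \<in> borel_measurable torus"
  by (simp add: torus_def measurable_restrict_space1)

interpretation torus: finite_measure torus
  by (rule finite_measureI) (simp add: torus_def space_restrict_space emeasure_restrict_space)

lemma integrable_torus_iff:
  fixes f :: "real \<Rightarrow> 'a::{banach, second_countable_topology}"
  shows "integrable torus f \<longleftrightarrow> integrable lborel (\<lambda>x. indicator {0..2*pi} x *\<^sub>R f x)"
  unfolding torus_def by (rule integrable_restrict_space) simp

lemma integral_torus_eq:
  fixes f :: "real \<Rightarrow> 'a::{banach, second_countable_topology}"
  shows "(\<integral>x. f x \<partial>torus) = (\<integral>x. indicator {0..2*pi} x *\<^sub>R f x \<partial>lborel)"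
  unfolding torus_def by (rule integral_restrict_space) simp

lemma integrable_torus_continuous:
  fixes f :: "real \<Rightarrow> 'a::{banach, second_countable_topology}"
  assumes "continuous_on {0..2*pi} f"
  shows "integrable torus f"
  unfolding integrable_torus_iff
  using borel_integrable_compact[OF compact_Icc assms]
    by (simp add: indicator_def if_distrib[of "\<lambda>c. c *\<^sub>R _"] cong: if_cong)

lemma integrable_torus_bounded:
  fixes f :: "real \<Rightarrow> 'a::{banach, second_countable_topology}"
  assumes "f \<in> borel_measurable torus" "\<And>x. norm (f x) \<le> C"
  shows "integrable torus f"
  by (rule torus.integrable_const_bound[of _ C]) (use assms in auto)

lemma integrable_torus_mult:
  fixes f w :: "real \<Rightarrow> complex"
  assumes "integrable torus f" "w \<in> borel_measurable torus" "\<And>x. cmod (w x) \<le> C"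
  shows "integrable torus (\<lambda>x. f x * w x)"
proof (rule Bochner_Integration.integrable_bound)
  show "integrable torus (\<lambda>x. C * cmod (f x))" using assms(1) by simp
  have "cmod (f x * w x) \<le> C * cmod (f x)" for x
    using assms(3)[of x] by (simp add: norm_mult mult.commute[of C] mult_left_mono)
  moreover have "C \<ge> 0" using assms(3)[of 0] norm_ge_zero order.trans by blast
  ultimately show "AE x in torus. cmod (f x * w x) \<le> norm (C * cmod (f x))" by simp
qed (use assms in measurable)

lemma fourier_coeff_mode: "fourier_coeff f k = (\<integral>x. f x * mode (- k) x \<partial>torus) / of_real (2 * pi)"
  by (simp add: fourier_coeff_def mode_def)

inductive trig_span :: "(real \<Rightarrow> complex) \<Rightarrow> bool" where
  mode: "trig_span (mode k)"
| add: "trig_span f \<Longrightarrow> trig_span g \<Longrightarrow> trig_span (\<lambda>x. f x + g x)"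
| scale: "trig_span f \<Longrightarrow> trig_span (\<lambda>x. a * f x)"

lemma trig_span_mult: "trig_span f \<Longrightarrow> trig_span g \<Longrightarrow> trig_span (\<lambda>x. f x * g x)"
proof (induction f rule: trig_span.induct)
  case (mode k)
  then show ?case
  proof (induction g rule: trig_span.induct)
    case (mode l)
    have "(\<lambda>x. mode k x * mode l x) = mode (k + l)" by (simp add: mode_add fun_eq_iff)
    then show ?case using trig_span.mode by simp
  next
    case (add f g)
    then show ?case using trig_span.add[OF add.IH] by (simp add: distrib_left)
  next
    case (scale f a)
    then show ?case using trig_span.scale[OF scale.IH, of a] by (simp add: mult.left_commute)
  qed
next
  case (add f1 f2)
  then show ?case using trig_span.add[OF add.IH] by (simp add: distrib_right)
next
  case (scale f a)
  then show ?case using trig_span.scale[OF scale.IH, of a] by (simp add: mult.assoc)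
qed

text \<open>Carries Stone-Weierstrass on the circle over to trigonometric polynomials: on the circle
  a real linear form is a combination of \<open>cos\<close> and \<open>sin\<close>, that is, of the
  modes 1 and -1, and the span is closed under products.\<close>

lemma trig_span_polynomial:
  fixes p :: "complex \<Rightarrow> real"
  assumes "real_polynomial_function p"
  shows "trig_span (\<lambda>x. of_real (p (cis x)))"
  using assms
proof (induction p rule: real_polynomial_function.induct)
  case (linear f)
  interpret bounded_linear f by fact
  have "complex_of_real (f (cis x)) = ((of_real (f 1) - \<i> * of_real (f \<i>)) / 2) * mode 1 x
     + ((of_real (f 1) + \<i> * of_real (f \<i>)) / 2) * mode (- 1) x" for x
  proof -
    have "cis x = cos x *\<^sub>R 1 + sin x *\<^sub>R \<i>" by (simp add: complex_eq_iff)
    then have "f (cis x) = cos x * f 1 + sin x * f \<i>" by (simp only: add scaleR) simp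
    moreover have "complex_of_real (cos x) = (mode 1 x + mode (- 1) x) / 2"
      "complex_of_real (sin x) = \<i> * (mode (- 1) x - mode 1 x) / 2"
      by (simp_all add: mode_def complex_eq_iff)
    ultimately have "complex_of_real (f (cis x)) = (mode 1 x + mode (- 1) x) / 2 * of_real (f 1) + \<i>
      * (mode (- 1) x - mode 1 x) / 2 * of_real (f \<i>)"
      by (simp only: of_real_add of_real_mult)
    then show ?thesis by (simp add: field_simps)
  qed
  then have "(\<lambda>x. complex_of_real (f (cis x))) = (\<lambda>x. ((of_real (f 1) - \<i> * of_real (f \<i>)) / 2) * mode 1 x
     + ((of_real (f 1) + \<i> * of_real (f \<i>)) / 2) * mode (- 1) x)" by blast
  then show ?case by (simp only:) (intro trig_span.intros)
next
  case (const c)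
  show ?case using trig_span.scale[OF trig_span.mode[of 0], of "of_real c"] by simp
next
  case (add f g)
  then show ?case using trig_span.add[OF add.IH] by simp
next
  case (mult f g)
  then show ?case using trig_span_mult[OF mult.IH] by simp
qed

lemma trig_span_continuous: "trig_span f \<Longrightarrow> continuous_on UNIV f"
  by (induction rule: trig_span.induct) (auto intro!: continuous_intros)

lemma trig_span_bounded: "trig_span f \<Longrightarrow> \<exists>C. \<forall>x. cmod (f x) \<le> C"
proof (induction rule: trig_span.induct)
  case (mode k)
  show ?case by (intro exI[of _ 1]) simp
next
  case (add f g)
  then obtain C D where "\<And>x. cmod (f x) \<le> C" "\<And>x. cmod (g x) \<le> D" by blast
  then have "cmod (f x + g x) \<le> C + D" for x by (metis add_mono norm_triangle_ineq order.trans)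
  then show ?case by blast
next
  case (scale f a)
  then obtain C where "\<And>x. cmod (f x) \<le> C" by blast
  then have "cmod (a * f x) \<le> cmod a * C" for x by (simp add: norm_mult mult_left_mono)
  then show ?case by blast
qed

lemma trig_span_measurable: "trig_span f \<Longrightarrow> f \<in> borel_measurable torus"
  by (intro measurable_torusI borel_measurable_continuous_onI trig_span_continuous)

lemma integral_trig_span_zero:
  assumes f: "integrable torus f" "\<And>k. fourier_coeff f k = 0" and "trig_span p"
  shows "(\<integral>x. f x * p x \<partial>torus) = 0"
  using assms(3)
proof (induction p rule: trig_span.induct)
  case (mode k)
  show ?case using f(2)[of "- k"] by (simp add: fourier_coeff_mode)
next
  case (add p q)
  have "integrable torus (\<lambda>x. f x * r x)" if "trig_span r" for r
    using trig_span_bounded[OF that] trig_span_measurable[OF that] integrable_torus_mult[OF f(1)] by blast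
  then show ?case using add by (simp add: distrib_left)
next
  case (scale p a)
  have "(\<integral>x. f x * (a * p x) \<partial>torus) = (\<integral>x. a * (f x * p x) \<partial>torus)" by (simp add: mult.left_commute)
  then show ?case using scale by simp
qed

text \<open>A polynomial within \<open>e\<close> of \<open>v\<close> on the circle integrates to 0
  against \<open>f\<close>, and the replacement changes the integral by at most \<open>e\<close>
  times the integral of \<open>cmod (f x)\<close>.\<close>

lemma integral_circle_function_zero:
  fixes v :: "complex \<Rightarrow> real"
  assumes f: "integrable torus f" "\<And>k. fourier_coeff f k = 0" and v: "continuous_on UNIV v"
    and bnd: "\<And>z. \<bar>v z\<bar> \<le> 1"
  shows "(\<integral>x. f x * of_real (v (cis x)) \<partial>torus) = 0"
proof -
  have meas: "(\<lambda>x. complex_of_real (v (cis x))) \<in> borel_measurable torus"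
    by (intro measurable_torusI borel_measurable_continuous_onI continuous_intros
      continuous_on_compose2[OF v]) auto
  have iv: "integrable torus (\<lambda>x. f x * of_real (v (cis x)))"
    by (rule integrable_torus_mult[OF f(1) meas, of 1]) (use bnd in simp)
  have "cmod (\<integral>x. f x * of_real (v (cis x)) \<partial>torus) \<le> e * (\<integral>x. cmod (f x) \<partial>torus)" if "e > 0" for e
  proof -
    obtain p where p: "real_polynomial_function p" "\<And>z. z \<in> sphere 0 1 \<Longrightarrow> \<bar>v z - p z\<bar> < e"
      using Stone_Weierstrass_real_polynomial_function[of "sphere (0::complex) 1" v e] \<open>e > 0\<close>
        continuous_on_subset[OF v] by auto
    note ts = trig_span_polynomial[OF p(1)]
    obtain C where C: "\<And>x. cmod (of_real (p (cis x))) \<le> C" using trig_span_bounded[OF ts] by blast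
    have ip: "integrable torus (\<lambda>x. f x * of_real (p (cis x)))"
      by (rule integrable_torus_mult[OF f(1) trig_span_measurable[OF ts] C])
    have "(\<integral>x. f x * of_real (v (cis x)) \<partial>torus)
      = (\<integral>x. f x * of_real (v (cis x)) - f x * of_real (p (cis x)) \<partial>torus)"
      using integral_trig_span_zero[OF f ts] iv ip by simp
    also have "cmod \<dots> \<le> (\<integral>x. e * cmod (f x) \<partial>torus)"
    proof (rule order.trans[OF integral_norm_bound integral_mono])
      show "cmod (f x * of_real (v (cis x)) - f x * of_real (p (cis x))) \<le> e * cmod (f x)" for x
      proof -
        have "f x * of_real (v (cis x)) - f x * of_real (p (cis x)) = f x * of_real (v (cis x) - p (cis x))"
          by (simp add: right_diff_distrib)
        then show ?thesis using p(2)[of "cis x"]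
          by (simp add: norm_mult mult.commute[of e] mult_left_mono del: of_real_diff)
      qed
    qed (use iv ip f in auto)
    finally show ?thesis by simp
  qed
  note bound = this
  have "((\<lambda>e. e * (\<integral>x. cmod (f x) \<partial>torus)) \<longlongrightarrow> 0 * (\<integral>x. cmod (f x) \<partial>torus)) (at_right 0)"
    by (intro tendsto_intros)
  then have "cmod (\<integral>x. f x * of_real (v (cis x)) \<partial>torus) \<le> 0 * (\<integral>x. cmod (f x) \<partial>torus)"
    by (rule tendsto_lowerbound) (auto intro!: eventually_at_rightI[of 0 1] bound)
  then show ?thesis by simp
qed

text \<open>Injectivity of \<open>cis\<close> on a half-open period; it gives the points past
  \<open>x\<close> a positive distance from the arc.\<close>

lemma cis_notin_arc:
  assumes "0 \<le> x" "x < y" "y < 2 * pi"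
  shows "cis y \<notin> cis ` {0..x}"
proof
  assume "cis y \<in> cis ` {0..x}"
  then obtain t where t: "0 \<le> t" "t \<le> x" "cis y = cis t" by auto
  then have "sin y = sin t \<and> cos y = cos t" by (simp add: complex_eq_iff)
  then obtain n :: int where n: "y = t + 2 * pi * of_int n"
    using sin_cos_eq_iff[of y t] by (auto simp: mult_ac)
  have "0 < pi * real_of_int n" "pi * real_of_int n < pi * 1" using n t assms by linarith+
  then have "0 < real_of_int n" "real_of_int n < 1"
    using pi_gt_zero by (auto simp only: zero_less_mult_pos mult_less_cancel_left_pos)
  then have "0 < n" "n < 1" by simp_all
  then show False by linarith
qed

text \<open>The indicator of an arc is a bounded pointwise limit of continuous functions on the circle, and
  those are uniform limits of trigonometric polynomials.\<close>

theorem fourier_uniqueness: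
  assumes f: "integrable torus f" "\<And>k. fourier_coeff f k = 0"
  shows "AE x in torus. f x = 0"
proof -
  define F where "F x = indicator {0..2*pi} x *\<^sub>R f x" for x
  have F: "integrable lborel F" using f(1) unfolding integrable_torus_iff F_def .
  have arc: "(\<integral>y. indicator {x<..} y *\<^sub>R F y \<partial>lborel) = 0" if x: "0 \<le> x" "x < 2 * pi" for x
  proof -
    \<comment> \<open>These functions tend to the indicator of the complement of the closed arc from
      0 to \<open>x\<close>. The parameter \<open>2 \<pi>\<close> gets the limit 0, because it is
      the same point of the circle as 0.\<close>
    define v where "v n z = min 1 (real n * infdist z (cis ` {0..x}))" for n :: nat and z
    have vc: "continuous_on UNIV (v n)" for n unfolding v_def by (intro continuous_intros)
    have v1: "0 \<le> v n z" "v n z \<le> 1" for n z by (auto simp: v_def infdist_nonneg)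
    have lim: "(\<lambda>n. v n (cis y)) \<longlonglongrightarrow> indicator {x<..<2*pi} y" if "y \<in> {0..2*pi}" for y
    proof (cases "x < y \<and> y < 2 * pi")
      case False
      have "cis y \<in> cis ` {0..x}"
      proof (cases "y = 2 * pi")
        case True
        then show ?thesis using x(1) by (intro image_eqI[of _ _ 0]) (auto simp: cis_2pi)
      next
        case False
        then show ?thesis using \<open>\<not> (x < y \<and> y < 2 * pi)\<close> that by (intro imageI) auto
      qed
      then have "v n (cis y) = 0" for n by (simp add: v_def)
      then show ?thesis using False by (auto simp: indicator_def)
    next
      case True
      have "closed (cis ` {0..x})" by (intro compact_imp_closed compact_continuous_image continuous_intros)
        auto
      then have "infdist (cis y) (cis ` {0..x}) > 0"
        using cis_notin_arc[of x y] True x by (intro infdist_pos_not_in_closed) auto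
      then obtain N :: nat where N: "1 < real N * infdist (cis y) (cis ` {0..x})"
        using reals_Archimedean3 by blast
      have "1 \<le> real n * infdist (cis y) (cis ` {0..x})" if "N \<le> n" for n
        using N that mult_right_mono[of "real N" "real n" "infdist (cis y) (cis ` {0..x})"]
        by (simp add: infdist_nonneg)
      then have "\<forall>\<^sub>F n in sequentially. 1 \<le> real n * infdist (cis y) (cis ` {0..x})"
        by (rule eventually_sequentiallyI)
      then have "\<forall>\<^sub>F n in sequentially. v n (cis y) = 1"
        by eventually_elim (simp add: v_def)
      then show ?thesis using True by (simp add: tendsto_eventually)
    qed
    have "(\<lambda>n. \<integral>y. f y * of_real (v n (cis y)) \<partial>torus) \<longlonglongrightarrow> (\<integral>y. f y * of_real (indicator {x<..<2*pi} y) \<partial>torus)"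
    proof (rule integral_dominated_convergence[where w = "\<lambda>y. cmod (f y)"])
      show "(\<lambda>y. f y * complex_of_real (indicator {x<..<2*pi} y)) \<in> borel_measurable torus"
        using borel_measurable_integrable[OF f(1)]
          by (rule borel_measurable_times) (rule measurable_torusI, simp)
      show "(\<lambda>y. f y * complex_of_real (v n (cis y))) \<in> borel_measurable torus" for n
        using borel_measurable_integrable[OF f(1)]
        by (rule borel_measurable_times) (intro measurable_torusI borel_measurable_continuous_onI
            continuous_intros continuous_on_compose2[OF vc], auto)
      show "AE y in torus. (\<lambda>n. f y * complex_of_real (v n (cis y)))
        \<longlonglongrightarrow> f y * complex_of_real (indicator {x<..<2*pi} y)"
        by (intro AE_I2 tendsto_intros lim) (simp add: space_torus)
      show "AE y in torus. cmod (f y * complex_of_real (v n (cis y))) \<le> cmod (f y)" for n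
        using v1[of n] by (intro AE_I2) (simp add: norm_mult mult_left_le)
    qed (use f in auto)
    moreover have "(\<integral>y. f y * of_real (v n (cis y)) \<partial>torus) = 0" for n
      using v1 by (intro integral_circle_function_zero f vc)
        (auto simp: abs_le_iff intro: order.trans[OF _ v1(1)])
    ultimately have "(\<integral>y. f y * of_real (indicator {x<..<2*pi} y) \<partial>torus) = 0"
      by (simp add: LIMSEQ_const_iff)
    then have "(\<integral>y. indicator {0..2*pi} y *\<^sub>R (f y * of_real (indicator {x<..<2*pi} y)) \<partial>lborel) = 0"
      by (simp add: integral_torus_eq)
    also have "(\<integral>y. indicator {0..2*pi} y *\<^sub>R (f y * of_real (indicator {x<..<2*pi} y)) \<partial>lborel)
      = (\<integral>y. indicator {x<..} y *\<^sub>R F y \<partial>lborel)"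
    proof (rule integral_cong_AE)
      have "AE y in lborel. y \<noteq> 2 * pi" by (rule AE_lborel_singleton)
      then show "AE y in lborel. indicator {0..2*pi} y *\<^sub>R (f y * of_real (indicator {x<..<2*pi} y))
        = indicator {x<..} y *\<^sub>R F y"
        by eventually_elim (auto simp: F_def indicator_def)
      have "(\<lambda>y. indicator {0..2*pi} y *\<^sub>R (f y * of_real (indicator {x<..<2*pi} y)))
        = (\<lambda>y. indicator {x<..<2*pi} y *\<^sub>R F y)"
        by (auto simp: F_def indicator_def)
      then show "(\<lambda>y. indicator {0..2*pi} y *\<^sub>R (f y * complex_of_real (indicator {x<..<2*pi} y))) \<in>
        borel_measurable lborel"
        using F by (simp only:) (intro borel_measurable_scaleR, auto)
      show "(\<lambda>y. indicator {x<..} y *\<^sub>R F y) \<in> borel_measurable lborel"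
        using F by (intro borel_measurable_scaleR) auto
    qed
    finally show ?thesis .
  qed
  \<comment> \<open>\<open>F\<close> vanishes outside the period, so a ray that starts left of 0 can
    be shortened to start at 0, up to a null set.\<close>
  have ray: "(\<integral>y. indicator {x<..} y *\<^sub>R F y \<partial>lborel) = 0" for x
  proof (cases "x < 2 * pi")
    case False
    then have "(\<lambda>y. indicator {x<..} y *\<^sub>R F y) = (\<lambda>_. 0)" by (auto simp: F_def indicator_def)
    then show ?thesis by simp
  next
    case True
    have "(\<integral>y. indicator {x<..} y *\<^sub>R F y \<partial>lborel) = (\<integral>y. indicator {max 0 x<..} y *\<^sub>R F y \<partial>lborel)"
    proof (rule integral_cong_AE)
      have "AE y in lborel. y \<noteq> (0::real)" by (rule AE_lborel_singleton)
      then show "AE y in lborel. indicator {x<..} y *\<^sub>R F y = indicator {max 0 x<..} y *\<^sub>R F y"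
        by eventually_elim (auto simp: F_def indicator_def)
    qed (use F in \<open>auto intro!: borel_measurable_scaleR\<close>)
    also have "\<dots> = 0" using True by (intro arc) auto
    finally show ?thesis .
  qed
  have iF: "integrable lborel (\<lambda>y. indicator {x<..} y *\<^sub>R F y)" for x
    by (rule integrable_mult_indicator[OF _ F]) auto
  have "AE y in lborel. Re (F y) = 0"
  proof (rule AE_zero_if_ray_integrals_zero)
    show "(\<integral>y. indicator {x<..} y * Re (F y) \<partial>lborel) = 0" for x
      using integral_Re[OF iF, of x] ray[of x] by simp
  qed (use F in auto)
  moreover have "AE y in lborel. Im (F y) = 0"
  proof (rule AE_zero_if_ray_integrals_zero)
    show "(\<integral>y. indicator {x<..} y * Im (F y) \<partial>lborel) = 0" for x
      using integral_Im[OF iF, of x] ray[of x] by simp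
  qed (use F in auto)
  ultimately have "AE y in lborel. y \<in> {0..2*pi} \<longrightarrow> f y = 0"
    by eventually_elim (auto simp: F_def complex_eq_iff)
  then show ?thesis unfolding torus_def by (subst AE_restrict_space_iff) auto
qed


section \<open>Fourier coefficients of derivatives and of uniformly convergent series\<close>

lemma mode_conv_exp: "mode k x = exp (\<i> * of_int k * of_real x)"
  by (simp add: mode_def cis_conv_exp mult.assoc)

lemma mode_vector_derivative: "(mode k has_vector_derivative \<i> * of_int k * mode k x) (at x)"
proof -
  have "((\<lambda>z. exp (\<i> * of_int k * z)) has_field_derivative exp (\<i> * of_int k * of_real x) * (\<i> * of_int k))
    (at (of_real x))"
    by (auto intro!: derivative_eq_intros)
  from has_vector_derivative_real_field[OF this]
  show ?thesis by (simp add: mode_conv_exp[abs_def] mult.commute)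
qed

lemma mode_2pi [simp]: "mode k (2 * pi) = 1"
  using cis_multiple_2pi[of "of_int k"] by (simp add: mode_def mult.commute)

lemma mode_at_0 [simp]: "mode k 0 = 1"
  by (simp add: mode_def)

lemma fourier_coeff_deriv:
  fixes f :: "real \<Rightarrow> complex"
  assumes d: "\<And>x. (f has_vector_derivative f' x) (at x)" and c: "continuous_on UNIV f'" and u_periodic: "f
    (2 * pi) = f 0"
  shows "fourier_coeff f' k = \<i> * of_int k * fourier_coeff f k"
proof -
  have cf: "continuous_on UNIV f"
    by (rule continuous_at_imp_continuous_on) (use has_vector_derivative_continuous[OF d] in auto)
  define h where "h x = f x * (\<i> * of_int (- k) * mode (- k) x) + f' x * mode (- k) x" for x
  have "((\<lambda>x. f x * mode (- k) x) has_vector_derivative h x) (at x within {0..2*pi})" for x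
    unfolding h_def by (intro has_vector_derivative_mult has_vector_derivative_at_within[OF d]
        has_vector_derivative_at_within[OF mode_vector_derivative])
  moreover have "continuous_on {0..2*pi} h"
    unfolding h_def by (intro continuous_intros continuous_on_subset[OF cf] continuous_on_subset[OF c]) auto
  ultimately have "(\<integral>x. indicator {0..2*pi} x *\<^sub>R h x \<partial>lborel) = f (2 * pi) * mode (- k) (2 * pi) - f 0
    * mode (- k) 0"
    by (intro integral_FTC_Icc) auto
  then have "(\<integral>x. h x \<partial>torus) = 0" by (simp add: integral_torus_eq u_periodic)
  moreover have "(\<integral>x. h x \<partial>torus)
    = (\<integral>x. (- \<i> * of_int k) * (f x * mode (- k) x) + f' x * mode (- k) x \<partial>torus)"
    by (simp add: h_def algebra_simps)
  moreover have "\<dots> = (- \<i> * of_int k) * (\<integral>x. f x * mode (- k) x \<partial>torus) + (\<integral>x. f' x * mode (- k) x \<partial>torus)"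
  proof -
    have "integrable torus (\<lambda>x. f x * mode (- k) x)" "integrable torus (\<lambda>x. f' x * mode (- k) x)"
      by (intro integrable_torus_continuous continuous_intros continuous_on_subset[OF cf]
        continuous_on_subset[OF c]; simp)+
    then show ?thesis by simp
  qed
  ultimately have "(\<integral>x. f' x * mode (- k) x \<partial>torus) = \<i> * of_int k * (\<integral>x. f x * mode (- k) x \<partial>torus)"
    by (simp add: algebra_simps)
  then show ?thesis by (simp add: fourier_coeff_mode)
qed

lemma measure_torus: "measure torus (space torus) = 2 * pi"
  by (simp add: torus_def space_restrict_space measure_restrict_space)

text \<open>Orthogonality without computing integrals: the constant 1 has derivative 0, so
  \<open>k\<close> times its \<open>k\<close>-th coefficient vanishes.\<close>

lemma fourier_coeff_1: "fourier_coeff (\<lambda>_. 1) k = of_bool (k = 0)"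
proof (cases "k = 0")
  case True
  have "(\<integral>x. 1 \<partial>torus) = complex_of_real (2 * pi)" using measure_torus by (simp add: scaleR_conv_of_real)
  then show ?thesis using True by (simp add: fourier_coeff_mode)
next
  case False
  have "fourier_coeff (\<lambda>_. 0) k = \<i> * of_int k * fourier_coeff (\<lambda>_. 1) k"
    by (rule fourier_coeff_deriv) (auto intro!: derivative_eq_intros)
  then show ?thesis using False by (simp add: fourier_coeff_mode)
qed

lemma integral_mode: "(\<integral>x. mode k x \<partial>torus) = of_bool (k = 0) * of_real (2 * pi)"
  using fourier_coeff_1[of "- k"] by (simp add: fourier_coeff_mode field_simps)

lemma fourier_coeff_bounded:
  assumes "continuous_on UNIV f"
  obtains C where "C > 0" "\<And>k. cmod (fourier_coeff f k) \<le> C"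
proof -
  have c: "continuous_on {0..2*pi} f" using assms by (rule continuous_on_subset) simp
  have "bounded (f ` {0..2*pi})" by (intro compact_imp_bounded compact_continuous_image c) auto
  then obtain C where C: "C > 0" "\<And>x. x \<in> {0..2*pi} \<Longrightarrow> cmod (f x) \<le> C"
    by (auto simp: bounded_pos)
  have "cmod (fourier_coeff f k) \<le> C" for k
  proof -
    have i: "integrable torus (\<lambda>x. f x * mode (- k) x)"
      by (intro integrable_torus_continuous continuous_intros c)
    have "cmod (\<integral>x. f x * mode (- k) x \<partial>torus) \<le> (\<integral>x. cmod (f x * mode (- k) x) \<partial>torus)"
      by (rule integral_norm_bound)
    also have "\<dots> \<le> (\<integral>x. C \<partial>torus)"
      using integrable_norm[OF i] C(2) by (intro integral_mono) (auto simp: norm_mult space_torus)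
    also have "\<dots> = C * (2 * pi)" using measure_torus by simp
    finally show ?thesis by (simp add: fourier_coeff_mode norm_divide field_simps)
  qed
  then show ?thesis using C(1) that by blast
qed

lemma fourier_coeff_diff:
  assumes "integrable torus f" "integrable torus g"
  shows "fourier_coeff (\<lambda>x. f x - g x) k = fourier_coeff f k - fourier_coeff g k"
proof -
  have "integrable torus (\<lambda>x. f x * mode (- k) x)" "integrable torus (\<lambda>x. g x * mode (- k) x)"
    by (rule integrable_torus_mult[of _ _ 1]; use assms in \<open>simp add: measurable_torusI\<close>)+
  then show ?thesis by (simp add: fourier_coeff_mode left_diff_distrib diff_divide_distrib)
qed

lemma fourier_coeff_scale: "fourier_coeff (\<lambda>x. a * f x) k = a * fourier_coeff f k"
  by (simp add: fourier_coeff_mode mult.assoc)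

lemma fourier_coeff_cong_AE:
  assumes "f \<in> borel_measurable torus" "g \<in> borel_measurable torus" "AE x in torus. f x = g x"
  shows "fourier_coeff f k = fourier_coeff g k"
proof -
  have "(\<integral>x. f x * mode (- k) x \<partial>torus) = (\<integral>x. g x * mode (- k) x \<partial>torus)"
    by (intro integral_cong_AE borel_measurable_times assms measurable_torusI[OF measurable_mode])
      (use assms(3) in auto)
  then show ?thesis by (simp add: fourier_coeff_mode)
qed

lemma AE_eq_if_fourier_coeff_eq:
  assumes "integrable torus f" "integrable torus g" "\<And>k. fourier_coeff f k = fourier_coeff g k"
  shows "AE x in torus. f x = g x"
proof -
  have "AE x in torus. f x - g x = 0"
    by (rule fourier_uniqueness) (use assms in \<open>auto simp: fourier_coeff_diff\<close>)
  then show ?thesis by simp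
qed

text \<open>The set of disagreement in the open period is open and null, hence empty. Endpoints are
  left to one-sided limits and periodicity.\<close>

lemma AE_torus_continuous_eq:
  fixes f g :: "real \<Rightarrow> complex"
  assumes "AE x in torus. f x = g x" "continuous_on UNIV f" "continuous_on UNIV g" "x \<in> {0<..<2*pi}"
  shows "f x = g x"
proof (rule ccontr)
  assume "f x \<noteq> g x"
  define S where "S = {y. f y - g y \<noteq> 0} \<inter> {0<..<2*pi}"
  have "open {y. f y - g y \<noteq> 0}" using assms by (intro open_Collect_neq continuous_intros) auto
  then have "open S" unfolding S_def by (intro open_Int) auto
  moreover have "x \<in> S" using assms \<open>f x \<noteq> g x\<close> by (simp add: S_def)
  moreover have "AE y in lborel. y \<in> {0..2*pi} \<longrightarrow> f y = g y"
    using assms(1) unfolding torus_def by (subst (asm) AE_restrict_space_iff) auto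
  then have "AE y in lborel. y \<notin> S" by eventually_elim (auto simp: S_def)
  then have "emeasure lborel S = 0" using \<open>open S\<close> by (subst (asm) AE_iff_measurable[OF _ refl]) auto
  ultimately show False
    using open_not_negligible[of S] by (auto simp: negligible_iff_emeasure0)
qed

text \<open>The frequencies are enumerated by \<open>q\<close> so that series over
  \<open>nat\<close> serve all cases: \<open>int\<close> for Hardy functions, the negative integers
  for what the projection removes, \<open>int_decode\<close> for \<open>u\<close>.\<close>

definition trig_series :: "(nat \<Rightarrow> complex) \<Rightarrow> (nat \<Rightarrow> int) \<Rightarrow> real \<Rightarrow> complex" where
  "trig_series b q x = (\<Sum>n. b n * mode (q n) x)"

context
  fixes b :: "nat \<Rightarrow> complex" and q :: "nat \<Rightarrow> int"
  assumes b: "summable (\<lambda>n. cmod (b n))"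
begin

lemma continuous_trig_series: "continuous_on UNIV (trig_series b q)"
proof (rule uniform_limit_theorem)
  show "uniform_limit UNIV (\<lambda>n x. \<Sum>i<n. b i * mode (q i) x) (trig_series b q) sequentially"
    unfolding trig_series_def[abs_def] by (rule Weierstrass_m_test[OF _ b]) (simp add: norm_mult)
  show "\<forall>\<^sub>F n in sequentially. continuous_on UNIV (\<lambda>x. \<Sum>i<n. b i * mode (q i) x)"
    by (intro always_eventually allI continuous_intros)
qed simp

lemma trig_series_bound: "cmod (trig_series b q x) \<le> (\<Sum>n. cmod (b n))"
  unfolding trig_series_def using summable_norm[of "\<lambda>n. b n * mode (q n) x"] b by (simp add: norm_mult)

lemma measurable_trig_series: "trig_series b q \<in> borel_measurable torus"
  by (intro measurable_torusI borel_measurable_continuous_onI continuous_trig_series)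

lemma integrable_trig_series: "integrable torus (trig_series b q)"
  by (rule integrable_torus_bounded[OF measurable_trig_series trig_series_bound])

lemma integral_mult_trig_series:
  assumes w: "integrable torus w"
  shows "(\<lambda>n. b n * (\<integral>x. w x * mode (q n) x \<partial>torus)) sums (\<integral>x. w x * trig_series b q x \<partial>torus)"
proof -
  have i: "integrable torus (\<lambda>x. w x * mode (q n) x)" for n
    by (rule integrable_torus_mult[of _ _ 1]) (use w in \<open>simp_all add: measurable_torusI\<close>)
  have "(\<lambda>n. \<integral>x. b n * (w x * mode (q n) x) \<partial>torus) sums (\<integral>x. (\<Sum>n. b n * (w x * mode (q n) x)) \<partial>torus)"
  proof (rule sums_integral)
    show "integrable torus (\<lambda>x. b n * (w x * mode (q n) x))" for n using i by simp
    show "AE x in torus. summable (\<lambda>n. norm (b n * (w x * mode (q n) x)))"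
      using summable_mult2[OF b] by (simp add: norm_mult)
    show "summable (\<lambda>n. \<integral>x. norm (b n * (w x * mode (q n) x)) \<partial>torus)"
      using summable_mult2[OF b] by (simp add: norm_mult)
  qed
  moreover have "(\<Sum>n. b n * (w x * mode (q n) x)) = w x * trig_series b q x" for x
  proof -
    have "summable (\<lambda>n. b n * mode (q n) x)"
      by (rule summable_norm_cancel) (simp add: norm_mult b)
    then have "w x * trig_series b q x = (\<Sum>n. w x * (b n * mode (q n) x))"
      unfolding trig_series_def by (rule suminf_mult[symmetric])
    then show ?thesis by (simp add: mult_ac)
  qed
  ultimately show ?thesis by simp
qed

lemma fourier_coeff_trig_series: "(\<lambda>n. b n * of_bool (q n = j)) sums fourier_coeff (trig_series b q) j"
proof -
  have "integrable torus (mode (- j))" by (intro integrable_torus_continuous continuous_intros)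
  from sums_divide[OF integral_mult_trig_series[OF this], of "of_real (2 * pi)"]
  have 1: "(\<lambda>n. b n * (\<integral>x. mode (- j) x * mode (q n) x \<partial>torus) / of_real (2 * pi))
    sums fourier_coeff (trig_series b q) j"
    by (simp only: fourier_coeff_mode mult.commute)
  have 2: "b n * (\<integral>x. mode (- j) x * mode (q n) x \<partial>torus) / of_real (2 * pi) = b n * of_bool (q n = j)" for n
    unfolding mode_add[symmetric] integral_mode by simp
  show ?thesis using 1 unfolding 2 .
qed

lemma fourier_coeff_trig_series_in:
  assumes "inj q"
  shows "fourier_coeff (trig_series b q) (q n) = b n"
proof -
  have "(\<lambda>m. b m * of_bool (q m = q n)) = (\<lambda>m. if m = n then b n else 0)"
    using assms by (auto simp: inj_def fun_eq_iff)
  then show ?thesis using fourier_coeff_trig_series[of "q n"] sums_unique2 sums_single[of n "\<lambda>_. b n"]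
    by (metis (no_types, lifting))
qed

lemma fourier_coeff_trig_series_notin:
  assumes "j \<notin> range q"
  shows "fourier_coeff (trig_series b q) j = 0"
proof -
  have "(\<lambda>m. b m * of_bool (q m = j)) = (\<lambda>_. 0)" using assms by (auto simp: fun_eq_iff)
  then show ?thesis using fourier_coeff_trig_series[of j] sums_unique2 sums_zero by metis
qed

end

section \<open>Square-integrable functions and Bessel's inequality\<close>

lemma L2_integrable:
  assumes "f \<in> L2_torus"
  shows "integrable torus f"
proof (rule Bochner_Integration.integrable_bound)
  show "integrable torus (\<lambda>x. 1 + (cmod (f x))\<^sup>2)" using assms by (simp add: L2_torus_def)
  have "cmod (f x) \<le> 1 + (cmod (f x))\<^sup>2" for x
  proof -
    have "2 * cmod (f x) \<le> 1 + (cmod (f x))\<^sup>2" using sum_squares_bound[of 1 "cmod (f x)"] by simp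
    then show ?thesis using norm_ge_zero[of "f x"] by linarith
  qed
  then show "AE x in torus. norm (f x) \<le> norm (1 + (cmod (f x))\<^sup>2)" by (intro AE_I2) (simp add: abs_of_nonneg)
qed (use assms in \<open>simp add: L2_torus_def\<close>)

lemma L2_bounded:
  assumes "f \<in> borel_measurable torus" "\<And>x. cmod (f x) \<le> C"
  shows "f \<in> L2_torus"
proof -
  have "integrable torus (\<lambda>x. (cmod (f x))\<^sup>2)"
    by (rule integrable_torus_bounded[where C = "C\<^sup>2"]) (use assms in \<open>auto intro: power_mono\<close>)
  then show ?thesis using assms by (simp add: L2_torus_def)
qed

lemma L2_mult_bounded:
  assumes f: "f \<in> L2_torus" and w: "w \<in> borel_measurable torus" "\<And>x. cmod (w x) \<le> C"
  shows "(\<lambda>x. w x * f x) \<in> L2_torus"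
proof -
  have [measurable]: "f \<in> borel_measurable torus" "w \<in> borel_measurable torus"
    using f w by (auto simp: L2_torus_def)
  have "integrable torus (\<lambda>x. (cmod (w x * f x))\<^sup>2)"
  proof (rule Bochner_Integration.integrable_bound)
    show "integrable torus (\<lambda>x. C\<^sup>2 * (cmod (f x))\<^sup>2)" using f by (simp add: L2_torus_def)
    have "(cmod (w x * f x))\<^sup>2 \<le> C\<^sup>2 * (cmod (f x))\<^sup>2" for x
      unfolding norm_mult power_mult_distrib using w(2)[of x] by (intro mult_right_mono power_mono) auto
    then show "AE x in torus. norm ((cmod (w x * f x))\<^sup>2) \<le> norm (C\<^sup>2 * (cmod (f x))\<^sup>2)" by simp
  qed measurable
  then show ?thesis by (simp add: L2_torus_def)
qed

lemma L2_diff: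
  assumes "f \<in> L2_torus" "g \<in> L2_torus"
  shows "(\<lambda>x. f x - g x) \<in> L2_torus"
proof -
  have [measurable]: "f \<in> borel_measurable torus" "g \<in> borel_measurable torus"
    using assms by (auto simp: L2_torus_def)
  have "integrable torus (\<lambda>x. (cmod (f x - g x))\<^sup>2)"
  proof (rule Bochner_Integration.integrable_bound)
    show "integrable torus (\<lambda>x. 2 * (cmod (f x))\<^sup>2 + 2 * (cmod (g x))\<^sup>2)" using assms
      by (simp add: L2_torus_def)
    have "(cmod (f x - g x))\<^sup>2 \<le> 2 * (cmod (f x))\<^sup>2 + 2 * (cmod (g x))\<^sup>2" for x
    proof -
      have "(cmod (f x - g x))\<^sup>2 \<le> (cmod (f x) + cmod (g x))\<^sup>2" by (intro power_mono norm_triangle_ineq4) auto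
      also have "\<dots> \<le> 2 * (cmod (f x))\<^sup>2 + 2 * (cmod (g x))\<^sup>2"
        using sum_squares_bound[of "cmod (f x)" "cmod (g x)"] by (simp add: power2_sum)
      finally show ?thesis .
    qed
    then show "AE x in torus. norm ((cmod (f x - g x))\<^sup>2) \<le> norm (2 * (cmod (f x))\<^sup>2 + 2 * (cmod (g x))\<^sup>2)"
      by simp
  qed measurable
  then show ?thesis by (simp add: L2_torus_def)
qed

lemma L2_mult_integrable:
  assumes "f \<in> L2_torus" "g \<in> L2_torus"
  shows "integrable torus (\<lambda>x. f x * cnj (g x))"
proof (rule Bochner_Integration.integrable_bound)
  show "integrable torus (\<lambda>x. (cmod (f x))\<^sup>2 + (cmod (g x))\<^sup>2)" using assms by (simp add: L2_torus_def)
  have "cmod (f x * cnj (g x)) \<le> (cmod (f x))\<^sup>2 + (cmod (g x))\<^sup>2" for x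
  proof -
    have "2 * (cmod (f x) * cmod (g x)) \<le> (cmod (f x))\<^sup>2 + (cmod (g x))\<^sup>2"
      using sum_squares_bound[of "cmod (f x)" "cmod (g x)"] by simp
    moreover have "0 \<le> cmod (f x) * cmod (g x)" by simp
    ultimately have "cmod (f x) * cmod (g x) \<le> (cmod (f x))\<^sup>2 + (cmod (g x))\<^sup>2" by linarith
    then show ?thesis by (simp add: norm_mult)
  qed
  then show "AE x in torus. norm (f x * cnj (g x)) \<le> norm ((cmod (f x))\<^sup>2 + (cmod (g x))\<^sup>2)" by simp
  have [measurable]: "f \<in> borel_measurable torus" "g \<in> borel_measurable torus"
    using assms by (auto simp: L2_torus_def)
  have "(\<lambda>x. cnj (g x)) \<in> borel_measurable torus"
    by (rule borel_measurable_continuous_on) (auto intro!: continuous_intros)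
  then show "(\<lambda>x. f x * cnj (g x)) \<in> borel_measurable torus" by (intro borel_measurable_times) auto
qed

lemma L2_mode: "mode k \<in> L2_torus"
  by (rule L2_bounded[of _ 1]) (simp_all add: measurable_torusI)

lemma bessel_inequality:
  assumes f: "f \<in> L2_torus" and "finite S"
  shows "(\<Sum>k\<in>S. (cmod (fourier_coeff f k))\<^sup>2) \<le> (\<integral>x. (cmod (f x))\<^sup>2 \<partial>torus) / (2 * pi)"
proof -
  define a where "a = fourier_coeff f"
  define P where "P x = (\<Sum>k\<in>S. a k * mode k x)" for x
  have Pc: "continuous_on T P" for T unfolding P_def by (intro continuous_intros)
  have Pm: "P \<in> borel_measurable torus" by (intro measurable_torusI borel_measurable_continuous_onI Pc)
  have "cmod (P x) \<le> (\<Sum>k\<in>S. cmod (a k))" for x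
    unfolding P_def by (rule order.trans[OF norm_sum]) (simp add: norm_mult)
  then have P: "P \<in> L2_torus" by (rule L2_bounded[OF Pm])
  have fa: "(\<integral>x. f x * cnj (mode k x) \<partial>torus) = of_real (2 * pi) * a k" for k
    by (simp add: a_def fourier_coeff_mode cnj_mode)
  have ifm: "integrable torus (\<lambda>x. g x * cnj (mode k x))" if "g \<in> L2_torus" for g k
    using L2_mult_integrable[OF that L2_mode] .
  have fP: "(\<integral>x. f x * cnj (P x) \<partial>torus) = of_real (2 * pi * (\<Sum>k\<in>S. (cmod (a k))\<^sup>2))"
  proof -
    have "(\<integral>x. f x * cnj (P x) \<partial>torus) = (\<integral>x. (\<Sum>k\<in>S. cnj (a k) * (f x * cnj (mode k x))) \<partial>torus)"
      by (simp add: P_def sum_distrib_left mult_ac)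
    also have "\<dots> = (\<Sum>k\<in>S. cnj (a k) * (of_real (2 * pi) * a k))"
      using ifm[OF f] by (simp add: fa Bochner_Integration.integral_sum)
    also have "\<dots> = of_real (2 * pi) * (\<Sum>k\<in>S. of_real ((cmod (a k))\<^sup>2))"
      unfolding sum_distrib_left complex_norm_square by (intro sum.cong refl) (simp only: mult_ac)
    finally show ?thesis by simp
  qed
  have Pa: "(\<integral>x. P x * cnj (mode k x) \<partial>torus) = of_real (2 * pi) * a k" if "k \<in> S" for k
  proof -
    have "(\<integral>x. P x * cnj (mode k x) \<partial>torus) = (\<integral>x. (\<Sum>l\<in>S. a l * mode (l + - k) x) \<partial>torus)"
      unfolding mode_add by (simp add: P_def sum_distrib_right cnj_mode mult.assoc)
    also have "\<dots> = (\<Sum>l\<in>S. a l * (of_bool (l = k) * of_real (2 * pi)))"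
      using integrable_torus_continuous[OF continuous_mode]
      by (simp add: Bochner_Integration.integral_sum integral_mode)
    also have "\<dots> = (\<Sum>l\<in>S. if l = k then a k * of_real (2 * pi) else 0)" by (intro sum.cong) auto
    finally show ?thesis using that \<open>finite S\<close> by simp
  qed
  have PP: "(\<integral>x. P x * cnj (P x) \<partial>torus) = of_real (2 * pi * (\<Sum>k\<in>S. (cmod (a k))\<^sup>2))"
  proof -
    have "(\<integral>x. P x * cnj (P x) \<partial>torus) = (\<integral>x. (\<Sum>k\<in>S. cnj (a k) * (P x * cnj (mode k x))) \<partial>torus)"
      by (subst (2) P_def) (simp add: sum_distrib_left mult_ac)
    also have "\<dots> = (\<Sum>k\<in>S. cnj (a k) * (of_real (2 * pi) * a k))"
      using ifm[OF P] by (simp add: Pa Bochner_Integration.integral_sum)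
    also have "\<dots> = of_real (2 * pi) * (\<Sum>k\<in>S. of_real ((cmod (a k))\<^sup>2))"
      unfolding sum_distrib_left complex_norm_square by (intro sum.cong refl) (simp only: mult_ac)
    finally show ?thesis by simp
  qed
  have pt: "(cmod (f x - P x))\<^sup>2 = (cmod (f x))\<^sup>2 - 2 * Re (f x * cnj (P x)) + Re (P x * cnj (P x))" for x
    unfolding cmod_power2 by (simp add: power2_eq_square algebra_simps)
  have i1: "integrable torus (\<lambda>x. (cmod (f x))\<^sup>2)" using f by (simp add: L2_torus_def)
  have i2: "integrable torus (\<lambda>x. Re (f x * cnj (P x)))" using L2_mult_integrable[OF f P]
    by (rule integrable_Re)
  have i3: "integrable torus (\<lambda>x. Re (P x * cnj (P x)))" using L2_mult_integrable[OF P P]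
    by (rule integrable_Re)
  have "0 \<le> (\<integral>x. (cmod (f x - P x))\<^sup>2 \<partial>torus)" by simp
  also have "\<dots> = (\<integral>x. (cmod (f x))\<^sup>2 \<partial>torus) - 2 * (\<integral>x. Re (f x * cnj (P x)) \<partial>torus)
    + (\<integral>x. Re (P x * cnj (P x)) \<partial>torus)"
  proof -
    have "(\<integral>x. (cmod (f x))\<^sup>2 - 2 * r x + s x \<partial>torus) = (\<integral>x. (cmod (f x))\<^sup>2 \<partial>torus) - 2 * (\<integral>x. r x \<partial>torus)
      + (\<integral>x. s x \<partial>torus)"
      if "integrable torus r" "integrable torus s" for r s :: "real \<Rightarrow> real"
      using that i1 by simp
    from this[OF i2 i3] show ?thesis unfolding pt .
  qed
  also have "(\<integral>x. Re (f x * cnj (P x)) \<partial>torus) = 2 * pi * (\<Sum>k\<in>S. (cmod (a k))\<^sup>2)"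
    using integral_Re[OF L2_mult_integrable[OF f P]] unfolding fP by simp
  also have "(\<integral>x. Re (P x * cnj (P x)) \<partial>torus) = 2 * pi * (\<Sum>k\<in>S. (cmod (a k))\<^sup>2)"
    using integral_Re[OF L2_mult_integrable[OF P P]] unfolding PP by simp
  finally have "2 * pi * (\<Sum>k\<in>S. (cmod (a k))\<^sup>2) \<le> (\<integral>x. (cmod (f x))\<^sup>2 \<partial>torus)" by simp
  then show ?thesis by (simp add: a_def field_simps)
qed

section \<open>Fourier coefficients of a periodic function of class C3\<close>

lemma summable_on_int_inverse_square:
  fixes f :: "int \<Rightarrow> real"
  assumes pos: "\<And>k. f k \<ge> 0" and bnd: "\<And>k. f k * (of_int k)\<^sup>2 \<le> C"
  shows "f summable_on UNIV"
proof -
  have s: "summable (\<lambda>n::nat. inverse (real n ^ 2) * C)"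
    by (intro summable_mult2 inverse_power_summable) simp
  have *: "f \<circ> h summable_on UNIV" if h: "\<And>n. \<bar>h n\<bar> = int (Suc n)" for h :: "nat \<Rightarrow> int"
  proof (rule summable_nonneg_imp_summable_on)
    show "summable (f \<circ> h)"
    proof (rule summable_comparison_test)
      have "f (h n) \<le> inverse (real (Suc n) ^ 2) * C" for n
      proof -
        have "(of_int (h n))\<^sup>2 = (real (Suc n))\<^sup>2"
          using h[of n] by (metis of_int_abs of_int_of_nat_eq power2_abs)
        then show ?thesis using bnd[of "h n"] by (simp add: field_simps)
      qed
      then show "\<exists>N. \<forall>n\<ge>N. norm ((f \<circ> h) n) \<le> inverse (real (Suc n) ^ 2) * C"
        using pos by (auto simp: abs_of_nonneg)
      show "summable (\<lambda>n. inverse (real (Suc n) ^ 2) * C)" using s by (subst summable_Suc_iff)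
    qed
  qed (use pos in auto)
  have "f summable_on range (\<lambda>n. int (Suc n))"
    by (subst summable_on_reindex) (auto simp: inj_on_def intro: *)
  moreover have "f summable_on range (\<lambda>n. - int (Suc n))"
    by (subst summable_on_reindex) (auto simp: inj_on_def intro: *)
  ultimately have "f summable_on range (\<lambda>n. int (Suc n)) \<union> range (\<lambda>n. - int (Suc n))"
    by (rule summable_on_Un_disjoint) auto
  then have "f summable_on (range (\<lambda>n. int (Suc n)) \<union> range (\<lambda>n. - int (Suc n))) \<union> {0}"
    by (rule summable_on_Un_disjoint) auto
  moreover have "range (\<lambda>n. int (Suc n)) \<union> range (\<lambda>n. - int (Suc n)) \<union> {0} = UNIV"
  proof (intro set_eqI iffI UNIV_I)
    fix k :: int
    show "k \<in> range (\<lambda>n. int (Suc n)) \<union> range (\<lambda>n. - int (Suc n)) \<union> {0}"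
      by (cases k rule: int_cases3) (auto simp: image_iff gr0_conv_Suc)
  qed
  ultimately show ?thesis by simp
qed

text \<open>The tail is bounded on arbitrary finite sets avoiding \<open>H\<close>, which is the
  form in which Schur's test needs it.\<close>

lemma summable_on_finite_tail:
  fixes f :: "'a \<Rightarrow> real"
  assumes f: "f summable_on UNIV" "\<And>x. f x \<ge> 0" and "\<eta> > 0"
  obtains H where "finite H" "\<And>F. finite F \<Longrightarrow> F \<inter> H = {} \<Longrightarrow> sum f F \<le> \<eta>"
proof -
  have "(sum f \<longlongrightarrow> infsum f UNIV) (finite_subsets_at_top UNIV)"
    using has_sum_infsum[OF f(1)] by (simp add: has_sum_def)
  from tendstoD[OF this, of \<eta>] obtain H where H: "finite H" "dist (sum f H) (infsum f UNIV) < \<eta>"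
    using \<open>\<eta> > 0\<close> by (auto simp: eventually_finite_subsets_at_top)
  show ?thesis
  proof (rule that[OF H(1)])
    fix F assume F: "finite F" "F \<inter> H = {}"
    have "sum f F + sum f H = sum f (F \<union> H)" using F H(1) by (simp add: sum.union_disjoint)
    also have "\<dots> \<le> infsum f UNIV" using F H(1) f by (intro finite_sum_le_infsum) auto
    finally show "sum f F \<le> \<eta>" using H(2) by (simp add: dist_real_def)
  qed
qed

text \<open>Each of the \<open>B\<close> cells of width \<open>h\<close> contributes at most
  \<open>K h^2\<close>. A Lipschitz bound is the right regularity, because the positive part of
  \<open>x + u\<close> has corners but a Lipschitz constant independent of \<open>x\<close>.\<close>

lemma riemann_sum_error:
  fixes f :: "real \<Rightarrow> real"
  assumes "B > 0" and lip: "\<And>x y. \<bar>f x - f y\<bar> \<le> K * \<bar>x - y\<bar>"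
  shows "\<bar>(\<Sum>r<B. f (node B r)) / real B - (\<integral>x. f x \<partial>torus) / (2 * pi)\<bar> \<le> 2 * pi * K / real B"
proof -
  have K0: "K \<ge> 0" using lip[of 1 0] by (simp add: order.trans[OF abs_ge_zero])
  have "continuous_on UNIV f"
    by (rule lipschitz_on_continuous_on[of K]) (auto intro!: lipschitz_onI lip K0 simp: dist_real_def)
  then have cont: "continuous_on S f" for S by (rule continuous_on_subset) simp
  define h where "h = 2 * pi / real B"
  have h: "h > 0" "real B * h = 2 * pi" using assms(1) by (auto simp: h_def)
  have node: "node B r = real r * h" for r by (simp add: node_def h_def)
  have "\<bar>integral {0..real m * h} f - (\<Sum>r<m. h * f (node B r))\<bar> \<le> real m * (K * h * h)" for m
  proof (induction m)
    case (Suc m)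
    define a where "a = real m * h"
    have ab: "0 \<le> a" "a \<le> a + h" "real (Suc m) * h = a + h" using h by (auto simp: a_def algebra_simps)
    have "integral {0..a} f + integral {a..a+h} f = integral {0..a+h} f"
      by (rule Henstock_Kurzweil_Integration.integral_combine)
        (use ab in \<open>auto intro!: integrable_continuous_real cont\<close>)
    moreover have "\<bar>integral {a..a+h} f - h * f a\<bar> \<le> K * h * h"
    proof -
      have "integral {a..a+h} f - h * f a = integral {a..a+h} (\<lambda>x. f x - f a)"
        using h by (subst integral_diff) (auto intro!: integrable_continuous_real cont)
      also have "norm \<dots> \<le> (K * h) * (a + h - a)"
      proof (rule integral_bound)
        fix t assume "t \<in> {a..a+h}"
        then have "K * \<bar>t - a\<bar> \<le> K * h" using K0 by (intro mult_left_mono) auto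
        then show "norm (f t - f a) \<le> K * h" using lip[of t a] by simp
      qed (use h in \<open>auto intro!: continuous_intros cont\<close>)
      finally show ?thesis by simp
    qed
    moreover have "(\<Sum>r<Suc m. h * f (node B r)) = (\<Sum>r<m. h * f (node B r)) + h * f a"
      by (simp add: node a_def)
    moreover have "real (Suc m) * (K * h * h) = real m * (K * h * h) + K * h * h"
      by (simp add: algebra_simps)
    ultimately show ?case using Suc.IH unfolding ab(3) a_def[symmetric] by linarith
  qed simp
  moreover have "real B * (K * h * h) = 2 * pi * (K * h)" unfolding h(2)[symmetric] by (simp only: mult_ac)
  ultimately have "\<bar>integral {0..2*pi} f - h * (\<Sum>r<B. f (node B r))\<bar> \<le> 2 * pi * (K * h)"
    unfolding sum_distrib_left using h(2) by metis
  moreover have "(\<integral>x. f x \<partial>torus) = integral {0..2*pi} f"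
  proof -
    have "set_integrable lborel {0..2*pi} f"
      using integrable_torus_continuous[OF cont] by (simp add: integrable_torus_iff set_integrable_def)
    from set_borel_integral_eq_integral(2)[OF this] show ?thesis
      by (simp add: integral_torus_eq set_lebesgue_integral_def)
  qed
  ultimately have 1: "\<bar>(\<integral>x. f x \<partial>torus) - h * (\<Sum>r<B. f (node B r))\<bar> \<le> 2 * pi * (K * h)" by simp
  have "(\<Sum>r<B. f (node B r)) / real B - (\<integral>x. f x \<partial>torus) / (2 * pi)
    = - ((\<integral>x. f x \<partial>torus) - h * (\<Sum>r<B. f (node B r))) / (2 * pi)"
    using assms(1) by (simp add: h_def field_simps)
  also have "\<bar>\<dots>\<bar> = \<bar>(\<integral>x. f x \<partial>torus) - h * (\<Sum>r<B. f (node B r))\<bar> / (2 * pi)"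
    by (simp only: abs_divide abs_minus_cancel) simp
  also have "\<dots> \<le> 2 * pi * (K * h) / (2 * pi)" using 1 by (intro divide_right_mono) auto
  also have "\<dots> = 2 * pi * K / real B" by (simp add: h_def)
  finally show ?thesis .
qed

section \<open>Periodic functions and the Fourier series of \<open>u\<close>\<close>

lemma periodic_int:
  fixes u :: "real \<Rightarrow> 'a"
  assumes u_periodic: "\<And>x. u (x + 2 * pi) = u x"
  shows "u (x + 2 * pi * of_int n) = u x"
proof (induction n rule: int_induct[of _ 0])
  case (step1 i)
  then show ?case using u_periodic[of "x + 2 * pi * of_int i"] by (simp add: algebra_simps)
next
  case (step2 i)
  then show ?case using u_periodic[of "x + 2 * pi * of_int (i - 1)"] by (simp add: algebra_simps)
qed simp

lemma periodic_reduce: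
  fixes x :: real
  obtains y and n :: int where "y \<in> {0..<2*pi}" "x = y + 2 * pi * of_int n"
proof -
  define n where "n = \<lfloor>x / (2 * pi)\<rfloor>"
  have "of_int n \<le> x / (2 * pi)" "x / (2 * pi) < of_int n + 1" by (auto simp: n_def)
  then have "of_int n * (2 * pi) \<le> x" "x < (of_int n + 1) * (2 * pi)"
    using pi_gt_zero by (auto simp: pos_le_divide_eq pos_divide_less_eq)
  then show ?thesis using that[of "x - 2 * pi * of_int n" n] by (auto simp: algebra_simps)
qed

lemma periodic_bounded:
  fixes v :: "real \<Rightarrow> real"
  assumes "\<And>x. v (x + 2 * pi) = v x" "continuous_on UNIV v"
  obtains C where "C > 0" "\<And>x. \<bar>v x\<bar> \<le> C"
proof -
  have "bounded (v ` {0..2*pi})"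
    by (intro compact_imp_bounded compact_continuous_image continuous_on_subset[OF assms(2)]) auto
  then obtain C where C: "C > 0" "\<And>x. x \<in> {0..2*pi} \<Longrightarrow> \<bar>v x\<bar> \<le> C"
    by (auto simp: bounded_pos)
  have "\<bar>v x\<bar> \<le> C" for x
  proof -
    obtain y n where "y \<in> {0..<2*pi}" "x = y + 2 * pi * of_int n" by (rule periodic_reduce)
    then show ?thesis using C(2)[of y] periodic_int[of v y n] assms(1) by auto
  qed
  then show ?thesis using C(1) that by blast
qed

lemma deriv_periodic:
  fixes v :: "real \<Rightarrow> real"
  assumes u_periodic: "\<And>x. v (x + 2 * pi) = v x" and d: "\<And>x. v differentiable (at x)"
  shows "deriv v (x + 2 * pi) = deriv v x"
proof -
  have "(v has_field_derivative deriv v (x + 2 * pi)) (at (x + 2 * pi))"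
    using d by (simp add: DERIV_deriv_iff_real_differentiable)
  then have "((\<lambda>x. v (x + 2 * pi)) has_field_derivative deriv v (x + 2 * pi)) (at x)"
    by (simp add: DERIV_shift)
  then show ?thesis by (simp add: u_periodic DERIV_imp_deriv)
qed

definition u_coeff :: "(real \<Rightarrow> real) \<Rightarrow> int \<Rightarrow> complex" where
  "u_coeff u = fourier_coeff (\<lambda>x. of_real (u x))"

context
  fixes u :: "real \<Rightarrow> real"
  assumes C3: "C3_periodic u"
begin

lemma u_periodic: "u (x + 2 * pi) = u x"
  using C3 by (simp add: C3_periodic_def)

lemma deriv_u: "j < 3 \<Longrightarrow> ((deriv ^^ j) u has_field_derivative (deriv ^^ Suc j) u x) (at x)"
  using C3 by (simp add: C3_periodic_def DERIV_deriv_iff_real_differentiable)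

lemma continuous_deriv_u: "j \<le> 3 \<Longrightarrow> continuous_on UNIV ((deriv ^^ j) u)"
proof (cases "j = 3")
  case False
  assume "j \<le> 3"
  then show ?thesis using deriv_u[of j] False
    by (intro continuous_at_imp_continuous_on ballI) (auto intro: DERIV_isCont)
qed (use C3 in \<open>simp add: C3_periodic_def\<close>)

lemma per_deriv_u: "j \<le> 3 \<Longrightarrow> (deriv ^^ j) u (x + 2 * pi) = (deriv ^^ j) u x"
proof (induction j arbitrary: x)
  case (Suc j)
  have "deriv ((deriv ^^ j) u) (x + 2 * pi) = deriv ((deriv ^^ j) u) x"
    using Suc C3 by (intro deriv_periodic) (auto simp: C3_periodic_def)
  then show ?case by simp
qed (simp add: u_periodic)

lemma continuous_u: "continuous_on S u"
  by (rule continuous_on_subset[of UNIV]) (use continuous_deriv_u[of 0] in simp_all)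

lemma continuous_u_complex: "continuous_on S (\<lambda>x. complex_of_real (u x))"
  by (intro continuous_intros continuous_u)

lemma u_bounded: obtains U where "U > 0" "\<And>x. \<bar>u x\<bar> \<le> U"
  using periodic_bounded[OF u_periodic continuous_u] by blast

lemma u_lipschitz: obtains K where "K > 0" "\<And>x y. \<bar>u x - u y\<bar> \<le> K * \<bar>x - y\<bar>"
proof -
  obtain K where K: "K > 0" "\<And>x. \<bar>(deriv ^^ 1) u x\<bar> \<le> K"
    using periodic_bounded[OF per_deriv_u[of 1] continuous_deriv_u[of 1]] by auto
  have "\<bar>u x - u y\<bar> \<le> K * \<bar>x - y\<bar>" for x y
    using field_differentiable_bound[of UNIV u "(deriv ^^ 1) u" K x y] deriv_u[of 0] K(2) by simp
  then show ?thesis using that K(1) by blast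
qed

lemma u_coeff_deriv:
  "j \<le> 3 \<Longrightarrow> fourier_coeff (\<lambda>x. of_real ((deriv ^^ j) u x)) k = (\<i> * of_int k) ^ j * u_coeff u k"
proof (induction j)
  case (Suc j)
  have "fourier_coeff (\<lambda>x. of_real ((deriv ^^ Suc j) u x)) k
    = \<i> * of_int k * fourier_coeff (\<lambda>x. of_real ((deriv ^^ j) u x)) k"
  proof (rule fourier_coeff_deriv)
    show "((\<lambda>x. complex_of_real ((deriv ^^ j) u x)) has_vector_derivative of_real ((deriv ^^ Suc j) u x))
      (at x)" for x
      using deriv_u[of j x] Suc.prems has_vector_derivative_of_real
      by (metis Suc_le_lessD)
    show "continuous_on UNIV (\<lambda>x. complex_of_real ((deriv ^^ Suc j) u x))"
      by (intro continuous_intros continuous_deriv_u Suc.prems)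
    show "complex_of_real ((deriv ^^ j) u (2 * pi)) = of_real ((deriv ^^ j) u 0)"
      using per_deriv_u[of j 0] Suc.prems by simp
  qed
  then show ?case using Suc by simp
qed (simp add: u_coeff_def)

lemma u_coeff_decay: obtains C where "C > 0" "\<And>k. \<bar>of_int k\<bar> ^ 3 * cmod (u_coeff u k) \<le> C"
proof -
  have "continuous_on UNIV (\<lambda>x. complex_of_real ((deriv ^^ 3) u x))"
    by (intro continuous_intros continuous_deriv_u) simp
  then obtain C where C: "C > 0" "\<And>k. cmod (fourier_coeff (\<lambda>x. of_real ((deriv ^^ 3) u x)) k) \<le> C"
    using fourier_coeff_bounded by blast
  have "\<bar>of_int k\<bar> ^ 3 * cmod (u_coeff u k) \<le> C" for k
    using C(2)[of k] unfolding u_coeff_deriv[OF order_refl] by (simp add: norm_mult norm_power)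
  then show ?thesis using that C(1) by blast
qed

text \<open>Three derivatives give coefficients of order \<open>k^-3\<close>; the weight spends one
  power and leaves a summable \<open>k^-2\<close>. The weight lets \<open>eigenvector_decay\<close>
  carry a factor \<open>1 + j\<close> through the convolution.\<close>

lemma u_coeff_weighted_summable: "(\<lambda>k. (1 + \<bar>of_int k\<bar>) * cmod (u_coeff u k)) summable_on UNIV"
proof -
  obtain C where C: "C > 0" "\<And>k. \<bar>of_int k\<bar> ^ 3 * cmod (u_coeff u k) \<le> C" using u_coeff_decay by blast
  show ?thesis
  proof (rule summable_on_int_inverse_square[where C = "2 * C"])
    fix k :: int
    have "(1 + \<bar>of_int k\<bar>) * \<bar>of_int k :: real\<bar>\<^sup>2 \<le> 2 * \<bar>of_int k\<bar> ^ 3"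
    proof (cases "k = 0")
      case False
      then have "1 \<le> \<bar>of_int k :: real\<bar>" by linarith
      then have "(1 + \<bar>of_int k\<bar>) * \<bar>of_int k :: real\<bar>\<^sup>2 \<le> (2 * \<bar>of_int k\<bar>) * \<bar>of_int k :: real\<bar>\<^sup>2"
        by (intro mult_right_mono) auto
      then show ?thesis by (simp add: power3_eq_cube power2_eq_square mult.assoc)
    qed simp
    then have "(1 + \<bar>of_int k\<bar>) * \<bar>of_int k :: real\<bar>\<^sup>2 * cmod (u_coeff u k) \<le> 2 * \<bar>of_int k\<bar> ^ 3
      * cmod (u_coeff u k)"
      by (rule mult_right_mono) simp
    then show "(1 + \<bar>of_int k\<bar>) * cmod (u_coeff u k) * (of_int k)\<^sup>2 \<le> 2 * C"
      using C(2)[of k] by (simp add: mult_ac)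
  qed simp
qed

lemma u_coeff_summable: "(\<lambda>k. cmod (u_coeff u k)) summable_on UNIV"
proof (rule summable_on_comparison_test[OF u_coeff_weighted_summable])
  show "cmod (u_coeff u k) \<le> (1 + \<bar>of_int k\<bar>) * cmod (u_coeff u k)" for k
    by (simp add: distrib_right)
qed auto

lemma u_coeff_cnj: "u_coeff u (- k) = cnj (u_coeff u k)"
proof -
  have "cnj (\<integral>x. of_real (u x) * mode (- k) x \<partial>torus) = (\<integral>x. cnj (of_real (u x) * mode (- k) x) \<partial>torus)"
    by (rule Bochner_Integration.integral_cnj[symmetric])
  then show ?thesis by (simp add: u_coeff_def fourier_coeff_mode cnj_mode)
qed

lemma summable_u_coeff_decode: "summable (\<lambda>n. cmod (u_coeff u (int_decode n)))"
proof -
  have "(\<lambda>n. cmod (u_coeff u (int_decode n))) summable_on UNIV"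
    using u_coeff_summable bij_int_decode by (subst summable_on_reindex_bij_betw[of int_decode UNIV UNIV])
  then show ?thesis by (rule summable_on_imp_summable)
qed

text \<open>Equal coefficients give equality almost everywhere; continuity improves this to all
  interior points of the period, a right limit handles 0, and periodicity the rest.\<close>

lemma u_fourier_series: "trig_series (\<lambda>n. u_coeff u (int_decode n)) int_decode x = of_real (u x)"
proof -
  define s where "s = trig_series (\<lambda>n. u_coeff u (int_decode n)) int_decode"
  note sm = summable_u_coeff_decode
  have sc: "continuous_on UNIV s" unfolding s_def by (rule continuous_trig_series[OF sm])
  have coeff: "fourier_coeff s k = u_coeff u k" for k
    using fourier_coeff_trig_series_in[OF sm inj_int_decode, of "int_encode k"] by (simp add: s_def)
  have "AE x in torus. s x = of_real (u x)"
    by (rule AE_eq_if_fourier_coeff_eq) (use integrable_trig_series[OF sm] coeff in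
      \<open>auto simp: s_def u_coeff_def intro!: integrable_torus_continuous continuous_u_complex\<close>)
  then have inner: "s y = of_real (u y)" if "y \<in> {0<..<2*pi}" for y
    using AE_torus_continuous_eq[OF _ sc continuous_u_complex that] by blast
  have at0: "s 0 = of_real (u 0)"
  proof (rule tendsto_unique)
    show "(s \<longlongrightarrow> s 0) (at_right 0)"
      using sc by (metis UNIV_I continuous_on_def tendsto_within_subset subset_UNIV)
    have "((\<lambda>x. complex_of_real (u x)) \<longlongrightarrow> of_real (u 0)) (at_right 0)"
      using continuous_u_complex[of UNIV]
        by (metis UNIV_I continuous_on_def tendsto_within_subset subset_UNIV)
    moreover have "\<forall>\<^sub>F x in at_right 0. complex_of_real (u x) = s x"
      using inner by (auto simp: eventually_at_right_field intro!: exI[of _ "2 * pi"])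
    ultimately show "(s \<longlongrightarrow> of_real (u 0)) (at_right 0)" by (rule Lim_transform_eventually)
  qed simp
  obtain y n where y: "y \<in> {0..<2*pi}" "x = y + 2 * pi * of_int n" by (rule periodic_reduce)
  have sper: "s (z + 2 * pi) = s z" for z
  proof -
    have "mode k (z + 2 * pi) = mode k z" for k
      using mode_2pi[of k] by (simp add: mode_def distrib_left cis_mult[symmetric])
    then show ?thesis by (simp add: s_def trig_series_def)
  qed
  have "s x = s y" "u x = u y" using y(2) periodic_int[of s] periodic_int[of u] sper u_periodic by auto
  moreover have "s y = of_real (u y)" using inner[of y] at0 y(1) by (cases "y = 0") auto
  ultimately show ?thesis by (simp add: s_def)
qed

text \<open>One \<open>M\<close> serves both claims, because the remainder of the Fourier series is
  itself bounded by sums of coefficients beyond \<open>M\<close>.\<close>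

lemma u_truncation:
  assumes "\<eta> > 0"
  shows "\<exists>M. (\<forall>F. finite F \<longrightarrow> (\<forall>l\<in>F. \<bar>l\<bar> > int M) \<longrightarrow> (\<Sum>l\<in>F. cmod (u_coeff u l)) \<le> \<eta>)
       \<and> (\<forall>\<theta>. \<bar>Re (trig_poly (u_coeff u) M \<theta>) - u \<theta>\<bar> \<le> \<eta>)"
proof -
  define c where "c = u_coeff u"
  obtain H where H: "finite H" "\<And>F. finite F \<Longrightarrow> F \<inter> H = {} \<Longrightarrow> (\<Sum>l\<in>F. cmod (c l)) \<le> \<eta>"
    using summable_on_finite_tail[OF u_coeff_summable _ assms] unfolding c_def by auto
  define M where "M = nat (Max (insert 0 (abs ` H)))"
  have "\<bar>l\<bar> \<le> int M" if "l \<in> H" for l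
  proof -
    have "\<bar>l\<bar> \<le> Max (insert 0 (abs ` H))" using that H(1) by (intro Max_ge) auto
    moreover have "0 \<le> Max (insert 0 (abs ` H))" using H(1) by (intro Max_ge) auto
    ultimately show ?thesis unfolding M_def by linarith
  qed
  then have tail: "(\<Sum>l\<in>F. cmod (c l)) \<le> \<eta>" if "finite F" "\<forall>l\<in>F. \<bar>l\<bar> > int M" for F
    using that by (intro H(2)) force+
  have "\<bar>Re (trig_poly c M \<theta>) - u \<theta>\<bar> \<le> \<eta>" for \<theta>
  proof -
    define f where "f k = c k * mode k \<theta>" for k
    have "summable (\<lambda>n. f (int_decode n))"
      by (rule summable_norm_cancel) (use summable_u_coeff_decode in \<open>simp add: f_def c_def norm_mult\<close>)
    then have "(\<lambda>N. \<Sum>n<N. f (int_decode n)) \<longlonglongrightarrow> of_real (u \<theta>)"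
      using u_fourier_series[of \<theta>] summable_LIMSEQ[of "\<lambda>n. f (int_decode n)"]
        by (simp add: trig_series_def f_def c_def)
    then have lim: "(\<lambda>N. cmod ((\<Sum>n<N. f (int_decode n)) - trig_poly c M \<theta>))
      \<longlonglongrightarrow> cmod (of_real (u \<theta>) - trig_poly c M \<theta>)"
      by (intro tendsto_intros)
    \<comment> \<open>From \<open>N0\<close> on, the partial sum in the order of
      \<open>int_decode\<close> contains all frequencies up to \<open>M\<close>, so that the
      difference consists of tail terms only.\<close>
    define N0 where "N0 = Suc (Max (int_encode ` {- int M..int M}))"
    have "cmod ((\<Sum>n<N. f (int_decode n)) - trig_poly c M \<theta>) \<le> \<eta>" if "N \<ge> N0" for N
    proof -
      have sub: "{- int M..int M} \<subseteq> int_decode ` {..<N}"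
      proof
        fix l assume l: "l \<in> {- int M..int M}"
        then have "int_encode l \<le> Max (int_encode ` {- int M..int M})" by (intro Max_ge) auto
        then have "int_encode l < N" using that by (simp add: N0_def)
        then show "l \<in> int_decode ` {..<N}" by (intro image_eqI[of _ _ "int_encode l"]) auto
      qed
      have "(\<Sum>n<N. f (int_decode n)) = sum f (int_decode ` {..<N})"
        by (subst sum.reindex) (auto intro: inj_on_subset[OF inj_int_decode])
      moreover have "trig_poly c M \<theta> = sum f {- int M..int M}" by (simp add: trig_poly_def f_def mode_def)
      ultimately have "(\<Sum>n<N. f (int_decode n)) - trig_poly c M \<theta>
        = sum f (int_decode ` {..<N} - {- int M..int M})"
        using sub by (simp add: sum_diff)
      also have "cmod \<dots> \<le> (\<Sum>l\<in>int_decode ` {..<N} - {- int M..int M}. cmod (c l))"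
        by (rule order.trans[OF norm_sum]) (simp add: f_def norm_mult)
      also have "\<dots> \<le> \<eta>" by (intro tail) auto
      finally show ?thesis .
    qed
    then have "cmod (of_real (u \<theta>) - trig_poly c M \<theta>) \<le> \<eta>"
      by (intro LIMSEQ_le_const2[OF lim]) blast
    then show ?thesis using abs_Re_le_cmod[of "of_real (u \<theta>) - trig_poly c M \<theta>"] by simp
  qed
  then show ?thesis using tail unfolding c_def by blast
qed

lemma lax_matrix_u: "(LBINT x:{0..2*pi}. u x) = 0 \<Longrightarrow> \<epsilon> > 0 \<Longrightarrow> lax_matrix (u_coeff u) \<epsilon>"
proof (unfold_locales)
  assume mean: "(LBINT x:{0..2*pi}. u x) = 0"
  have "(\<integral>x. u x \<partial>torus) = 0" using mean by (simp add: integral_torus_eq set_lebesgue_integral_def)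
  then show "u_coeff u 0 = 0" by (simp add: u_coeff_def fourier_coeff_mode)
qed (use u_coeff_summable u_coeff_cnj in auto)

end

section \<open>Eigenvalues of the Lax operator\<close>

text \<open>Column sums of the coefficients are at most \<open>D\<close>, so summing over the rows
  first costs only that factor. The injection \<open>p\<close> selects the rows: the nonnegative
  modes, or the negative ones that the projection removes.\<close>

lemma summable_convolution:
  fixes a :: "nat \<Rightarrow> complex" and c :: "int \<Rightarrow> complex"
  assumes a: "summable (\<lambda>n. cmod (a n))" and c: "(\<lambda>k. cmod (c k)) summable_on UNIV" and p: "inj
    (p :: nat \<Rightarrow> int)"
  shows "summable (\<lambda>i. cmod (\<Sum>n. c (p i - int n) * a n))"
proof (rule summableI_nonneg_bounded)
  fix N
  define D where "D = (\<Sum>\<^sub>\<infinity>k. cmod (c k))"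
  have cD: "sum (\<lambda>k. cmod (c k)) F \<le> D" if "finite F" for F
    unfolding D_def using that c by (intro finite_sum_le_infsum) auto
  have s: "summable (\<lambda>n. cmod (c (p i - int n)) * cmod (a n))" for i
  proof (rule summable_comparison_test)
    show "\<exists>N. \<forall>n\<ge>N. norm (cmod (c (p i - int n)) * cmod (a n)) \<le> D * cmod (a n)"
      using cD[of "{p i - int n}" for n] by (auto intro!: mult_right_mono)
    show "summable (\<lambda>n. D * cmod (a n))" using a by (rule summable_mult)
  qed
  have "(\<Sum>i<N. cmod (\<Sum>n. c (p i - int n) * a n)) \<le> (\<Sum>i<N. \<Sum>n. cmod (c (p i - int n)) * cmod (a n))"
  proof (rule sum_mono)
    show "cmod (\<Sum>n. c (p i - int n) * a n) \<le> (\<Sum>n. cmod (c (p i - int n)) * cmod (a n))" for i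
      using summable_norm[of "\<lambda>n. c (p i - int n) * a n"] s[of i] by (simp add: norm_mult)
  qed
  also have "\<dots> = (\<Sum>n. \<Sum>i<N. cmod (c (p i - int n)) * cmod (a n))"
    by (rule suminf_sum[symmetric]) (rule s)
  also have "\<dots> \<le> (\<Sum>n. D * cmod (a n))"
  proof (rule suminf_le)
    fix n
    have "(\<Sum>i<N. cmod (c (p i - int n))) \<le> D"
      by (rule sum_inj_le[of "\<lambda>k. cmod (c k)", OF cD]) (use p in \<open>auto simp: inj_on_def inj_def\<close>)
    then show "(\<Sum>i<N. cmod (c (p i - int n)) * cmod (a n)) \<le> D * cmod (a n)"
      by (simp add: sum_distrib_right[symmetric] mult_right_mono)
  qed (use a s in \<open>auto intro!: summable_sum summable_mult\<close>)
  finally show "(\<Sum>i<N. cmod (\<Sum>n. c (p i - int n) * a n)) \<le> (\<Sum>n. D * cmod (a n))" .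
qed simp

text \<open>As \<open>szego\<close> is a choice, a witness is required first. Summability makes both
  halves of \<open>f\<close> explicit continuous functions, and the half with negative modes is
  orthogonal to the Hardy space. Whatever is chosen is then identified by testing against the
  modes.\<close>

lemma szego_fourier_coeff:
  assumes f: "f \<in> L2_torus"
    and pos: "summable (\<lambda>n. cmod (fourier_coeff f (int n)))"
    and neg: "summable (\<lambda>n. cmod (fourier_coeff f (- int (Suc n))))"
  shows "szego f \<in> L2_plus" and "k \<ge> 0 \<Longrightarrow> fourier_coeff (szego f) k = fourier_coeff f k"
proof -
  define q where "q n = - int (Suc n)" for n
  have injq: "inj q" by (auto simp: q_def inj_def)
  define g where "g = trig_series (\<lambda>n. fourier_coeff f (int n)) int"
  define r where "r = trig_series (\<lambda>n. fourier_coeff f (q n)) q"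
  have neg': "summable (\<lambda>n. cmod (fourier_coeff f (q n)))" using neg by (simp add: q_def)
  have gL2: "g \<in> L2_torus" unfolding g_def
    by (rule L2_bounded[OF measurable_trig_series[OF pos] trig_series_bound[OF pos]])
  have g_coeff: "fourier_coeff g k = (if k \<ge> 0 then fourier_coeff f k else 0)" for k
  proof (cases "k \<ge> 0")
    case True
    then show ?thesis using fourier_coeff_trig_series_in[OF pos, of int "nat k"] by (simp add: g_def)
  next
    case False
    then show ?thesis using fourier_coeff_trig_series_notin[OF pos, of k int] by (auto simp: g_def image_iff)
  qed
  have r_coeff: "fourier_coeff r k = (if k \<ge> 0 then 0 else fourier_coeff f k)" for k
  proof (cases "k \<ge> 0")
    case True
    then show ?thesis using fourier_coeff_trig_series_notin[OF neg', of k q]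
      by (auto simp: r_def q_def image_iff)
  next
    case False
    then have "q (nat (- k - 1)) = k" by (simp add: q_def)
    then show ?thesis using False fourier_coeff_trig_series_in[OF neg' injq, of "nat (- k - 1)"]
      by (simp add: r_def)
  qed
  have diff: "AE x in torus. f x - g x = r x"
  proof (rule AE_eq_if_fourier_coeff_eq)
    show "integrable torus (\<lambda>x. f x - g x)" using f gL2 by (simp add: L2_integrable)
    show "integrable torus r" unfolding r_def by (rule integrable_trig_series[OF neg'])
    show "fourier_coeff (\<lambda>x. f x - g x) k = fourier_coeff r k" for k
      using fourier_coeff_diff[OF L2_integrable[OF f] L2_integrable[OF gL2]] by (simp add: g_coeff r_coeff)
  qed
  have orth: "L2_inner (\<lambda>x. f x - g x) h = 0" if "h \<in> L2_plus" for h
  proof -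
    have h: "h \<in> L2_torus" "\<And>k. k < 0 \<Longrightarrow> fourier_coeff h k = 0" using that by (auto simp: L2_plus_def)
    have hc: "integrable torus (\<lambda>x. cnj (h x))" using L2_integrable[OF h(1)] by (rule integrable_cnj)
    have "L2_inner (\<lambda>x. f x - g x) h = (\<integral>x. cnj (h x) * r x \<partial>torus)"
      unfolding L2_inner_def
    proof (rule integral_cong_AE)
      show "(\<lambda>x. (f x - g x) * cnj (h x)) \<in> borel_measurable torus"
        using L2_mult_integrable[OF L2_diff[OF f gL2] h(1)] by simp
      show "(\<lambda>x. cnj (h x) * r x) \<in> borel_measurable torus"
        unfolding r_def by (intro borel_measurable_times measurable_trig_series[OF neg']
          borel_measurable_integrable[OF hc])
      show "AE x in torus. (f x - g x) * cnj (h x) = cnj (h x) * r x"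
        using diff by eventually_elim simp
    qed
    moreover have "(\<lambda>n. fourier_coeff f (q n) * (\<integral>x. cnj (h x) * mode (q n) x \<partial>torus))
      sums (\<integral>x. cnj (h x) * r x \<partial>torus)"
      unfolding r_def by (rule integral_mult_trig_series[OF neg' hc])
    moreover have "(\<integral>x. cnj (h x) * mode (q n) x \<partial>torus) = 0" for n
    proof -
      have "(\<integral>x. cnj (h x) * mode (q n) x \<partial>torus) = (\<integral>x. cnj (h x * mode (- q n) x) \<partial>torus)"
        by (simp add: cnj_mode)
      also have "\<dots> = cnj (\<integral>x. h x * mode (- q n) x \<partial>torus)"
        by (rule Bochner_Integration.integral_cnj)
      also have "(\<integral>x. h x * mode (- q n) x \<partial>torus) = 0"
        using h(2)[of "q n"] by (simp add: fourier_coeff_mode q_def)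
      finally show ?thesis by simp
    qed
    ultimately show ?thesis by (simp add: sums_unique2[OF _ sums_zero])
  qed
  have ex: "\<exists>g. g \<in> L2_plus \<and> (\<forall>h\<in>L2_plus. L2_inner (\<lambda>x. f x - g x) h = 0)"
    using orth gL2 g_coeff by (intro exI[of _ g]) (simp add: L2_plus_def)
  have sz: "szego f \<in> L2_plus" "\<forall>h\<in>L2_plus. L2_inner (\<lambda>x. f x - szego f x) h = 0"
    using someI_ex[OF ex] by (auto simp: szego_def)
  show "szego f \<in> L2_plus" by (rule sz)
  have szL2: "szego f \<in> L2_torus" using sz(1) by (simp add: L2_plus_def)
  assume "k \<ge> 0"
  have "fourier_coeff (mode k) j = of_bool (j = k)" for j
  proof -
    have "(\<integral>x. mode k x * mode (- j) x \<partial>torus) = of_bool (j = k) * of_real (2 * pi)"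
      unfolding mode_add[symmetric] integral_mode by auto
    then show ?thesis by (simp add: fourier_coeff_mode)
  qed
  then have "mode k \<in> L2_plus" using \<open>k \<ge> 0\<close> L2_mode by (simp add: L2_plus_def)
  then have "L2_inner (\<lambda>x. f x - szego f x) (mode k) = 0" using sz(2) by blast
  then have "fourier_coeff (\<lambda>x. f x - szego f x) k = 0"
    by (simp add: fourier_coeff_mode L2_inner_def cnj_mode)
  then show "fourier_coeff (szego f) k = fourier_coeff f k"
    using fourier_coeff_diff[OF L2_integrable[OF f] L2_integrable[OF szL2]] by simp
qed

lemma is_weak_deriv_weak_deriv: "h \<in> H1_plus \<Longrightarrow> is_weak_deriv h (weak_deriv h)"
  unfolding weak_deriv_def H1_plus_def using someI_ex[of "is_weak_deriv h"] by blast

text \<open>With \<open>t\<close> the modulus of the \<open>n\<close>-th coefficient,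
  \<open>t \<le> n^-2 + n^2 t^2\<close> by the inequality of the means, and Bessel for the
  derivative sums the second term.\<close>

lemma H1_plus_coeff_summable:
  assumes "h \<in> H1_plus"
  shows "summable (\<lambda>n. cmod (fourier_coeff h (int n)))"
proof -
  define g where "g = weak_deriv h"
  have g: "g \<in> L2_torus" "\<And>k. fourier_coeff g k = \<i> * of_int k * fourier_coeff h k"
    using is_weak_deriv_weak_deriv[OF assms] by (auto simp: is_weak_deriv_def g_def)
  have s: "summable (\<lambda>n. (cmod (fourier_coeff g (int n)))\<^sup>2)"
  proof (rule summableI_nonneg_bounded)
    show "(\<Sum>n<N. (cmod (fourier_coeff g (int n)))\<^sup>2) \<le> (\<integral>x. (cmod (g x))\<^sup>2 \<partial>torus) / (2 * pi)" for N
      by (rule sum_inj_le[of "\<lambda>k. (cmod (fourier_coeff g k))\<^sup>2", OF bessel_inequality[OF g(1)]]) auto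
  qed simp
  show ?thesis
  proof (rule summable_comparison_test)
    have "cmod (fourier_coeff h (int n)) \<le> inverse (real n ^ 2) + (cmod (fourier_coeff g (int n)))\<^sup>2" if "n
      \<ge> 1" for n
    proof -
      define t where "t = cmod (fourier_coeff h (int n))"
      have "cmod (fourier_coeff g (int n)) = real n * t" by (simp add: g(2) norm_mult t_def)
      moreover have "2 * (inverse (real n) * (real n * t)) \<le> (inverse (real n))\<^sup>2 + (real n * t)\<^sup>2"
        using sum_squares_bound[of "inverse (real n)" "real n * t"] by (simp only: mult.assoc)
      moreover have "inverse (real n) * (real n * t) = t" using that by simp
      moreover have "t \<ge> 0" by (simp add: t_def)
      ultimately have "t \<le> (inverse (real n))\<^sup>2 + (cmod (fourier_coeff g (int n)))\<^sup>2" by simp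
      then show ?thesis by (simp add: t_def power_inverse)
    qed
    then show "\<exists>N. \<forall>n\<ge>N. norm (cmod (fourier_coeff h (int n)))
      \<le> inverse (real n ^ 2) + (cmod (fourier_coeff g (int n)))\<^sup>2"
      by (intro exI[of _ 1]) simp
    show "summable (\<lambda>n. inverse (real n ^ 2) + (cmod (fourier_coeff g (int n)))\<^sup>2)"
      by (intro summable_add s inverse_power_summable) simp
  qed
qed

lemma strict_mono_enumeration_unique:
  fixes f g :: "nat \<Rightarrow> real"
  assumes "strict_mono f" "strict_mono g" "range f = range g"
  shows "f = g"
proof -
  have le: "g n \<le> f n" if IH: "\<And>m. m < n \<Longrightarrow> f m = g m" and fg: "strict_mono f" "strict_mono g" "range f
    = range g"
    for f g :: "nat \<Rightarrow> real" and n
  proof -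
    obtain k where k: "f n = g k" using fg(3) by (metis rangeE rangeI)
    have "\<not> k < n"
    proof
      assume "k < n"
      then show False using IH[of k] k strict_monoD[OF fg(1), of k n] by simp
    qed
    then show ?thesis using k fg(2) by (simp add: strict_mono_less_eq)
  qed
  have "f n = g n" for n
  proof (induction n rule: less_induct)
    case (less n)
    then have "g n \<le> f n" using assms by (intro le) auto
    moreover have "f n \<le> g n" using assms less by (intro le) auto
    ultimately show ?case by simp
  qed
  then show ?thesis by blast
qed

context
  fixes u :: "real \<Rightarrow> real" and \<epsilon> :: real
  assumes C3: "C3_periodic u" and mean: "(LBINT x:{0..2*pi}. u x) = 0" and eps: "\<epsilon> > 0"
begin

interpretation lax_matrix "u_coeff u" \<epsilon>
  by (rule lax_matrix_u[OF C3 mean eps])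

text \<open>\<open>h\<close> is replaced by its absolutely convergent series, which may be
  integrated term by term against \<open>u\<close>.\<close>

lemma mult_u_coeff:
  assumes h: "h \<in> H1_plus"
  shows "fourier_coeff (\<lambda>x. of_real (u x) * h x) j = (\<Sum>n. u_coeff u (j - int n) * fourier_coeff h (int n))"
    and "(\<lambda>x. of_real (u x) * h x) \<in> L2_torus"
proof -
  define a where "a n = fourier_coeff h (int n)" for n
  have sa: "summable (\<lambda>n. cmod (a n))" unfolding a_def by (rule H1_plus_coeff_summable[OF h])
  have hL2: "h \<in> L2_torus" "\<And>k. k < 0 \<Longrightarrow> fourier_coeff h k = 0" using h by (auto simp: H1_plus_def L2_plus_def)
  have um: "(\<lambda>x. complex_of_real (u x)) \<in> borel_measurable torus"
    by (intro measurable_torusI borel_measurable_continuous_onI continuous_u_complex[OF C3])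
  obtain U where U: "\<And>x. \<bar>u x\<bar> \<le> U" using u_bounded[OF C3] by blast
  show uh: "(\<lambda>x. of_real (u x) * h x) \<in> L2_torus"
    by (rule L2_mult_bounded[OF hL2(1) um, of U]) (use U in simp)
  have "AE x in torus. h x = trig_series a int x"
  proof (rule AE_eq_if_fourier_coeff_eq)
    fix k
    show "fourier_coeff h k = fourier_coeff (trig_series a int) k"
    proof (cases "k \<ge> 0")
      case True
      then show ?thesis using fourier_coeff_trig_series_in[OF sa, of int "nat k"]
        by (simp add: a_def[abs_def])
    next
      case False
      then show ?thesis using fourier_coeff_trig_series_notin[OF sa, of k int] hL2(2)
        by (auto simp: image_iff)
    qed
  qed (auto intro: L2_integrable hL2 integrable_trig_series[OF sa])
  then have "AE x in torus. of_real (u x) * h x = of_real (u x) * trig_series a int x" by eventually_elim simp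
  then have "fourier_coeff (\<lambda>x. of_real (u x) * h x) j
    = fourier_coeff (\<lambda>x. of_real (u x) * trig_series a int x) j"
    using uh hL2(1) by (intro fourier_coeff_cong_AE borel_measurable_times measurable_trig_series[OF sa] um)
      (auto simp: L2_torus_def)
  moreover have "(\<lambda>n. u_coeff u (j - int n) * a n)
    sums fourier_coeff (\<lambda>x. of_real (u x) * trig_series a int x) j"
  proof -
    have "integrable torus (\<lambda>x. of_real (u x) * mode (- j) x)"
      by (intro integrable_torus_continuous continuous_intros continuous_u_complex[OF C3])
    from sums_divide[OF integral_mult_trig_series[OF sa this, of int], of "of_real (2 * pi)"]
    have 1: "(\<lambda>n. a n * (\<integral>x. of_real (u x) * mode (- j) x * mode (int n) x \<partial>torus) / of_real (2 * pi)) sums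
       ((\<integral>x. of_real (u x) * mode (- j) x * trig_series a int x \<partial>torus) / of_real (2 * pi))" .
    have 2: "(\<integral>x. of_real (u x) * mode (- j) x * trig_series a int x \<partial>torus) / of_real (2 * pi)
      = fourier_coeff (\<lambda>x. of_real (u x) * trig_series a int x) j"
      unfolding fourier_coeff_mode by (simp only: mult_ac)
    have 3: "a n * (\<integral>x. of_real (u x) * mode (- j) x * mode (int n) x \<partial>torus) / of_real (2 * pi)
      = u_coeff u (j - int n) * a n" for n
    proof -
      have "mode (- (j - int n)) x = mode (- j) x * mode (int n) x" for x
        unfolding mode_add[symmetric] by simp
      then show ?thesis by (simp add: u_coeff_def fourier_coeff_mode mult.assoc)
    qed
    show ?thesis using 1 unfolding 2 3 .
  qed
  ultimately show "fourier_coeff (\<lambda>x. of_real (u x) * h x) j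
    = (\<Sum>n. u_coeff u (j - int n) * fourier_coeff h (int n))"
    by (simp add: sums_iff a_def)
qed

text \<open>Translates the equation between \<open>L2\<close> classes into the infinite matrix
  equation. Uniqueness of Fourier coefficients allows testing mode by mode, and at negative modes
  both sides vanish.\<close>

lemma lax_eigen_iff:
  assumes h: "h \<in> H1_plus"
  shows "(AE x in torus. lax u \<epsilon> h x = of_real \<mu> * h x) \<longleftrightarrow>
    (\<forall>j. of_real (\<epsilon> * real j) * fourier_coeff h (int j)
      - (\<Sum>n. u_coeff u (int j - int n) * fourier_coeff h (int n))
      = of_real \<mu> * fourier_coeff h (int j))"
proof -
  define a where "a n = fourier_coeff h (int n)" for n
  define f where "f x = of_real (u x) * h x" for x
  define w where "w = weak_deriv h"
  have sa: "summable (\<lambda>n. cmod (a n))" unfolding a_def by (rule H1_plus_coeff_summable[OF h])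
  have hL2: "h \<in> L2_torus" "\<And>k. k < 0 \<Longrightarrow> fourier_coeff h k = 0" using h by (auto simp: H1_plus_def L2_plus_def)
  have fj: "fourier_coeff f j = (\<Sum>n. u_coeff u (j - int n) * a n)" for j
    using mult_u_coeff(1)[OF h] by (simp add: f_def[abs_def] a_def)
  have fL2: "f \<in> L2_torus" using mult_u_coeff(2)[OF h] by (simp add: f_def[abs_def])
  have s1: "summable (\<lambda>n. cmod (fourier_coeff f (int n)))"
    unfolding fj by (rule summable_convolution[OF sa u_coeff_summable[OF C3]]) (simp add: inj_def)
  have s2: "summable (\<lambda>n. cmod (fourier_coeff f (- int (Suc n))))"
    unfolding fj by (rule summable_convolution[OF sa u_coeff_summable[OF C3]]) (simp add: inj_def)
  note sz = szego_fourier_coeff[OF fL2 s1 s2]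
  have szL2: "szego f \<in> L2_torus" "\<And>k. k < 0 \<Longrightarrow> fourier_coeff (szego f) k = 0" using sz(1)
    by (auto simp: L2_plus_def)
  have w: "w \<in> L2_torus" "\<And>k. fourier_coeff w k = \<i> * of_int k * fourier_coeff h k"
    using is_weak_deriv_weak_deriv[OF h] by (auto simp: is_weak_deriv_def w_def)
  have lax: "lax u \<epsilon> h = (\<lambda>x. (- \<i> * of_real \<epsilon>) * w x - szego f x)"
    by (simp add: lax_def w_def f_def[abs_def])
  have iw: "integrable torus (\<lambda>x. (- \<i> * of_real \<epsilon>) * w x)" using L2_integrable[OF w(1)] by simp
  have ilax: "integrable torus (lax u \<epsilon> h)" unfolding lax using iw L2_integrable[OF szL2(1)] by simp
  have ih: "integrable torus (\<lambda>x. of_real \<mu> * h x)" using L2_integrable[OF hL2(1)] by simp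
  have lax_coeff: "fourier_coeff (lax u \<epsilon> h) k = of_real \<epsilon> * of_int k * fourier_coeff h k
    - fourier_coeff (szego f) k" for k
  proof -
    have "fourier_coeff (lax u \<epsilon> h) k = fourier_coeff (\<lambda>x. (- \<i> * of_real \<epsilon>) * w x) k
      - fourier_coeff (szego f) k"
      unfolding lax by (rule fourier_coeff_diff[OF iw L2_integrable[OF szL2(1)]])
    moreover have "- \<i> * of_real \<epsilon> * (\<i> * of_int k * fourier_coeff h k)
      = - (\<i> * \<i>) * (of_real \<epsilon> * of_int k * fourier_coeff h k)"
      by algebra
    ultimately show ?thesis unfolding fourier_coeff_scale w(2) by simp
  qed
  have "(AE x in torus. lax u \<epsilon> h x = of_real \<mu> * h x) \<longleftrightarrow>
      (\<forall>k. fourier_coeff (lax u \<epsilon> h) k = of_real \<mu> * fourier_coeff h k)"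
  proof
    assume "AE x in torus. lax u \<epsilon> h x = of_real \<mu> * h x"
    then show "\<forall>k. fourier_coeff (lax u \<epsilon> h) k = of_real \<mu> * fourier_coeff h k"
      using fourier_coeff_cong_AE[of "lax u \<epsilon> h" "\<lambda>x. of_real \<mu> * h x"] ilax ih
        by (auto simp: fourier_coeff_scale)
  next
    assume "\<forall>k. fourier_coeff (lax u \<epsilon> h) k = of_real \<mu> * fourier_coeff h k"
    then show "AE x in torus. lax u \<epsilon> h x = of_real \<mu> * h x"
      by (intro AE_eq_if_fourier_coeff_eq ilax ih) (simp add: fourier_coeff_scale)
  qed
  also have "\<dots> \<longleftrightarrow> (\<forall>j::nat. fourier_coeff (lax u \<epsilon> h) (int j) = of_real \<mu> * fourier_coeff h (int j))"
  proof (intro iffI allI)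
    fix k
    assume *: "\<forall>j::nat. fourier_coeff (lax u \<epsilon> h) (int j) = of_real \<mu> * fourier_coeff h (int j)"
    show "fourier_coeff (lax u \<epsilon> h) k = of_real \<mu> * fourier_coeff h k"
    proof (cases "k \<ge> 0")
      case True
      then show ?thesis using *[rule_format, of "nat k"] by simp
    next
      case False
      then show ?thesis by (simp add: lax_coeff hL2(2) szL2(2))
    qed
  qed simp
  finally show ?thesis by (simp add: lax_coeff sz(2) fj a_def)
qed

text \<open>Bootstrap: a bounded solution is \<open>O(1/j)\<close>, hence \<open>O(1/j\<^sup>2)\<close> and summable; its convolution
  with the summable coefficients is then summable too, and so is \<open>j a\<^sub>j\<close>. The point is that the
  eigenfunction and its weak derivative are uniformly convergent series.\<close>

lemma eigenvector_decay:
  fixes a :: "nat \<Rightarrow> complex"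
  assumes a1: "\<And>j. cmod (a j) \<le> 1"
    and eq: "\<And>j. of_real (\<epsilon> * real j) * a j - (\<Sum>m. u_coeff u (int j - int m) * a m) = of_real \<mu> * a j"
  shows "summable (\<lambda>j. (1 + real j) * cmod (a j))"
proof -
  define c where "c = u_coeff u"
  define d where "d j = (\<Sum>m. c (int j - int m) * a m)" for j
  define W where "W = (\<Sum>\<^sub>\<infinity>k. (1 + \<bar>of_int k\<bar>) * cmod (c k))"
  define E where "E = \<bar>\<mu>\<bar> + \<epsilon>"
  have E: "E \<ge> 0" using eps by (simp add: E_def)
  have W: "(\<Sum>k\<in>F. (1 + \<bar>of_int k\<bar>) * cmod (c k)) \<le> W" if "finite F" for F
    unfolding W_def c_def using that u_coeff_weighted_summable[OF C3] by (intro finite_sum_le_infsum) auto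
  have row: "(\<Sum>m<N. (1 + \<bar>of_int (int j - int m)\<bar>) * cmod (c (int j - int m))) \<le> W" for j N
    by (rule sum_inj_le[of "\<lambda>k. (1 + \<bar>of_int k\<bar>) * cmod (c k)", OF W]) (auto simp: inj_on_def)
  have W0: "W \<ge> 0" using W[of "{}"] by simp
  \<comment> \<open>If the entries scaled by \<open>t\<close> grow no faster than the weight
    \<open>1 + \<bar>j - m\<bar>\<close>, the weighted sum \<open>W\<close> absorbs the growth. It
    is used with \<open>t = 1\<close> and with \<open>t = 1 + j\<close>.\<close>
  have dbound: "t * cmod (d j) \<le> W * K"
    if t: "t \<ge> 0" "\<And>m. t * cmod (a m) \<le> (1 + \<bar>of_int (int j - int m)\<bar>) * K" and K: "K \<ge> 0" for t K j
  proof -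
    have termwise: "t * cmod (c (int j - int m) * a m) \<le> (1 + \<bar>of_int (int j - int m)\<bar>)
      * cmod (c (int j - int m)) * K" for m
      using mult_left_mono[OF t(2)[of m], of "cmod (c (int j - int m))"] by (simp add: norm_mult mult_ac)
    have psum: "(\<Sum>m<N. t * cmod (c (int j - int m) * a m)) \<le> W * K" for N
    proof -
      have "(\<Sum>m<N. t * cmod (c (int j - int m) * a m))
        \<le> (\<Sum>m<N. (1 + \<bar>of_int (int j - int m)\<bar>) * cmod (c (int j - int m))) * K"
        unfolding sum_distrib_right by (intro sum_mono termwise)
      also have "\<dots> \<le> W * K" using K row by (intro mult_right_mono)
      finally show ?thesis .
    qed
    have s: "summable (\<lambda>m. cmod (c (int j - int m) * a m))"
    proof (rule summableI_nonneg_bounded)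
      fix N
      have "(\<Sum>m<N. cmod (c (int j - int m) * a m))
        \<le> (\<Sum>m<N. (1 + \<bar>of_int (int j - int m)\<bar>) * cmod (c (int j - int m)))"
      proof (rule sum_mono)
        fix m
        have "cmod (c (int j - int m)) * cmod (a m)
          \<le> cmod (c (int j - int m)) * (1 + \<bar>of_int (int j - int m)\<bar>)"
          using a1[of m] by (intro mult_left_mono) (auto intro: order.trans)
        then show "cmod (c (int j - int m) * a m) \<le> (1 + \<bar>of_int (int j - int m)\<bar>) * cmod (c (int j - int m))"
          by (simp add: norm_mult mult.commute)
      qed
      then show "(\<Sum>m<N. cmod (c (int j - int m) * a m)) \<le> W" using row order.trans by blast
    qed simp
    have "t * cmod (d j) \<le> t * (\<Sum>m. cmod (c (int j - int m) * a m))"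
      unfolding d_def by (intro mult_left_mono summable_norm s t)
    also have "\<dots> = (\<Sum>m. t * cmod (c (int j - int m) * a m))" using s by (rule suminf_mult[symmetric])
    also have "\<dots> \<le> W * K" using s psum by (intro suminf_le_const summable_mult) auto
    finally show ?thesis .
  qed
  \<comment> \<open>Adding \<open>\<epsilon> a j\<close> to both sides of the equation turns the
    factor \<open>j\<close> into \<open>1 + j\<close>, which never vanishes.\<close>
  have star: "(1 + real j) * cmod (a j) \<le> (cmod (d j) + E * cmod (a j)) / \<epsilon>" for j
  proof -
    have "of_real (\<epsilon> * (1 + real j)) * a j = d j + of_real (\<mu> + \<epsilon>) * a j"
      using eq[of j] by (simp add: d_def c_def algebra_simps)
    then have "\<epsilon> * (1 + real j) * cmod (a j) = cmod (d j + of_real (\<mu> + \<epsilon>) * a j)"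
      using eps by (metis abs_of_nonneg add_nonneg_nonneg less_imp_le mult_nonneg_nonneg norm_mult
        norm_of_real of_nat_0_le_iff zero_le_one)
    also have "\<dots> \<le> cmod (d j) + \<bar>\<mu> + \<epsilon>\<bar> * cmod (a j)"
      using norm_triangle_ineq[of "d j" "of_real (\<mu> + \<epsilon>) * a j"] by (simp add: norm_mult del: of_real_add)
    also have "\<dots> \<le> cmod (d j) + E * cmod (a j)"
      using eps by (intro add_left_mono mult_right_mono) (auto simp: E_def)
    finally show ?thesis using eps by (simp add: pos_le_divide_eq mult_ac)
  qed
  define C1 where "C1 = (W + E) / \<epsilon>"
  have C1: "C1 \<ge> 0" using W0 E eps by (simp add: C1_def)
  have step1: "(1 + real j) * cmod (a j) \<le> C1" for j
  proof -
    have "cmod (d j) \<le> W" using dbound[of 1 j 1] a1 by (force intro: order.trans)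
    moreover have "E * cmod (a j) \<le> E" using a1[of j] E by (intro mult_left_le) auto
    ultimately show ?thesis using star[of j] eps unfolding C1_def
      by (meson add_mono divide_right_mono less_imp_le order.trans)
  qed
  have step2: "(1 + real j) * cmod (d j) \<le> W * C1" for j
  proof (rule dbound)
    fix m
    \<comment> \<open>The weight at \<open>j\<close> splits into the weight of the distance to
      \<open>m\<close>, absorbed by \<open>W\<close>, and the weight at \<open>m\<close>, absorbed
      by \<open>step1\<close>.\<close>
    have "1 + real j \<le> (1 + \<bar>of_int (int j - int m)\<bar>) * (1 + real m)"
    proof -
      have "1 + real j \<le> 1 + \<bar>of_int (int j - int m)\<bar> + real m" by simp
      also have "\<dots> \<le> (1 + \<bar>of_int (int j - int m)\<bar>) * (1 + real m)" by (simp add: algebra_simps)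
      finally show ?thesis .
    qed
    then have "(1 + real j) * cmod (a m) \<le> (1 + \<bar>of_int (int j - int m)\<bar>) * (1 + real m) * cmod (a m)"
      by (rule mult_right_mono) simp
    also have "\<dots> \<le> (1 + \<bar>of_int (int j - int m)\<bar>) * C1"
      using step1[of m] by (simp only: mult.assoc) (intro mult_left_mono, auto)
    finally show "(1 + real j) * cmod (a m) \<le> (1 + \<bar>of_int (int j - int m)\<bar>) * C1" .
  qed (use C1 in auto)
  have sa: "summable (\<lambda>j. cmod (a j))"
  proof (rule summable_comparison_test)
    define C2 where "C2 = (W * C1 + E * C1) / \<epsilon>"
    have "cmod (a j) \<le> C2 * inverse (real (Suc j) ^ 2)" for j
    proof -
      have "(1 + real j) * ((1 + real j) * cmod (a j)) \<le> (1 + real j) * ((cmod (d j) + E * cmod (a j)) / \<epsilon>)"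
        by (intro mult_left_mono star) simp
      also have "\<dots> = ((1 + real j) * cmod (d j) + E * ((1 + real j) * cmod (a j))) / \<epsilon>"
        by (simp add: algebra_simps add_divide_distrib)
      also have "\<dots> \<le> C2" unfolding C2_def
        using step1[of j] step2[of j] E eps by (intro divide_right_mono add_mono mult_left_mono) auto
      finally have "real (Suc j) ^ 2 * cmod (a j) \<le> C2" by (simp add: power2_eq_square mult.assoc)
      then show ?thesis by (simp add: field_simps)
    qed
    then show "\<exists>N. \<forall>n\<ge>N. norm (cmod (a n)) \<le> C2 * inverse (real (Suc n) ^ 2)" by simp
    have "summable (\<lambda>n::nat. inverse (real n ^ 2))" by (rule inverse_power_summable) simp
    then have "summable (\<lambda>n::nat. inverse (real (Suc n) ^ 2))" by (subst summable_Suc_iff)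
    then show "summable (\<lambda>n. C2 * inverse (real (Suc n) ^ 2))" by (rule summable_mult)
  qed
  have sd: "summable (\<lambda>j. cmod (d j))"
    unfolding d_def c_def by (rule summable_convolution[OF sa u_coeff_summable[OF C3]]) (simp add: inj_def)
  show ?thesis
  proof (rule summable_comparison_test)
    show "\<exists>N. \<forall>n\<ge>N. norm ((1 + real n) * cmod (a n)) \<le> (cmod (d n) + E * cmod (a n)) / \<epsilon>"
      using star by (auto simp: abs_mult)
    show "summable (\<lambda>n. (cmod (d n) + E * cmod (a n)) / \<epsilon>)"
      using sa sd by (intro summable_divide summable_add summable_mult)
  qed
qed

text \<open>In one direction the coefficients of an eigenfunction are summable and solve the matrix
  equation. In the other, the decay of the limit eigenvector makes its series and the formal
  derivative continuous, which puts the sum into the domain.\<close>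

lemma lax_eigenvalues_eq: "lax_eigenvalues u \<epsilon> = range (limit_ev (u_coeff u) \<epsilon>)"
proof (intro set_eqI iffI)
  fix \<mu> assume "\<mu> \<in> lax_eigenvalues u \<epsilon>"
  then obtain h where h: "h \<in> H1_plus" "\<not> (AE x in torus. h x = 0)" "AE x in torus. lax u \<epsilon> h x
    = of_real \<mu> * h x"
    by (auto simp: lax_eigenvalues_def)
  have hL2: "h \<in> L2_torus" "\<And>k. k < 0 \<Longrightarrow> fourier_coeff h k = 0" using h(1)
    by (auto simp: H1_plus_def L2_plus_def)
  have "\<exists>k. fourier_coeff h k \<noteq> 0"
    using h(2) fourier_uniqueness[OF L2_integrable[OF hL2(1)]] by blast
  then obtain k where k: "fourier_coeff h k \<noteq> 0" by blast
  then have "k \<ge> 0" using hL2(2)[of k] by force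
  then have "fourier_coeff h (int (nat k)) \<noteq> 0" using k by simp
  then show "\<mu> \<in> range (limit_ev (u_coeff u) \<epsilon>)"
    using eigenvalue_is_evl[of "\<lambda>n. fourier_coeff h (int n)" "nat k" \<mu>] H1_plus_coeff_summable[OF h(1)]
      h(3)[unfolded lax_eigen_iff[OF h(1)]] by blast
next
  fix \<mu> assume "\<mu> \<in> range (limit_ev (u_coeff u) \<epsilon>)"
  then obtain k where \<mu>: "\<mu> = limit_ev (u_coeff u) \<epsilon> k" by blast
  obtain a where a: "\<And>j. cmod (a j) \<le> 1" "\<exists>j. a j \<noteq> 0"
    "\<And>j. of_real (\<epsilon> * real j) * a j - (\<Sum>m. u_coeff u (int j - int m) * a m) = of_real \<mu> * a j"
    using evl_eigenvector[of k] unfolding \<mu> by blast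
  have sw: "summable (\<lambda>j. (1 + real j) * cmod (a j))" by (rule eigenvector_decay[OF a(1,3)])
  have sa: "summable (\<lambda>j. cmod (a j))"
    by (rule summable_comparison_test[OF _ sw]) (auto simp: distrib_right)
  have sd: "summable (\<lambda>j. cmod (\<i> * of_nat j * a j))"
    by (rule summable_comparison_test[OF _ sw]) (auto simp: norm_mult distrib_right)
  define h where "h = trig_series a int"
  define g where "g = trig_series (\<lambda>j. \<i> * of_nat j * a j) int"
  have hL2: "h \<in> L2_torus" unfolding h_def
    by (rule L2_bounded[OF measurable_trig_series[OF sa] trig_series_bound[OF sa]])
  have gL2: "g \<in> L2_torus" unfolding g_def
    by (rule L2_bounded[OF measurable_trig_series[OF sd] trig_series_bound[OF sd]])
  have hj: "fourier_coeff h (int j) = a j" for j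
    unfolding h_def by (rule fourier_coeff_trig_series_in[OF sa]) (simp add: inj_def)
  have gj: "fourier_coeff g (int j) = \<i> * of_nat j * a j" for j
    unfolding g_def by (rule fourier_coeff_trig_series_in[OF sd]) (simp add: inj_def)
  have neg: "fourier_coeff h k = 0" "fourier_coeff g k = 0" if "k < 0" for k
    unfolding h_def g_def using that
    by (auto intro!: fourier_coeff_trig_series_notin[OF sa] fourier_coeff_trig_series_notin[OF sd])
  have "fourier_coeff g k = \<i> * of_int k * fourier_coeff h k" for k
  proof (cases "k \<ge> 0")
    case True
    then show ?thesis using hj[of "nat k"] gj[of "nat k"] by simp
  next
    case False
    then show ?thesis by (simp add: neg)
  qed
  then have H1: "h \<in> H1_plus"
    using hL2 gL2 neg by (auto simp: H1_plus_def L2_plus_def is_weak_deriv_def)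
  have "\<not> (AE x in torus. h x = 0)"
  proof
    assume "AE x in torus. h x = 0"
    then have "fourier_coeff h k = fourier_coeff (\<lambda>_. 0) k" for k
      using hL2 by (intro fourier_coeff_cong_AE) (auto simp: L2_torus_def)
    then show False using a(2) hj by (simp add: fourier_coeff_mode)
  qed
  moreover have "AE x in torus. lax u \<epsilon> h x = of_real \<mu> * h x"
    unfolding lax_eigen_iff[OF H1] hj using a(3) by blast
  ultimately show "\<mu> \<in> lax_eigenvalues u \<epsilon>" using H1 by (auto simp: lax_eigenvalues_def)
qed

text \<open>The gap inequality makes the limits strictly increasing, and a strictly increasing
  enumeration of a set is unique; this evaluates the \<open>THE\<close> in
  \<open>lax_ev\<close>.\<close>

lemma lax_ev_eq: "lax_ev u \<epsilon> = limit_ev (u_coeff u) \<epsilon>"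
  unfolding lax_ev_def lax_eigenvalues_eq
proof (rule the_equality)
  show "strict_mono (limit_ev (u_coeff u) \<epsilon>) \<and> range (limit_ev (u_coeff u) \<epsilon>)
    = range (limit_ev (u_coeff u) \<epsilon>)"
    using evl_strict_mono by blast
  show "l = limit_ev (u_coeff u) \<epsilon>"
    if "strict_mono l \<and> range l = range (limit_ev (u_coeff u) \<epsilon>)" for l
    using that evl_strict_mono by (intro strict_mono_enumeration_unique) auto
qed

end

section \<open>The distribution function\<close>

lemma abs_max_0_diff_le: "\<bar>max 0 a - max 0 b\<bar> \<le> \<bar>a - b\<bar>" for a b :: real
  by (auto simp: max_def)

text \<open>The phase-space volume up to energy \<open>x\<close>, normalised by
  \<open>2 \<pi>\<close>; by the layer-cake formula it is also the integral of the distribution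
  function from \<open>- x\<close> to \<open>max u\<close>.\<close>

definition weyl_fun :: "(real \<Rightarrow> real) \<Rightarrow> real \<Rightarrow> real" where
  "weyl_fun u x = (\<integral>y. max 0 (x + u y) \<partial>torus) / (2 * pi)"

context
  fixes u :: "real \<Rightarrow> real"
  assumes C3: "C3_periodic u"
begin

lemma bdd_above_u: "bdd_above (range u)" and bdd_below_u: "bdd_below (range u)"
proof -
  obtain U where "U > 0" "\<And>x. \<bar>u x\<bar> \<le> U" by (rule u_bounded[OF C3]) blast
  then have "u x \<le> U" "- U \<le> u x" for x by (auto simp: abs_le_iff minus_le_iff)
  then show "bdd_above (range u)" "bdd_below (range u)"
    by (auto intro!: bdd_aboveI2 bdd_belowI2)
qed

lemma u_le_SUP: "u x \<le> (SUP x. u x)"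
  by (intro cSUP_upper bdd_above_u) simp

lemma INF_le_u: "(INF x. u x) \<le> u x"
  by (intro cINF_lower bdd_below_u) simp

lemma integrable_max_u: "integrable torus (\<lambda>y. max 0 (x + u y))"
  by (intro integrable_torus_continuous continuous_intros continuous_u[OF C3])

lemma weyl_fun_mono: "x \<le> y \<Longrightarrow> weyl_fun u x \<le> weyl_fun u y"
  unfolding weyl_fun_def
  by (intro divide_right_mono integral_mono integrable_max_u) auto

lemma weyl_fun_lipschitz: "\<bar>weyl_fun u x - weyl_fun u y\<bar> \<le> \<bar>x - y\<bar>"
proof -
  have le: "weyl_fun u y \<le> weyl_fun u x + (y - x)" if "x \<le> y" for x y
  proof -
    have "(\<integral>z. max 0 (y + u z) \<partial>torus) \<le> (\<integral>z. max 0 (x + u z) + (y - x) \<partial>torus)"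
      using that integrable_max_u[of x] by (intro integral_mono integrable_max_u) auto
    also have "\<dots> = (\<integral>z. max 0 (x + u z) \<partial>torus) + (y - x) * (2 * pi)"
      using integrable_max_u[of x] measure_torus by simp
    finally show ?thesis by (simp add: weyl_fun_def field_simps)
  qed
  show ?thesis using le[of x y] le[of y x] weyl_fun_mono[of x y] weyl_fun_mono[of y x] by linarith
qed

lemma weyl_fun_eq:
  assumes mean: "(LBINT x:{0..2*pi}. u x) = 0" and x: "- (INF x. u x) \<le> x"
  shows "weyl_fun u x = x"
proof -
  have "(\<integral>y. u y \<partial>torus) = 0" using mean by (simp add: integral_torus_eq set_lebesgue_integral_def)
  moreover have "integrable torus u" by (intro integrable_torus_continuous continuous_u[OF C3])
  moreover have "max 0 (x + u y) = x + u y" for y using INF_le_u[of y] x by simp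
  ultimately show ?thesis using measure_torus by (simp add: weyl_fun_def)
qed

lemma weyl_fun_riemann_sum:
  obtains K where "\<And>B x. B > 0 \<Longrightarrow> \<bar>(\<Sum>r<B. max 0 (x + u (node B r))) / real B - weyl_fun u x\<bar> \<le> K / real B"
proof -
  obtain K where "K > 0" and K: "\<And>x y. \<bar>u x - u y\<bar> \<le> K * \<bar>x - y\<bar>"
    by (rule u_lipschitz[OF C3]) blast
  have "\<bar>(\<Sum>r<B. max 0 (x + u (node B r))) / real B - weyl_fun u x\<bar> \<le> 2 * pi * K / real B" if "B > 0" for B x
    unfolding weyl_fun_def
  proof (rule riemann_sum_error[OF that])
    show "\<bar>max 0 (x + u y) - max 0 (x + u z)\<bar> \<le> K * \<bar>y - z\<bar>" for y z
    proof -
      have "\<bar>max 0 (x + u y) - max 0 (x + u z)\<bar> \<le> \<bar>(x + u y) - (x + u z)\<bar>" by (rule abs_max_0_diff_le)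
      also have "\<dots> = \<bar>u y - u z\<bar>" by simp
      also have "\<dots> \<le> K * \<bar>y - z\<bar>" by (rule K)
      finally show ?thesis .
    qed
  qed
  then show ?thesis using that by blast
qed

text \<open>Fubini for the region under the graph of \<open>u\<close> between the heights
  \<open>- x\<close> and \<open>max u\<close>: slices at fixed height have length
  \<open>2 \<pi> F\<close>, slices at fixed \<open>y\<close> the positive part of
  \<open>x + u y\<close>. The region is compact, which settles integrability.\<close>

lemma integral_distrib_fun:
  "(LBINT \<eta> = ereal (- x) .. ereal (SUP x. u x). distrib_fun u \<eta>) = weyl_fun u x"
proof (cases "- x \<le> (SUP x. u x)")
  case False
  \<comment> \<open>If \<open>- x\<close> exceeds the maximum, the integral runs backwards over
    heights at which \<open>F\<close> vanishes, and the positive part is 0 as well.\<close>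
  have F0: "distrib_fun u \<eta> = 0" if "\<eta> > (SUP x. u x)" for \<eta>
  proof -
    have empty: "{x \<in> {0..2*pi}. \<eta> \<le> u x} = {}" using that u_le_SUP
      by (auto simp: not_le intro: le_less_trans)
    show ?thesis unfolding distrib_fun_def empty by simp
  qed
  have "max 0 (x + u y) = 0" for y using u_le_SUP[of y] False by simp
  then have "weyl_fun u x = 0" by (simp add: weyl_fun_def)
  moreover have "(LBINT \<eta>:einterval (SUP x. u x) (- x). distrib_fun u \<eta>)
    = (LBINT \<eta>:einterval (SUP x. u x) (- x). 0)"
    by (rule set_lebesgue_integral_cong) (auto simp: F0 einterval_def)
  ultimately show ?thesis using False by (simp add: interval_lebesgue_integral_def set_lebesgue_integral_def)
next
  case True
  define M where "M = (SUP x. u x)"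
  define S where "S = {(\<eta>, y). \<eta> \<in> {- x..M} \<and> y \<in> {0..2*pi} \<and> \<eta> \<le> u y}"
  have "S = ({- x..M} \<times> {0..2*pi}) \<inter> {p. fst p \<le> u (snd p)}" by (auto simp: S_def)
  moreover have "closed {p. fst p \<le> u (snd p)}"
    by (intro closed_Collect_le continuous_intros continuous_on_compose2[OF continuous_u[OF C3, of UNIV]])
      auto
  ultimately have cS: "compact S" by (auto intro!: compact_Int_closed compact_Times)
  have intS: "integrable (lborel \<Otimes>\<^sub>M lborel) (indicator S :: real \<times> real \<Rightarrow> real)"
    unfolding lborel_prod using emeasure_compact_finite[OF cS] cS
      by (intro integrable_real_indicator) (auto simp: borel_compact)
  have ind: "indicator S (\<eta>, y)
    = (indicator {- x..M} \<eta> * indicator {0..2*pi} y * indicator {..u y} \<eta> :: real)" for \<eta> y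
    by (auto simp: S_def indicator_def)
  have "(\<integral>y. (\<integral>\<eta>. indicator S (\<eta>, y) \<partial>lborel) \<partial>lborel)
    = (\<integral>\<eta>. (\<integral>y. indicator S (\<eta>, y) \<partial>lborel) \<partial>lborel :: real)"
    by (rule lborel_pair.Fubini_integral) (use intS in \<open>simp add: case_prod_eta\<close>)
  moreover have "(\<integral>\<eta>. indicator S (\<eta>, y) \<partial>lborel) = (indicator {0..2*pi} y * max 0 (x + u y) :: real)" for y
  proof -
    have "(\<lambda>\<eta>. indicator S (\<eta>, y) :: real) = (\<lambda>\<eta>. indicator {0..2*pi} y * indicator {- x..u y} \<eta>)"
      unfolding ind using u_le_SUP[of y] by (auto simp: fun_eq_iff M_def indicator_def)
    then have "(\<integral>\<eta>. indicator S (\<eta>, y) \<partial>lborel) = (indicator {0..2*pi} y * measure lborel {- x..u y} :: real)"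
      by simp
    also have "measure lborel {- x..u y} = max 0 (x + u y)"
      by (cases "- x \<le> u y") auto
    finally show ?thesis .
  qed
  moreover have "(\<integral>y. indicator S (\<eta>, y) \<partial>lborel)
    = (indicator {- x..M} \<eta> * (2 * pi * distrib_fun u \<eta>) :: real)" for \<eta>
  proof -
    have "closed ({0..2*pi} \<inter> {y. \<eta> \<le> u y})"
      by (intro closed_Int closed_Collect_le continuous_intros continuous_u[OF C3])
    moreover have "{y \<in> {0..2*pi}. \<eta> \<le> u y} = {0..2*pi} \<inter> {y. \<eta> \<le> u y}" by auto
    ultimately have m: "{y \<in> {0..2*pi}. \<eta> \<le> u y} \<in> sets lborel" by (simp only: sets_lborel borel_closed)
    have "(\<lambda>y. indicator S (\<eta>, y) :: real)
      = (\<lambda>y. indicator {- x..M} \<eta> * indicator {y \<in> {0..2*pi}. \<eta> \<le> u y} y)"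
      unfolding ind by (auto simp: fun_eq_iff indicator_def)
    then show ?thesis using m by (simp add: distrib_fun_def)
  qed
  ultimately have "(\<integral>y. indicator {0..2*pi} y * max 0 (x + u y) \<partial>lborel)
    = 2 * pi * (\<integral>\<eta>. indicator {- x..M} \<eta> * distrib_fun u \<eta> \<partial>lborel)"
    by (simp add: mult.left_commute)
  then have "weyl_fun u x = (LBINT \<eta>:{- x..M}. distrib_fun u \<eta>)"
    by (simp add: weyl_fun_def integral_torus_eq set_lebesgue_integral_def)
  then show ?thesis using True unfolding M_def by (subst interval_integral_Icc) auto
qed

text \<open>For bounded \<open>n \<epsilon>\<close>, a deviation beyond \<open>2 d\<close> survives
  a shift of the argument by \<open>d\<close>, as \<open>weyl_fun\<close> is 1-Lipschitz, and
  \<open>weyl_law\<close> at the shifted argument would put the eigenvalue above or below itself.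
  For large \<open>n\<close> the eigenvalue is squeezed between \<open>n \<epsilon> - d\<close> and
  \<open>n \<epsilon>\<close>, where \<open>weyl_fun\<close> is the identity.\<close>

lemma uniform_weyl_law:
  assumes mean: "(LBINT x:{0..2*pi}. u x) = 0" and "\<delta> > 0"
  shows "\<exists>\<epsilon>0>0. \<forall>\<epsilon>. 0 < \<epsilon> \<longrightarrow> \<epsilon> < \<epsilon>0 \<longrightarrow> (\<forall>n. \<bar>weyl_fun u (lax_ev u \<epsilon> n) - real n * \<epsilon>\<bar> \<le> \<delta>)"
proof -
  obtain U where U: "U > 0" "\<And>x. \<bar>u x\<bar> \<le> U" by (rule u_bounded[OF C3]) blast
  obtain K where K: "\<And>B x. B > 0 \<Longrightarrow> \<bar>(\<Sum>r<B. max 0 (x + u (node B r))) / real B - weyl_fun u x\<bar> \<le> K / real B"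
    by (rule weyl_fun_riemann_sum) blast
  define d where "d = min 1 (\<delta> / 2)"
  have d: "d > 0" "d \<le> 1" "2 * d \<le> \<delta>" using \<open>\<delta> > 0\<close> by (auto simp: d_def)
  \<comment> \<open>From \<open>U\<close> on, \<open>weyl_fun\<close> is the identity; the margin
    allows for the shift by \<open>d \<le> 1\<close>. The further 2 in the use of
    \<open>weyl_law\<close> covers the arguments \<open>evl n + d\<close> and
    \<open>k \<epsilon> - d\<close> that exceed \<open>\<Lambda>\<close>.\<close>
  define \<Lambda> where "\<Lambda> = U + 2"
  have INF: "- (INF x. u x) \<le> U"
  proof -
    have "- U \<le> (INF x. u x)" using U(2) by (intro cINF_greatest) (auto simp: abs_le_iff minus_le_iff)
    then show ?thesis by simp
  qed
  have "\<exists>\<epsilon>0>0. \<forall>\<epsilon>. 0 < \<epsilon> \<longrightarrow> \<epsilon> < \<epsilon>0 \<longrightarrow> (\<forall>x k. x \<le> \<Lambda> + 2 \<longrightarrow>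
     (weyl_fun u x + d \<le> real k * \<epsilon> \<longrightarrow> x \<le> limit_ev (u_coeff u) \<epsilon> k) \<and>
     (real k * \<epsilon> \<le> weyl_fun u x - d \<longrightarrow> limit_ev (u_coeff u) \<epsilon> k \<le> x))"
    by (rule weyl_law[where u = u and U = U and K = K])
      (use lax_matrix_u[OF C3 mean] u_truncation[OF C3] U K d in \<open>auto simp: \<Lambda>_def\<close>)
  then obtain \<epsilon>1 where \<epsilon>1: "\<epsilon>1 > 0"
    "\<And>\<epsilon> x k. 0 < \<epsilon> \<Longrightarrow> \<epsilon> < \<epsilon>1 \<Longrightarrow> x \<le> \<Lambda> + 2 \<Longrightarrow> weyl_fun u x + d \<le> real k * \<epsilon> \<Longrightarrow> x \<le> limit_ev (u_coeff u) \<epsilon> k"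
    "\<And>\<epsilon> x k. 0 < \<epsilon> \<Longrightarrow> \<epsilon> < \<epsilon>1 \<Longrightarrow> x \<le> \<Lambda> + 2 \<Longrightarrow> real k * \<epsilon> \<le> weyl_fun u x - d \<Longrightarrow> limit_ev (u_coeff u) \<epsilon> k \<le> x"
    by blast
  have "\<bar>weyl_fun u (lax_ev u \<epsilon> n) - real n * \<epsilon>\<bar> \<le> \<delta>" if \<epsilon>: "0 < \<epsilon>" "\<epsilon> < min 1 \<epsilon>1" for \<epsilon> n
  proof -
    interpret lax_matrix "u_coeff u" \<epsilon> by (rule lax_matrix_u[OF C3 mean \<epsilon>(1)])
    have \<epsilon>': "\<epsilon> < \<epsilon>1" "\<epsilon> < 1" using \<epsilon> by auto
    have ev: "lax_ev u \<epsilon> = evl" by (rule lax_ev_eq[OF C3 mean \<epsilon>(1)])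
    have le: "evl n \<le> real n * \<epsilon>" by (rule evl_le)
    show ?thesis
    proof (cases "real n * \<epsilon> \<le> \<Lambda>")
      case True
      have "\<not> weyl_fun u (evl n) < real n * \<epsilon> - 2 * d"
      proof
        assume a: "weyl_fun u (evl n) < real n * \<epsilon> - 2 * d"
        have "weyl_fun u (evl n + d) + d \<le> real n * \<epsilon>"
          using a weyl_fun_lipschitz[of "evl n + d" "evl n"] d(1) by linarith
        then have "evl n + d \<le> evl n" using \<epsilon>1(2)[OF \<epsilon>(1) \<epsilon>'(1), of "evl n + d" n] le True d(2) by simp
        then show False using d(1) by simp
      qed
      moreover have "\<not> weyl_fun u (evl n) > real n * \<epsilon> + 2 * d"
      proof
        assume a: "weyl_fun u (evl n) > real n * \<epsilon> + 2 * d"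
        have "real n * \<epsilon> \<le> weyl_fun u (evl n - d) - d"
          using a weyl_fun_lipschitz[of "evl n - d" "evl n"] d(1) by linarith
        then have "evl n \<le> evl n - d" using \<epsilon>1(3)[OF \<epsilon>(1) \<epsilon>'(1), of "evl n - d" n] le True d by simp
        then show False using d(1) by simp
      qed
      ultimately show ?thesis using d(3) unfolding ev by linarith
    next
      case False
      \<comment> \<open>An index with \<open>k \<epsilon>\<close> just above
        \<open>\<Lambda>\<close>, still within reach of the Weyl law; from there the gap inequality
        carries the lower bound on to \<open>n\<close>.\<close>
      define k where "k = nat \<lceil>\<Lambda> / \<epsilon>\<rceil>"
      have L0: "\<Lambda> / \<epsilon> \<ge> 0" using U(1) \<epsilon>(1) by (simp add: \<Lambda>_def)
      have "\<Lambda> / \<epsilon> \<le> real k" "real k \<le> \<Lambda> / \<epsilon> + 1" unfolding k_def using L0 by linarith+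
      then have k: "\<Lambda> \<le> real k * \<epsilon>" "real k * \<epsilon> \<le> \<Lambda> + \<epsilon>"
        using \<epsilon>(1) by (auto simp: field_simps)
      have "k \<le> n"
      proof -
        have "\<Lambda> / \<epsilon> < real n" using False \<epsilon>(1) by (simp add: field_simps)
        then have "\<lceil>\<Lambda> / \<epsilon>\<rceil> \<le> int n" by (simp add: ceiling_le_iff)
        then show ?thesis by (simp only: k_def nat_le_iff)
      qed
      have "weyl_fun u (real k * \<epsilon> - d) = real k * \<epsilon> - d"
        using k(1) d(2) INF by (intro weyl_fun_eq mean) (simp add: \<Lambda>_def)
      then have "real k * \<epsilon> - d \<le> evl k"
        using \<epsilon>1(2)[OF \<epsilon>(1) \<epsilon>'(1), of "real k * \<epsilon> - d" k] k(2) \<epsilon>'(2) d by simp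
      then have ge: "real n * \<epsilon> - d \<le> evl n"
        using evl_add[of k "n - k"] \<open>k \<le> n\<close> by (simp add: of_nat_diff algebra_simps)
      have "weyl_fun u (evl n) = evl n"
        using ge False d(2) INF by (intro weyl_fun_eq mean) (simp add: \<Lambda>_def)
      then show ?thesis using ge le d unfolding ev by simp
    qed
  qed
  then show ?thesis using \<epsilon>1(1) by (intro exI[of _ "min 1 \<epsilon>1"]) auto
qed

lemma lax_ev_Suc:
  assumes "(LBINT x:{0..2*pi}. u x) = 0" "\<epsilon> > 0"
  shows "lax_ev u \<epsilon> k + \<epsilon> \<le> lax_ev u \<epsilon> (Suc k)"
proof -
  interpret lax_matrix "u_coeff u" \<epsilon> by (rule lax_matrix_u[OF C3 assms])
  show ?thesis using evl_Suc by (simp add: lax_ev_eq[OF C3 assms])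
qed

end

theorem corollary1p4:
  fixes u :: "real \<Rightarrow> real"
  assumes "bell_shaped u"
  shows "\<exists>C>0. \<exists>(CN :: nat \<Rightarrow> real \<Rightarrow> real) (\<epsilon>0 :: real \<Rightarrow> real).
    \<forall>N\<ge>1. \<forall>\<delta>>0. CN N \<delta> > 0 \<and> \<epsilon>0 \<delta> > 0 \<and>
      (\<forall>\<epsilon>. 0 < \<epsilon> \<and> \<epsilon> < \<epsilon>0 \<delta> \<longrightarrow>
        (\<forall>n. \<bar>(LBINT \<eta> = - lax_ev u \<epsilon> n .. (SUP x. u x). distrib_fun u \<eta>) - real n * \<epsilon>\<bar>
               \<le> C / (real N * sqrt (real N)) + CN N \<delta> * \<epsilon> * sqrt \<epsilon> + C * \<delta>) \<and>
        (\<forall>n. lax_ev u \<epsilon> n + \<epsilon> \<in> Lambda_plus u \<delta> \<longrightarrow>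
               summable (\<lambda>k. gap u \<epsilon> (n + 1 + k)) \<and>
               (\<Sum>k. gap u \<epsilon> (n + 1 + k))
                 \<le> C / (real N * sqrt (real N)) + CN N \<delta> * \<epsilon> * sqrt \<epsilon> + C * \<delta>) \<and>
        (\<forall>n p. lax_ev u \<epsilon> n + \<epsilon> \<in> Lambda_minus u \<delta> \<and> lax_ev u \<epsilon> p + \<epsilon> \<in> Lambda_plus u \<delta> \<longrightarrow>
               \<bar>real p - real n\<bar> \<ge> \<delta> / (C * \<epsilon>)))"
proof -
  have C3: "C3_periodic u" and mean: "(LBINT x:{0..2*pi}. u x) = 0"
    using assms by (auto simp: bell_shaped_def)
  \<comment> \<open>An error of \<open>\<delta>/8\<close> per eigenvalue, because the second and
    third claims compare two eigenvalues and the third also loses \<open>\<epsilon>\<close>.\<close>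
  have "\<exists>e>0. \<forall>\<epsilon>. 0 < \<epsilon> \<longrightarrow> \<epsilon> < e \<longrightarrow> (\<forall>n. \<bar>weyl_fun u (lax_ev u \<epsilon> n) - real n * \<epsilon>\<bar> \<le> \<delta> / 8)"
    if "\<delta> > 0" for \<delta>
    using uniform_weyl_law[OF C3 mean, of "\<delta> / 8"] that by simp
  then obtain e where e: "\<And>\<delta>. \<delta> > 0 \<Longrightarrow> e \<delta> > 0"
    "\<And>\<delta> \<epsilon> n. \<delta> > 0 \<Longrightarrow> 0 < \<epsilon> \<Longrightarrow> \<epsilon> < e \<delta> \<Longrightarrow> \<bar>weyl_fun u (lax_ev u \<epsilon> n) - real n * \<epsilon>\<bar> \<le> \<delta> / 8"
    by metis
  \<comment> \<open>The bound \<open>\<epsilon> < \<delta>/2\<close> turns membership of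
    \<open>l n + \<epsilon>\<close> in \<open>Lambda_plus\<close> into \<open>l n > - m\<close>,
    where \<open>weyl_fun\<close> is the identity.\<close>
  define \<epsilon>0 where "\<epsilon>0 \<delta> = min (e \<delta>) (\<delta> / 2)" for \<delta>
  define bound where "bound N \<delta> \<epsilon> = 4 / (real N * sqrt (real N)) + 1 * \<epsilon> * sqrt \<epsilon> + 4 * \<delta>" for N \<delta> \<epsilon>
  have main: "(\<forall>n. \<bar>(LBINT \<eta> = - lax_ev u \<epsilon> n .. (SUP x. u x). distrib_fun u \<eta>) - real n * \<epsilon>\<bar> \<le> bound N \<delta> \<epsilon>) \<and>
      (\<forall>n. lax_ev u \<epsilon> n + \<epsilon> \<in> Lambda_plus u \<delta> \<longrightarrow>
         summable (\<lambda>k. gap u \<epsilon> (n + 1 + k)) \<and> (\<Sum>k. gap u \<epsilon> (n + 1 + k)) \<le> bound N \<delta> \<epsilon>) \<and>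
      (\<forall>n p. lax_ev u \<epsilon> n + \<epsilon> \<in> Lambda_minus u \<delta> \<and> lax_ev u \<epsilon> p + \<epsilon> \<in> Lambda_plus u \<delta> \<longrightarrow>
         \<bar>real p - real n\<bar> \<ge> \<delta> / (4 * \<epsilon>))"
    if "\<delta> > 0" and \<epsilon>: "0 < \<epsilon>" "\<epsilon> < \<epsilon>0 \<delta>" for N :: nat and \<delta> \<epsilon>
  proof (intro conjI allI impI)
    define l where "l = lax_ev u \<epsilon>"
    define m where "m = (INF x. u x)"
    have \<epsilon>': "\<epsilon> < e \<delta>" "\<epsilon> < \<delta> / 2" using \<epsilon> by (auto simp: \<epsilon>0_def)
    have weyl: "\<bar>weyl_fun u (l n) - real n * \<epsilon>\<bar> \<le> \<delta> / 8" for n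
      unfolding l_def by (rule e(2)[OF \<open>\<delta> > 0\<close> \<epsilon>(1) \<epsilon>'(1)])
    have b: "\<delta> \<le> bound N \<delta> \<epsilon>" using \<epsilon>(1) \<open>\<delta> > 0\<close> by (simp add: bound_def add_increasing)
    have step: "l k + \<epsilon> \<le> l (Suc k)" for k unfolding l_def by (rule lax_ev_Suc[OF C3 mean \<epsilon>(1)])
    have above: "weyl_fun u (l n) = l n" "l n > - m" if "l n + \<epsilon> \<in> Lambda_plus u \<delta>" for n
      using that \<epsilon>'(2) \<open>\<delta> > 0\<close> by (auto simp: Lambda_plus_def m_def intro!: weyl_fun_eq[OF C3 mean])
    show "\<bar>(LBINT \<eta> = - lax_ev u \<epsilon> n .. (SUP x. u x). distrib_fun u \<eta>) - real n * \<epsilon>\<bar> \<le> bound N \<delta> \<epsilon>" for n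
      using weyl[of n] b \<open>\<delta> > 0\<close> unfolding integral_distrib_fun[OF C3] l_def by linarith
    show "summable (\<lambda>k. gap u \<epsilon> (n + 1 + k))" "(\<Sum>k. gap u \<epsilon> (n + 1 + k)) \<le> bound N \<delta> \<epsilon>"
      if n: "lax_ev u \<epsilon> n + \<epsilon> \<in> Lambda_plus u \<delta>" for n
    proof -
      have g: "gap u \<epsilon> (n + 1 + k) = l (n + Suc k) - l (n + k) - \<epsilon>" for k
        by (simp add: gap_def l_def)
      have ln: "l n \<le> l (n + k)" for k
      proof (induction k)
        case (Suc k)
        then show ?case using step[of "n + k"] \<epsilon>(1) by simp
      qed simp
      \<comment> \<open>The sum telescopes to the difference of \<open>l j - j \<epsilon>\<close> at
        two indices. Both eigenvalues lie above \<open>- m\<close>, where these quantities are the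
        errors in the Weyl law.\<close>
      have partial: "(\<Sum>k<K. gap u \<epsilon> (n + 1 + k)) \<le> \<delta>" for K
      proof -
        have "(\<Sum>k<K. gap u \<epsilon> (n + 1 + k)) = (l (n + K) - real (n + K) * \<epsilon>) - (l n - real n * \<epsilon>)"
          unfolding g by (induction K) (simp_all add: algebra_simps)
        moreover have "weyl_fun u (l (n + K)) = l (n + K)"
          using above(2)[of n] n ln[of K] by (intro weyl_fun_eq[OF C3 mean]) (simp add: l_def m_def)
        ultimately show ?thesis
          using weyl[of "n + K"] weyl[of n] above(1)[of n] n \<open>\<delta> > 0\<close> unfolding l_def[symmetric] by linarith
      qed
      show s: "summable (\<lambda>k. gap u \<epsilon> (n + 1 + k))"
        proof (rule summableI_nonneg_bounded[OF _ partial])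
        show "0 \<le> gap u \<epsilon> (n + 1 + k)" for k unfolding g using step[of "n + k"] by simp
      qed
      show "(\<Sum>k. gap u \<epsilon> (n + 1 + k)) \<le> bound N \<delta> \<epsilon>"
        using suminf_le_const[OF s partial] b by linarith
    qed
    show "\<bar>real p - real n\<bar> \<ge> \<delta> / (4 * \<epsilon>)"
      if np: "lax_ev u \<epsilon> n + \<epsilon> \<in> Lambda_minus u \<delta> \<and> lax_ev u \<epsilon> p + \<epsilon> \<in> Lambda_plus u \<delta>" for n p
    proof -
      have "l n \<le> - m" using np \<epsilon>(1) \<open>\<delta> > 0\<close> by (simp add: Lambda_minus_def l_def m_def)
      then have "weyl_fun u (l n) \<le> weyl_fun u (- m)" by (rule weyl_fun_mono[OF C3])
      also have "\<dots> = - m" by (rule weyl_fun_eq[OF C3 mean]) (simp add: m_def)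
      finally have "weyl_fun u (l n) \<le> - m" .
      moreover have "l p \<ge> - m + \<delta> - \<epsilon>" using np by (simp add: Lambda_plus_def l_def m_def)
      \<comment> \<open>The distance \<open>\<delta> - \<epsilon> > \<delta>/2\<close>, less two
        errors of \<open>\<delta>/8\<close>, leaves \<open>\<delta>/4\<close>; this is the origin of
        the constant 4.\<close>
      ultimately have "\<delta> / 4 \<le> real p * \<epsilon> - real n * \<epsilon>"
        using weyl[of n] weyl[of p] above(1)[of p] np \<epsilon>'(2) \<open>\<delta> > 0\<close> unfolding l_def[symmetric] by linarith
      then have "\<delta> / (4 * \<epsilon>) \<le> real p - real n" using \<epsilon>(1) by (simp add: field_simps)
      then show ?thesis by linarith
    qed
  qed
  have pos: "\<epsilon>0 \<delta> > 0" if "\<delta> > 0" for \<delta> using e(1)[OF that] that by (simp add: \<epsilon>0_def)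
  show ?thesis
    using main pos unfolding bound_def
    by (intro exI[of _ 4] conjI exI[of _ "\<lambda>_ _. 1"] exI[of _ \<epsilon>0]) simp_all
qed

end
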